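(* Let $Q\ne 0$ be real and let $V(z)$ belong to the class $\mathfrak M^Q$, i.e. $$V(z)=Q+\int_{\mathbb R}\left(\frac{1}{\lambda-z}-\frac{\lambda}{1+\lambda^2}\right)d\mu(\lambda),\qquad \int_{\mathbb R}\frac{d\mu(\lambda)}{1+\lambda^2}=1,$$ where $\mu$ is an infinite Borel measure on $\mathbb R$. Then $V(z)$ can be realized as the impedance function $V_\Theta(z)$ of a minimal L-system $\Theta$ (with one-dimensional input-output space $\mathbb C$ and $J=1$) whose main operator $T$ has von Neumann parameter $$\kappa=\frac{|Q|}{\sqrt{Q^2+4}}.$$ Moreover, the quasi-kernel $\hat A$ of $\mathrm{Re}\,\mathbb A$ of the realizing L-system $\Theta$ has the unimodular von Neumann parameter $$U=\frac{Q}{|Q|}\cdot\frac{-Q+2i}{\sqrt{Q^2+4}}.$$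
   Context: Rigged space: for a closed densely defined symmetric operator $\dot A$ with deficiency indices $(1,1)$ in a complex Hilbert space $\mathcal H$, let $\mathcal H_+=\mathrm{Dom}(\dot A^* )$ with $(f,g)_+=(f,g)+(\dot A^*f,\dot A^*g)$, and let $\mathcal H_+\subset\mathcal H\subset\mathcal H_-$ be the associated rigged Hilbert space ($\mathcal H_-$ is the dual of $\mathcal H_+$ with respect to the pairing extending the inner product of $\mathcal H$). $[X,Y]$ denotes bounded linear operators $X\to Y$. If $\mathbb A\in[\mathcal H_+,\mathcal H_-]$ then $\mathbb A^*\in[\mathcal H_+,\mathcal H_-]$; $\mathrm{Re}\,\mathbb A=(\mathbb A+\mathbb A^* )/2$, $\mathrm{Im}\,\mathbb A=(\mathbb A-\mathbb A^* )/2i$. The quasi-kernel $\hat A$ of $\mathrm{Re}\,\mathbb A$ is its restriction to $\{f\in\mathcal H_+:\mathrm{Re}\,\mathbb A f\in\mathcal H\}$. L-system: let $T$ be a non-symmetric operator with $\dot A\subset T\subset\dot A^*$, $\rho(T)\ne\emptyset$, $\mathrm{Dom}(\dot A)=\mathrm{Dom}(T)\cap\mathrm{Dom}(T^* )$. A $( * )$-extension of $T$ is $\mathbb A\in[\mathcal H_+,\mathcal H_-]$ with $\dot A\subset T\subset\mathbb A$, $\dot A\subset T^*\subset\mathbb A^*$ such that the quasi-kernel $\hat A$ of $\mathrm{Re}\,\mathbb A$ is self-adjoint in $\mathcal H$. An L-system with one-dimensional input-output is $\Theta=\begin{pmatrix}\mathbb A&K&1\\ \mathcal H_+\subset\mathcal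 H\subset\mathcal H_-&&\mathbb C\end{pmatrix}$ where $\mathbb A$ (state-space operator) is a $( * )$-extension of such a $T$ (main operator), $K\in[\mathbb C,\mathcal H_-]$, $\mathrm{Im}\,\mathbb A=KK^*$, $\mathrm{Ran}(K)=\mathrm{Ran}(\mathrm{Im}\,\mathbb A)$. It is minimal if $\dot A$ is prime (no nontrivial reducing subspace on which $\dot A$ induces a self-adjoint operator). Its transfer function is $W_\Theta(z)=1-2iK^*(\mathbb A-zI)^{-1}K$, $z\in\rho(T)$, and its impedance function is $V_\Theta(z)=K^*(\mathrm{Re}\,\mathbb A-zI)^{-1}K$, $z\in\rho(\hat A)$. Parameters: for normalized $g_\pm\in\mathrm{Ker}(\dot A^*\mp iI)$, the von Neumann parameter $\kappa$ of $T$ is defined by $g_+-\kappa g_-\in\mathrm{Dom}(T)$, $|\kappa|<1$; the vectors $g_\pm$ are chosen (changing the phase of $g_-$) so that $0\le\kappa<1$. The parameter $U$ ($|U|=1$) of $\hat A$ is defined, with respect to the same pair $g_\pm$, by $g_++Ug_-\in\mathrm{Dom}(\hat A)$, i.e. $\mathrm{Dom}(\hat A)=\mathrm{Dom}(\dot A)\dot+\mathrm{span}\{g_++Ug_-\}$. "Realized" means $V=V_\Theta$ on $\mathbb C_\pm$ ($V$ extended by $V(\bar z)=\overline{V(z)}$), for a suitable choice of rigged space and deficiency vectors. *)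

theory Defs
  imports "HOL-Analysis.Analysis" "HOL-Algebra.Module"
begin

section \<open>Complex Hilbert spaces with explicit carrier\<close>

text \<open>
  Hilbert spaces are structures on an explicit carrier set, so that a statement can quantify
  over them existentially. A vector space is a HOL-Algebra module over the field of complex
  numbers; the fields \<open>mult\<close> and \<open>one\<close> inherited from the ring record play no role.
  Inner products are linear in the first argument.
\<close>

definition complex_ring :: "complex ring" where
  "complex_ring = \<lparr>carrier = UNIV, mult = (*), one = 1, zero = 0, add = (+)\<rparr>"

record 'a inner_space = "(complex, 'a) module" +
  ip :: "'a \<Rightarrow> 'a \<Rightarrow> complex"

definition nrm :: "('a, 'm) inner_space_scheme \<Rightarrow> 'a \<Rightarrow> real" where
  "nrm H x = sqrt (Re (ip H x x))"

definition dst :: "('a, 'm) inner_space_scheme \<Rightarrow> 'a \<Rightarrow> 'a \<Rightarrow> real" where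
  "dst H x y = nrm H (x \<ominus>\<^bsub>H\<^esub> y)"

definition norm_topology :: "('a, 'm) inner_space_scheme \<Rightarrow> 'a topology" where
  "norm_topology H = Metric_space.mtopology (carrier H) (dst H)"

locale hilbert_space = Module.module complex_ring H
  for H :: "('a, 'm) inner_space_scheme" (structure) +
  assumes ip_add_left: "\<lbrakk>x \<in> carrier H; y \<in> carrier H; z \<in> carrier H\<rbrakk>
      \<Longrightarrow> ip H (x \<oplus> y) z = ip H x z + ip H y z"
    and ip_smult_left: "\<lbrakk>x \<in> carrier H; z \<in> carrier H\<rbrakk> \<Longrightarrow> ip H (c \<odot> x) z = c * ip H x z"
    and ip_cnj_commute: "\<lbrakk>x \<in> carrier H; y \<in> carrier H\<rbrakk> \<Longrightarrow> ip H x y = cnj (ip H y x)"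
    and ip_nonneg: "x \<in> carrier H \<Longrightarrow> 0 \<le> Re (ip H x x)"
    and ip_definite: "\<lbrakk>x \<in> carrier H; ip H x x = 0\<rbrakk> \<Longrightarrow> x = \<zero>"
    and complete: "Metric_space.mcomplete (carrier H) (dst H)"

definition complex_space :: "complex inner_space" where
  "complex_space = \<lparr>carrier = UNIV, mult = (*), one = 1, zero = 0, add = (+),
     smult = (*), ip = (\<lambda>c d. c * cnj d)\<rparr>"

definition dense_in :: "('a, 'm) inner_space_scheme \<Rightarrow> 'a set \<Rightarrow> bool" where
  "dense_in H D \<longleftrightarrow> norm_topology H closure_of D = carrier H"

definition closed_subspace :: "('a, 'm) inner_space_scheme \<Rightarrow> 'a set \<Rightarrow> bool" where
  "closed_subspace H M \<longleftrightarrow> submodule M complex_ring H \<and> closedin (norm_topology H) M"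

definition orthogonal_compl :: "('a, 'm) inner_space_scheme \<Rightarrow> 'a set \<Rightarrow> 'a set" where
  "orthogonal_compl H M = {x \<in> carrier H. \<forall>m\<in>M. ip H x m = 0}"

definition one_dimensional :: "('a, 'm) inner_space_scheme \<Rightarrow> 'a set \<Rightarrow> bool" where
  "one_dimensional H N \<longleftrightarrow> (\<exists>g\<in>carrier H. g \<noteq> \<zero>\<^bsub>H\<^esub> \<and> N = {c \<odot>\<^bsub>H\<^esub> g |c. True})"


section \<open>Unbounded operators\<close>

text \<open>
  An operator is identified with its graph: \<open>Domain A\<close> is its domain, and \<open>A \<subseteq> B\<close> says that
  \<open>B\<close> extends \<open>A\<close>.
\<close>

definition linear_op :: "('a, 'm) inner_space_scheme \<Rightarrow> ('a \<times> 'a) set \<Rightarrow> bool" where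
  "linear_op H A \<longleftrightarrow> A \<subseteq> carrier H \<times> carrier H \<and> single_valued A \<and> (\<zero>\<^bsub>H\<^esub>, \<zero>\<^bsub>H\<^esub>) \<in> A \<and>
     (\<forall>f h f' h'. (f, h) \<in> A \<longrightarrow> (f', h') \<in> A \<longrightarrow> (f \<oplus>\<^bsub>H\<^esub> f', h \<oplus>\<^bsub>H\<^esub> h') \<in> A) \<and>
     (\<forall>c f h. (f, h) \<in> A \<longrightarrow> (c \<odot>\<^bsub>H\<^esub> f, c \<odot>\<^bsub>H\<^esub> h) \<in> A)"

definition op_app :: "('a \<times> 'a) set \<Rightarrow> 'a \<Rightarrow> 'a" where
  "op_app A f = (THE h. (f, h) \<in> A)"

definition densely_defined :: "('a, 'm) inner_space_scheme \<Rightarrow> ('a \<times> 'a) set \<Rightarrow> bool" where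
  "densely_defined H A \<longleftrightarrow> dense_in H (Domain A)"

definition closed_op :: "('a, 'm) inner_space_scheme \<Rightarrow> ('a \<times> 'a) set \<Rightarrow> bool" where
  "closed_op H A \<longleftrightarrow> closedin (prod_topology (norm_topology H) (norm_topology H)) A"

definition adj :: "('a, 'm) inner_space_scheme \<Rightarrow> ('a \<times> 'a) set \<Rightarrow> ('a \<times> 'a) set" where
  "adj H A = {(g, h). g \<in> carrier H \<and> h \<in> carrier H \<and> (\<forall>(f, k)\<in>A. ip H k g = ip H f h)}"

definition symmetric_op :: "('a, 'm) inner_space_scheme \<Rightarrow> ('a \<times> 'a) set \<Rightarrow> bool" where
  "symmetric_op H A \<longleftrightarrow> A \<subseteq> adj H A"

definition selfadjoint_op :: "('a, 'm) inner_space_scheme \<Rightarrow> ('a \<times> 'a) set \<Rightarrow> bool" where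
  "selfadjoint_op H A \<longleftrightarrow> linear_op H A \<and> densely_defined H A \<and> adj H A = A"

definition resolvent_set :: "('a, 'm) inner_space_scheme \<Rightarrow> ('a \<times> 'a) set \<Rightarrow> complex set" where
  "resolvent_set H A = {z.
     (\<forall>h\<in>carrier H. \<exists>!f. (f, h \<oplus>\<^bsub>H\<^esub> z \<odot>\<^bsub>H\<^esub> f) \<in> A) \<and>
     (\<exists>C. \<forall>(f, k)\<in>A. nrm H f \<le> C * nrm H (k \<ominus>\<^bsub>H\<^esub> z \<odot>\<^bsub>H\<^esub> f))}"

definition eigenspace :: "('a, 'm) inner_space_scheme \<Rightarrow> ('a \<times> 'a) set \<Rightarrow> complex \<Rightarrow> 'a set" where
  "eigenspace H A z = {g. (g, z \<odot>\<^bsub>H\<^esub> g) \<in> A}"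

text \<open>
  \<open>reduces H A M\<close>: the orthogonal projection \<open>P\<close> onto \<open>M\<close> maps \<open>Domain A\<close> into itself and
  \<open>A (P f) = P (A f)\<close> there. The part of \<open>A\<close> induced in a reducing \<open>M\<close> is \<open>A \<inter> M \<times> M\<close>.
\<close>

definition reduces :: "('a, 'm) inner_space_scheme \<Rightarrow> ('a \<times> 'a) set \<Rightarrow> 'a set \<Rightarrow> bool" where
  "reduces H A M \<longleftrightarrow> closed_subspace H M \<and>
     (\<forall>(f, h)\<in>A. \<exists>f'\<in>M. \<exists>h'\<in>M. f \<ominus>\<^bsub>H\<^esub> f' \<in> orthogonal_compl H M \<and>
        h \<ominus>\<^bsub>H\<^esub> h' \<in> orthogonal_compl H M \<and> (f', h') \<in> A)"

definition prime_op :: "('a, 'm) inner_space_scheme \<Rightarrow> ('a \<times> 'a) set \<Rightarrow> bool" where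
  "prime_op H A \<longleftrightarrow> \<not> (\<exists>M. M \<noteq> {\<zero>\<^bsub>H\<^esub>} \<and> reduces H A M \<and>
     selfadjoint_op (H\<lparr>carrier := M\<rparr>) (A \<inter> M \<times> M))"

definition symmetric_op_11 :: "('a, 'm) inner_space_scheme \<Rightarrow> ('a \<times> 'a) set \<Rightarrow> bool" where
  "symmetric_op_11 H S \<longleftrightarrow> linear_op H S \<and> closed_op H S \<and> densely_defined H S \<and>
     symmetric_op H S \<and> one_dimensional H (eigenspace H (adj H S) \<i>) \<and>
     one_dimensional H (eigenspace H (adj H S) (- \<i>))"


section \<open>The rigged Hilbert space of a symmetric operator\<close>

definition hplus :: "'a inner_space \<Rightarrow> ('a \<times> 'a) set \<Rightarrow> 'a inner_space" where
  "hplus H S = H\<lparr>carrier := Domain (adj H S),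
     ip := (\<lambda>f g. ip H f g + ip H (op_app (adj H S) f) (op_app (adj H S) g))\<rparr>"

text \<open>
  The dual \<open>H\<^sub>-\<close> of \<open>E = H\<^sub>+\<close> consists of the bounded conjugate-linear functionals
  \<open>\<phi>\<close> on \<open>E\<close>, with pairing \<open>(\<phi>, g) = \<phi> g\<close>. Functionals are set to \<open>0\<close> outside the carrier, which
  makes equality of functions the equality of functionals. An element \<open>h\<close> of \<open>H\<close> is
  identified with \<open>g \<mapsto> (h, g)\<close>.
\<close>

definition antidual :: "('a, 'm) inner_space_scheme \<Rightarrow> ('a \<Rightarrow> complex) set" where
  "antidual E = {\<phi>. (\<forall>g. g \<notin> carrier E \<longrightarrow> \<phi> g = 0) \<and>
     (\<forall>f\<in>carrier E. \<forall>g\<in>carrier E. \<phi> (f \<oplus>\<^bsub>E\<^esub> g) = \<phi> f + \<phi> g) \<and>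
     (\<forall>c. \<forall>g\<in>carrier E. \<phi> (c \<odot>\<^bsub>E\<^esub> g) = cnj c * \<phi> g) \<and>
     (\<exists>C. \<forall>g\<in>carrier E. cmod (\<phi> g) \<le> C * nrm E g)}"

definition antidual_norm :: "('a, 'm) inner_space_scheme \<Rightarrow> ('a \<Rightarrow> complex) \<Rightarrow> real" where
  "antidual_norm E \<phi> = (SUP g\<in>{g \<in> carrier E. nrm E g \<le> 1}. cmod (\<phi> g))"

definition rig_embed :: "'a inner_space \<Rightarrow> ('a \<times> 'a) set \<Rightarrow> 'a \<Rightarrow> 'a \<Rightarrow> complex" where
  "rig_embed H S h = (\<lambda>g. if g \<in> carrier (hplus H S) then ip H h g else 0)"

text \<open>\<open>bounded_ops X E\<close> is \<open>[X, Y]\<close> with \<open>Y\<close> the dual of \<open>E\<close>.\<close>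

definition bounded_ops ::
    "('x, 'm) inner_space_scheme \<Rightarrow> ('a, 'n) inner_space_scheme \<Rightarrow> ('x \<Rightarrow> 'a \<Rightarrow> complex) set" where
  "bounded_ops X E = {B.
     (\<forall>x\<in>carrier X. B x \<in> antidual E) \<and>
     (\<forall>x\<in>carrier X. \<forall>y\<in>carrier X. B (x \<oplus>\<^bsub>X\<^esub> y) = (\<lambda>g. B x g + B y g)) \<and>
     (\<forall>c. \<forall>x\<in>carrier X. B (c \<odot>\<^bsub>X\<^esub> x) = (\<lambda>g. c * B x g)) \<and>
     (\<exists>C. \<forall>x\<in>carrier X. antidual_norm E (B x) \<le> C * nrm X x)}"

text \<open>The adjoint in \<open>[E, E\<^sup>*]\<close>, determined by \<open>(B f, g) = (f, B\<^sup>* g)\<close>.\<close>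

definition rig_adj :: "('a, 'm) inner_space_scheme \<Rightarrow> ('a \<Rightarrow> 'a \<Rightarrow> complex) \<Rightarrow> 'a \<Rightarrow> 'a \<Rightarrow> complex"
  where "rig_adj E B f = (\<lambda>g. if g \<in> carrier E then cnj (B g f) else 0)"

definition rig_re :: "('a, 'm) inner_space_scheme \<Rightarrow> ('a \<Rightarrow> 'a \<Rightarrow> complex) \<Rightarrow> 'a \<Rightarrow> 'a \<Rightarrow> complex"
  where "rig_re E B f = (\<lambda>g. (B f g + rig_adj E B f g) / 2)"

definition rig_im :: "('a, 'm) inner_space_scheme \<Rightarrow> ('a \<Rightarrow> 'a \<Rightarrow> complex) \<Rightarrow> 'a \<Rightarrow> 'a \<Rightarrow> complex"
  where "rig_im E B f = (\<lambda>g. (B f g - rig_adj E B f g) / (2 * \<i>))"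

text \<open>For \<open>K\<close> in \<open>[\<complex>, E\<^sup>*]\<close>, the adjoint is given by \<open>(K c, g) = c * cnj (K\<^sup>* g)\<close>.\<close>

definition chan_adj :: "(complex \<Rightarrow> 'a \<Rightarrow> complex) \<Rightarrow> 'a \<Rightarrow> complex" where
  "chan_adj K g = cnj (K 1 g)"

text \<open>The quasi-kernel of \<open>R : H\<^sub>+ \<rightarrow> H\<^sub>-\<close>: its restriction to the vectors it maps into \<open>H\<close>.\<close>

definition quasi_kernel ::
    "'a inner_space \<Rightarrow> ('a \<times> 'a) set \<Rightarrow> ('a \<Rightarrow> 'a \<Rightarrow> complex) \<Rightarrow> ('a \<times> 'a) set" where
  "quasi_kernel H S R = {(f, h). f \<in> carrier (hplus H S) \<and> h \<in> carrier H \<and> R f = rig_embed H S h}"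

text \<open>\<open>T \<subset> B\<close> for an operator \<open>T\<close> in \<open>H\<close> and \<open>B\<close> acting from \<open>H\<^sub>+\<close> to \<open>H\<^sub>-\<close>.\<close>

definition rig_extends ::
    "'a inner_space \<Rightarrow> ('a \<times> 'a) set \<Rightarrow> ('a \<times> 'a) set \<Rightarrow> ('a \<Rightarrow> 'a \<Rightarrow> complex) \<Rightarrow> bool" where
  "rig_extends H S T B \<longleftrightarrow> Domain T \<subseteq> carrier (hplus H S) \<and> (\<forall>(f, h)\<in>T. B f = rig_embed H S h)"


section \<open>L-systems with one-dimensional input-output space\<close>

definition main_op_class :: "'a inner_space \<Rightarrow> ('a \<times> 'a) set \<Rightarrow> ('a \<times> 'a) set \<Rightarrow> bool" where
  "main_op_class H S T \<longleftrightarrow> linear_op H T \<and> \<not> symmetric_op H T \<and> S \<subseteq> T \<and> T \<subseteq> adj H S \<and>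
     resolvent_set H T \<noteq> {} \<and> Domain S = Domain T \<inter> Domain (adj H T)"

definition star_extension ::
    "'a inner_space \<Rightarrow> ('a \<times> 'a) set \<Rightarrow> ('a \<times> 'a) set \<Rightarrow> ('a \<Rightarrow> 'a \<Rightarrow> complex) \<Rightarrow> bool" where
  "star_extension H S T B \<longleftrightarrow> B \<in> bounded_ops (hplus H S) (hplus H S) \<and>
     S \<subseteq> T \<and> rig_extends H S T B \<and>
     S \<subseteq> adj H T \<and> rig_extends H S (adj H T) (rig_adj (hplus H S) B) \<and>
     selfadjoint_op H (quasi_kernel H S (rig_re (hplus H S) B))"

record 'a L_system =
  sys_space :: "'a inner_space"
  sym_op :: "('a \<times> 'a) set"
  main_op :: "('a \<times> 'a) set"
  state_op :: "'a \<Rightarrow> 'a \<Rightarrow> complex"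
  channel_op :: "complex \<Rightarrow> 'a \<Rightarrow> complex"

definition sys_hplus :: "'a L_system \<Rightarrow> 'a inner_space" where
  "sys_hplus \<Theta> = hplus (sys_space \<Theta>) (sym_op \<Theta>)"

definition L_system :: "'a L_system \<Rightarrow> bool" where
  "L_system \<Theta> \<longleftrightarrow>
     hilbert_space (sys_space \<Theta>) \<and>
     symmetric_op_11 (sys_space \<Theta>) (sym_op \<Theta>) \<and>
     main_op_class (sys_space \<Theta>) (sym_op \<Theta>) (main_op \<Theta>) \<and>
     star_extension (sys_space \<Theta>) (sym_op \<Theta>) (main_op \<Theta>) (state_op \<Theta>) \<and>
     channel_op \<Theta> \<in> bounded_ops complex_space (sys_hplus \<Theta>) \<and>
     (\<forall>f\<in>carrier (sys_hplus \<Theta>).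
        rig_im (sys_hplus \<Theta>) (state_op \<Theta>) f = channel_op \<Theta> (chan_adj (channel_op \<Theta>) f)) \<and>
     range (channel_op \<Theta>) = rig_im (sys_hplus \<Theta>) (state_op \<Theta>) ` carrier (sys_hplus \<Theta>)"

definition minimal_L_system :: "'a L_system \<Rightarrow> bool" where
  "minimal_L_system \<Theta> \<longleftrightarrow> L_system \<Theta> \<and> prime_op (sys_space \<Theta>) (sym_op \<Theta>)"

definition sys_quasi_kernel :: "'a L_system \<Rightarrow> ('a \<times> 'a) set" where
  "sys_quasi_kernel \<Theta> =
     quasi_kernel (sys_space \<Theta>) (sym_op \<Theta>) (rig_re (sys_hplus \<Theta>) (state_op \<Theta>))"

text \<open>\<open>Re \<bbbA> - z I\<close> as a map from \<open>H\<^sub>+\<close> to \<open>H\<^sub>-\<close>.\<close>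

definition re_minus :: "'a L_system \<Rightarrow> complex \<Rightarrow> 'a \<Rightarrow> 'a \<Rightarrow> complex" where
  "re_minus \<Theta> z f = (\<lambda>g. rig_re (sys_hplus \<Theta>) (state_op \<Theta>) f g
     - z * rig_embed (sys_space \<Theta>) (sym_op \<Theta>) f g)"

definition impedance :: "'a L_system \<Rightarrow> complex \<Rightarrow> complex" where
  "impedance \<Theta> z = chan_adj (channel_op \<Theta>)
     (inv_into (carrier (sys_hplus \<Theta>)) (re_minus \<Theta> z) (channel_op \<Theta> 1))"

text \<open>
  For \<open>z\<close> in the resolvent set of the quasi-kernel, \<open>re_minus \<Theta> z\<close> is injective on \<open>H\<^sub>+\<close>; together
  with the range condition this makes the inverse in \<open>impedance\<close> a genuine one. \<open>V\<close> is given on the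
  upper half-plane and extended to the lower one by reflection.
\<close>

definition realizes :: "'a L_system \<Rightarrow> (complex \<Rightarrow> complex) \<Rightarrow> bool" where
  "realizes \<Theta> V \<longleftrightarrow> (\<forall>z. Im z \<noteq> 0 \<longrightarrow>
     z \<in> resolvent_set (sys_space \<Theta>) (sys_quasi_kernel \<Theta>) \<and>
     channel_op \<Theta> 1 \<in> re_minus \<Theta> z ` carrier (sys_hplus \<Theta>) \<and>
     impedance \<Theta> z = (if Im z > 0 then V z else cnj (V (cnj z))))"


section \<open>Von Neumann parameters\<close>

definition deficiency_vectors :: "'a L_system \<Rightarrow> 'a \<Rightarrow> 'a \<Rightarrow> bool" where
  "deficiency_vectors \<Theta> gp gm \<longleftrightarrow>
     gp \<in> eigenspace (sys_space \<Theta>) (adj (sys_space \<Theta>) (sym_op \<Theta>)) \<i> \<and>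
     gm \<in> eigenspace (sys_space \<Theta>) (adj (sys_space \<Theta>) (sym_op \<Theta>)) (- \<i>) \<and>
     nrm (sys_space \<Theta>) gp = 1 \<and> nrm (sys_space \<Theta>) gm = 1"

definition main_op_parameter :: "'a L_system \<Rightarrow> 'a \<Rightarrow> 'a \<Rightarrow> complex \<Rightarrow> bool" where
  "main_op_parameter \<Theta> gp gm \<kappa> \<longleftrightarrow> cmod \<kappa> < 1 \<and>
     gp \<ominus>\<^bsub>sys_space \<Theta>\<^esub> \<kappa> \<odot>\<^bsub>sys_space \<Theta>\<^esub> gm \<in> Domain (main_op \<Theta>)"

definition quasi_kernel_parameter :: "'a L_system \<Rightarrow> 'a \<Rightarrow> 'a \<Rightarrow> complex \<Rightarrow> bool" where
  "quasi_kernel_parameter \<Theta> gp gm U \<longleftrightarrow> cmod U = 1 \<and>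
     (let H = sys_space \<Theta>; g = gp \<oplus>\<^bsub>H\<^esub> U \<odot>\<^bsub>H\<^esub> gm in
        g \<notin> Domain (sym_op \<Theta>) \<and>
        Domain (sys_quasi_kernel \<Theta>) = {f \<oplus>\<^bsub>H\<^esub> c \<odot>\<^bsub>H\<^esub> g |f c. f \<in> Domain (sym_op \<Theta>)})"


section \<open>The generalized Donoghue class\<close>

definition class_M :: "real \<Rightarrow> (complex \<Rightarrow> complex) set" where
  "class_M Q = {V. \<exists>\<mu> :: real measure. sets \<mu> = sets borel \<and> emeasure \<mu> UNIV = \<infinity> \<and>
     (\<integral>\<^sup>+t. ennreal (1 / (1 + t\<^sup>2)) \<partial>\<mu>) = 1 \<and>
     (\<forall>z. Im z > 0 \<longrightarrow> V z = complex_of_real Q +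
        (\<integral>t. (1 / (complex_of_real t - z) - complex_of_real (t / (1 + t\<^sup>2))) \<partial>\<mu>))}"

end

theory Submission
  imports Defs
begin

text \<open>
  Let \<open>H = L\<^sup>2(\<mu>)\<close> and let \<open>S\<close> be multiplication by \<open>t\<close> on the functions of integral zero. Its adjoint
  consists of the pairs \<open>(f, h)\<close> with \<open>t f - h\<close> equal to a constant, since a function orthogonal to
  all rapidly decaying functions of integral zero is constant. With that constant as \<open>G0 f\<close> and
  \<open>G1 f = Q G0 f + \<integral> (f - G0 f t / (1 + t\<^sup>2)) d\<mu>\<close>, Green's identity holds, the deficiency space at \<open>z\<close> is
  spanned by \<open>1 / (t - z)\<close>, and \<open>G1 (1 / (t - z)) = V z\<close>; as \<open>\<mu>\<close> is infinite, \<open>G0\<close> is well defined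
  and \<open>S\<close> is densely defined. Everything else follows from these properties alone. The main
  operator is \<open>T = {G0 f + \<i> G1 f = 0}\<close>, the state-space operator is
  \<open>f \<mapsto> S\<^sup>* f + (G0 f + \<i> G1 f) \<chi>\<close> with \<open>\<chi> g = cnj (G1 g)\<close>, and the quasi-kernel of its real part is
  \<open>{G0 f = 0}\<close>, i.e. multiplication by \<open>t\<close>. Then \<open>f = 1 / (t - z)\<close> solves \<open>(Re \<bbbA> - z) f = \<chi>\<close>, so the
  impedance function is \<open>G1 f = V z\<close>. The parameters \<open>\<kappa>\<close> and \<open>U\<close> come from \<open>V (\<plusminus> \<i>) = Q \<plusminus> \<i>\<close>.
  \<open>S\<close> is prime because a reducing subspace on which it is self-adjoint is orthogonal to all
  \<open>1 / (t - z)\<close>, and these are total.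
\<close>

section \<open>Inner product spaces with explicit carrier\<close>

text \<open>Operators between \<open>S\<close> and its adjoint correspond to subspaces of the
  two-dimensional space of boundary values, where Green's identity is a skew-Hermitian form;
  adjoints become linear algebra there. The coefficient \<open>G0 f + \<i> * G1 f\<close> meets two
  demands. It vanishes on \<open>T\<close>, so that \<open>T\<close> is extended. And since Green's
  identity turns it into \<open>G0 f - \<i> * G1 f\<close> in the adjoint, the real and imaginary
  parts have the coefficients \<open>G0 f\<close> and \<open>G1 f\<close>: the first makes
  multiplication by t the quasi-kernel, the second gives the rank-one form K K^* with K c = c
  \<chi>. Infinite mass of \<mu> acts in two ways. Constants have infinite norm, so the constant in
  t f - h is unique; and normalized indicators of long intervals have integral one but small norm,
  so an integral can be corrected at little cost and \<open>S\<close> is dense. Totality of the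
  resolvent functions is the analytic core. Atoms of \<mu> are allowed, so endpoints of intervals
  matter; rational kernels that converge everywhere to the indicator of a closed interval deal with
  them.\<close>

text \<open>
  The library's locale of metric spaces wants the distance to be nonnegative and symmetric on the
  whole type, not only on the carrier; \<open>dst H\<close> has no reason to be, hence the last two
  assumptions.
\<close>

locale pre_hilbert_space = Module.module complex_ring H
  for H :: "('a, 'm) inner_space_scheme" (structure) +
  assumes ip_add_left: "\<lbrakk>x \<in> carrier H; y \<in> carrier H; z \<in> carrier H\<rbrakk>
      \<Longrightarrow> ip H (x \<oplus> y) z = ip H x z + ip H y z"
    and ip_smult_left: "\<lbrakk>x \<in> carrier H; z \<in> carrier H\<rbrakk> \<Longrightarrow> ip H (c \<odot> x) z = c * ip H x z"
    and ip_cnj_commute: "\<lbrakk>x \<in> carrier H; y \<in> carrier H\<rbrakk> \<Longrightarrow> ip H x y = cnj (ip H y x)"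
    and ip_nonneg: "x \<in> carrier H \<Longrightarrow> 0 \<le> Re (ip H x x)"
    and ip_definite: "\<lbrakk>x \<in> carrier H; ip H x x = 0\<rbrakk> \<Longrightarrow> x = \<zero>"
    and dst_nonneg: "0 \<le> dst H x y"
    and dst_commute: "dst H x y = dst H y x"
begin

lemma scale_closed [simp]: "x \<in> carrier H \<Longrightarrow> c \<odot> x \<in> carrier H"
  by (rule smult_closed) (simp_all add: complex_ring_def)

lemma plus_closed [simp]: "x \<in> carrier H \<Longrightarrow> y \<in> carrier H \<Longrightarrow> x \<oplus> y \<in> carrier H"
  by (rule M.a_closed)

lemma diff_closed [simp]: "x \<in> carrier H \<Longrightarrow> y \<in> carrier H \<Longrightarrow> x \<ominus> y \<in> carrier H"
  by (rule M.minus_closed)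

lemma ip_add_right:
  assumes "x \<in> carrier H" "y \<in> carrier H" "z \<in> carrier H"
  shows "ip H z (x \<oplus> y) = ip H z x + ip H z y"
  using ip_add_left[OF assms] assms by (metis complex_cnj_add ip_cnj_commute plus_closed)

lemma ip_smult_right:
  assumes "x \<in> carrier H" "z \<in> carrier H"
  shows "ip H z (c \<odot> x) = cnj c * ip H z x"
  using ip_smult_left[OF assms] assms by (metis complex_cnj_mult ip_cnj_commute scale_closed)

lemma ip_zero_left: "z \<in> carrier H \<Longrightarrow> ip H \<zero> z = 0"
  using ip_add_left[of \<zero> \<zero> z] by simp

lemma ip_zero_right: "z \<in> carrier H \<Longrightarrow> ip H z \<zero> = 0"
  using ip_add_right[of \<zero> \<zero> z] by simp

lemma ip_diff_left:
  assumes "x \<in> carrier H" "y \<in> carrier H" "z \<in> carrier H"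
  shows "ip H (x \<ominus> y) z = ip H x z - ip H y z"
proof -
  have "ip H (\<ominus> y) z + ip H y z = ip H (\<ominus> y \<oplus> y) z"
    using assms by (simp only: ip_add_left M.a_inv_closed)
  also have "\<dots> = 0" using assms by (simp add: M.l_neg ip_zero_left)
  finally show ?thesis
    using assms by (simp add: a_minus_def ip_add_left eq_neg_iff_add_eq_0)
qed

lemma ip_diff_right:
  assumes "x \<in> carrier H" "y \<in> carrier H" "z \<in> carrier H"
  shows "ip H z (x \<ominus> y) = ip H z x - ip H z y"
  using ip_diff_left[OF assms] assms by (metis complex_cnj_diff ip_cnj_commute diff_closed)

lemmas ip_simps = ip_add_left ip_add_right ip_smult_left ip_smult_right ip_zero_left
  ip_zero_right ip_diff_left ip_diff_right

lemma diff_eq_zero_iff: "x \<in> carrier H \<Longrightarrow> y \<in> carrier H \<Longrightarrow> x \<ominus> y = \<zero> \<longleftrightarrow> x = y"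
  using M.minus_equality[of x "\<ominus> y"] M.r_neg[of y] by (auto simp: a_minus_def)

text \<open>Vector identities are proved by comparing inner products, where they become
  identities between complex numbers.\<close>

lemma vector_eqI:
  assumes "x \<in> carrier H" "y \<in> carrier H" "\<And>z. z \<in> carrier H \<Longrightarrow> ip H x z = ip H y z"
  shows "x = y"
proof -
  have "ip H (x \<ominus> y) (x \<ominus> y) = 0" using assms by (simp add: ip_simps)
  then show ?thesis using ip_definite[of "x \<ominus> y"] diff_eq_zero_iff assms(1,2) by simp
qed

section \<open>Norm, Cauchy-Schwarz inequality and metric topology\<close>

lemma ip_self: "x \<in> carrier H \<Longrightarrow> ip H x x = complex_of_real ((nrm H x)\<^sup>2)"
  using ip_cnj_commute[of x x] ip_nonneg[of x] by (simp add: nrm_def complex_eq_iff)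

lemma nrm_nonneg [simp]: "x \<in> carrier H \<Longrightarrow> 0 \<le> nrm H x"
  by (simp add: nrm_def ip_nonneg)

lemma nrm_eq_0_iff: "x \<in> carrier H \<Longrightarrow> nrm H x = 0 \<longleftrightarrow> x = \<zero>"
  using ip_self[of x] ip_definite[of x] ip_zero_left[of \<zero>] by auto

lemma nrm_zero [simp]: "nrm H \<zero> = 0"
  by (simp add: nrm_eq_0_iff)

lemma nrm_smult: "x \<in> carrier H \<Longrightarrow> nrm H (c \<odot> x) = cmod c * nrm H x"
proof -
  assume x: "x \<in> carrier H"
  have "ip H (c \<odot> x) (c \<odot> x) = complex_of_real ((cmod c)\<^sup>2) * ip H x x"
    using x by (simp add: ip_simps complex_norm_square del: of_real_power)
  then show ?thesis
    using x by (simp add: nrm_def real_sqrt_mult)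
qed

lemma Cauchy_Schwarz:
  assumes x: "x \<in> carrier H" and y: "y \<in> carrier H"
  shows "cmod (ip H x y) \<le> nrm H x * nrm H y"
proof (cases "nrm H y = 0")
  case True
  then show ?thesis using x y by (simp add: nrm_eq_0_iff ip_zero_right)
next
  case False
  define b where "b = (nrm H y)\<^sup>2"
  define a where "a = ip H x y"
  have b: "b > 0" using False by (simp add: b_def)
  have yy: "ip H y y = of_real b" using y by (simp add: b_def ip_self)
  have yx: "ip H y x = cnj a" using ip_cnj_commute[OF y x] by (simp add: a_def)
  \<comment> \<open>Scaling by b = |y|^2 clears the denominator of the projection of x onto y;
    nonnegativity of this squared norm is the inequality multiplied by b.\<close>
  have "ip H (of_real b \<odot> x \<ominus> a \<odot> y) (of_real b \<odot> x \<ominus> a \<odot> y)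
      = of_real (b * (b * (nrm H x)\<^sup>2 - (cmod a)\<^sup>2))"
    using x y complex_norm_square[of a]
    by (simp add: ip_simps yy yx a_def[symmetric] ip_self[OF x] algebra_simps power2_eq_square)
  then have "0 \<le> b * (b * (nrm H x)\<^sup>2 - (cmod a)\<^sup>2)"
    using ip_nonneg[of "of_real b \<odot> x \<ominus> a \<odot> y"] x y by (simp del: of_real_mult of_real_diff)
  then have "(cmod a)\<^sup>2 \<le> (nrm H x * nrm H y)\<^sup>2"
    using b by (simp add: zero_le_mult_iff b_def power_mult_distrib mult.commute)
  then show ?thesis unfolding a_def by (rule power2_le_imp_le) (use x y in simp)
qed

lemma nrm_triangle:
  assumes x: "x \<in> carrier H" and y: "y \<in> carrier H"
  shows "nrm H (x \<oplus> y) \<le> nrm H x + nrm H y"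
proof (rule power2_le_imp_le)
  have "ip H (x \<oplus> y) (x \<oplus> y) = ip H x x + ip H y y + (ip H x y + cnj (ip H x y))"
    using x y ip_cnj_commute[of y x] by (simp add: ip_simps)
  then have "(nrm H (x \<oplus> y))\<^sup>2 = (nrm H x)\<^sup>2 + (nrm H y)\<^sup>2 + 2 * Re (ip H x y)"
    using x y by (simp add: ip_self complex_eq_iff)
  also have "\<dots> \<le> (nrm H x)\<^sup>2 + (nrm H y)\<^sup>2 + 2 * (nrm H x * nrm H y)"
    using Cauchy_Schwarz[OF x y] complex_Re_le_cmod[of "ip H x y"] by linarith
  finally show "(nrm H (x \<oplus> y))\<^sup>2 \<le> (nrm H x + nrm H y)\<^sup>2" by (simp add: power2_sum)
qed (use x y in simp)

lemma metric: "Metric_space (carrier H) (dst H)"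
proof
  fix x y assume xy: "x \<in> carrier H" "y \<in> carrier H"
  show "dst H x y = 0 \<longleftrightarrow> x = y"
    using xy by (simp add: dst_def nrm_eq_0_iff diff_eq_zero_iff)
  fix z assume z: "z \<in> carrier H"
  have "x \<ominus> z = (x \<ominus> y) \<oplus> (y \<ominus> z)"
    by (rule vector_eqI) (use xy z in \<open>simp_all add: ip_simps\<close>)
  then show "dst H x z \<le> dst H x y + dst H y z"
    using xy z by (simp add: dst_def nrm_triangle)
qed (rule dst_nonneg dst_commute)+

sublocale MS: Metric_space "carrier H" "dst H"
  rewrites "MS.mtopology = norm_topology H"
  by (simp_all add: metric norm_topology_def)

lemma dense_in_iff:
  "dense_in H D \<longleftrightarrow> (\<forall>x\<in>carrier H. \<forall>e>0. \<exists>y\<in>D \<inter> carrier H. nrm H (x \<ominus> y) < e)"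
  by (auto simp: dense_in_def MS.metric_closure_of dst_def Bex_def)

lemma dense_orthogonal_zero:
  assumes D: "dense_in H D" and x: "x \<in> carrier H" and "\<And>y. y \<in> D \<inter> carrier H \<Longrightarrow> ip H x y = 0"
  shows "x = \<zero>"
proof (rule ccontr)
  assume "x \<noteq> \<zero>"
  then have n: "nrm H x > 0" using x nrm_eq_0_iff nrm_nonneg by (metis less_eq_real_def)
  then obtain y where y: "y \<in> D \<inter> carrier H" "nrm H (x \<ominus> y) < nrm H x"
    using D x unfolding dense_in_iff by blast
  have "ip H x (x \<ominus> y) = ip H x x" using assms(3)[OF y(1)] x y by (simp add: ip_simps)
  then have "(nrm H x)\<^sup>2 \<le> nrm H x * nrm H (x \<ominus> y)"
    using Cauchy_Schwarz[of x "x \<ominus> y"] x y(1) by (simp add: ip_self norm_power)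
  then show False using n y(2) by (simp add: power2_eq_square)
qed

lemma continuous_map_ip:
  assumes y: "y \<in> carrier H"
  shows "continuous_map (norm_topology H) euclidean (ip H y)"
proof -
  have "continuous_map (norm_topology H) Met_TC.mtopology (ip H y)"
    unfolding MS.metric_continuous_map[OF Met_TC.Metric_space_axioms]
  proof (intro conjI ballI allI impI)
    fix a and e :: real assume a: "a \<in> carrier H" and e: "0 < e"
    show "\<exists>d>0. \<forall>x. x \<in> carrier H \<and> dst H a x < d \<longrightarrow> dist (ip H y a) (ip H y x) < e"
    proof (intro exI conjI allI impI)
      \<comment> \<open>Adding one keeps the radius meaningful for y = 0.\<close>
      show "0 < e / (nrm H y + 1)" using e nrm_nonneg[OF y] by (intro divide_pos_pos) linarith+
      fix x assume x: "x \<in> carrier H \<and> dst H a x < e / (nrm H y + 1)"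
      have "dist (ip H y a) (ip H y x) = cmod (ip H y (a \<ominus> x))"
        using x a y by (simp add: ip_simps dist_norm)
      also have "\<dots> \<le> nrm H y * dst H a x"
        using Cauchy_Schwarz x a y by (simp add: dst_def)
      also have "\<dots> \<le> (nrm H y + 1) * dst H a x"
        by (intro mult_right_mono) auto
      also have "\<dots> < e"
        using x nrm_nonneg[OF y] by (simp add: field_simps)
      finally show "dist (ip H y a) (ip H y x) < e" .
    qed
  qed auto
  then show ?thesis by simp
qed

section \<open>Adjoint operators as graphs\<close>

lemma adj_alt: "(g, h) \<in> adj H A \<longleftrightarrow>
    g \<in> carrier H \<and> h \<in> carrier H \<and> (\<forall>f k. (f, k) \<in> A \<longrightarrow> ip H k g = ip H f h)"
  by (auto simp: adj_def)

lemma adj_antimono: "A \<subseteq> B \<Longrightarrow> adj H B \<subseteq> adj H A"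
  unfolding adj_def by blast

text \<open>Each pair in \<open>A\<close> imposes one equation, continuous in (g, h), on the members
  of the adjoint; its graph is the intersection of the zero sets.\<close>

lemma closed_op_adj:
  assumes A: "A \<subseteq> carrier H \<times> carrier H"
  shows "closed_op H (adj H A)"
proof -
  let ?X = "prod_topology (norm_topology H) (norm_topology H)"
  have top: "topspace ?X = carrier H \<times> carrier H" by simp
  have c: "continuous_map ?X euclidean (\<lambda>p. ip H (snd q) (fst p) - ip H (fst q) (snd p))"
    if q: "q \<in> A" for q
  proof -
    have m: "fst q \<in> carrier H" "snd q \<in> carrier H" using A q by auto
    show ?thesis
      using continuous_map_compose[OF continuous_map_fst continuous_map_ip[OF m(2)], of "norm_topology H"]
        continuous_map_compose[OF continuous_map_snd continuous_map_ip[OF m(1)], of "norm_topology H"]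
      by (intro continuous_map_diff) (simp_all add: o_def)
  qed
  have "closedin ?X {p \<in> topspace ?X. ip H (snd q) (fst p) - ip H (fst q) (snd p) \<in> {0}}"
    if "q \<in> A" for q
    by (rule closedin_continuous_map_preimage[OF c[OF that]]) simp
  moreover have "adj H A = topspace ?X \<inter>
      \<Inter> ((\<lambda>q. {p \<in> topspace ?X. ip H (snd q) (fst p) - ip H (fst q) (snd p) \<in> {0}}) ` A)"
    by (fastforce simp: adj_def top)
  moreover have "closedin ?X (carrier H \<times> carrier H)"
    using closedin_topspace[of ?X] by simp
  \<comment> \<open>For empty \<open>A\<close> the intersection is over no sets and equals the whole
    type; then only the closed product of the carriers remains.\<close>
  ultimately show ?thesis
    unfolding closed_op_def by (cases "A = {}") (auto intro!: closedin_Inter closedin_Int)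
qed

end

locale hilbert_metric_space = pre_hilbert_space H
  for H :: "('a, 'm) inner_space_scheme" (structure) +
  assumes complete: "Metric_space.mcomplete (carrier H) (dst H)"
begin

lemma hilbert: "hilbert_space H"
  by unfold_locales
    (rule ip_add_left ip_smult_left ip_cnj_commute ip_nonneg ip_definite complete; assumption)+

end

section \<open>Boundary triples\<close>

text \<open>
  \<open>B\<close> is the adjoint of the symmetric operator \<open>S\<close>, the boundary maps \<open>G0\<close> and \<open>G1\<close> satisfy
  Green's identity, \<open>gam z\<close> spans the deficiency space at \<open>z\<close>, and \<open>W\<close> is the Weyl function, here
  normalized by its value at \<open>\<i>\<close>.
\<close>

locale boundary_triple = hilbert_metric_space H
  for H :: "'a inner_space" (structure) +
  fixes S B :: "('a \<times> 'a) set" and G0 G1 :: "'a \<Rightarrow> complex"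
    and gam :: "complex \<Rightarrow> 'a" and W :: "complex \<Rightarrow> complex" and Q :: real
  assumes linear_B: "linear_op H B"
    and S_eq: "S = {(f, h) \<in> B. G0 f = 0 \<and> G1 f = 0}"
    and S_dense: "densely_defined H S"
    and adj_S: "adj H S = B"
    and G0_add: "\<lbrakk>(f, h) \<in> B; (g, k) \<in> B\<rbrakk> \<Longrightarrow> G0 (f \<oplus> g) = G0 f + G0 g"
    and G1_add: "\<lbrakk>(f, h) \<in> B; (g, k) \<in> B\<rbrakk> \<Longrightarrow> G1 (f \<oplus> g) = G1 f + G1 g"
    and G0_smult: "(f, h) \<in> B \<Longrightarrow> G0 (c \<odot> f) = c * G0 f"
    and G1_smult: "(f, h) \<in> B \<Longrightarrow> G1 (c \<odot> f) = c * G1 f"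
    and green: "\<lbrakk>(f, h) \<in> B; (g, k) \<in> B\<rbrakk> \<Longrightarrow>
      ip H h g - ip H f k = G1 f * cnj (G0 g) - G0 f * cnj (G1 g)"
    and gam_eigen: "Im z \<noteq> 0 \<Longrightarrow> (gam z, z \<odot> gam z) \<in> B"
    and G0_gam: "Im z \<noteq> 0 \<Longrightarrow> G0 (gam z) = 1"
    and G1_gam: "Im z \<noteq> 0 \<Longrightarrow> G1 (gam z) = W z"
    and W_i: "W \<i> = complex_of_real Q + \<i>"
    and W_minus_i: "W (- \<i>) = complex_of_real Q - \<i>"
    and solve: "\<lbrakk>Im z \<noteq> 0; h \<in> carrier H\<rbrakk> \<Longrightarrow> \<exists>f. (f, h \<oplus> z \<odot> f) \<in> B \<and> G0 f = 0"
    and total: "\<lbrakk>m \<in> carrier H; \<And>z. Im z \<noteq> 0 \<Longrightarrow> ip H m (gam z) = 0\<rbrakk> \<Longrightarrow> m = \<zero>"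
begin

lemma B_carrier: "(f, h) \<in> B \<Longrightarrow> f \<in> carrier H" "(f, h) \<in> B \<Longrightarrow> h \<in> carrier H"
  using linear_B by (auto simp: linear_op_def)

lemma B_unique: "(f, h) \<in> B \<Longrightarrow> (f, h') \<in> B \<Longrightarrow> h = h'"
  using linear_B by (auto simp: linear_op_def single_valued_def)

lemma B_add: "(f, h) \<in> B \<Longrightarrow> (f', h') \<in> B \<Longrightarrow> (f \<oplus> f', h \<oplus> h') \<in> B"
  using linear_B by (auto simp: linear_op_def)

lemma B_smult: "(f, h) \<in> B \<Longrightarrow> (c \<odot> f, c \<odot> h) \<in> B"
  using linear_B by (auto simp: linear_op_def)

lemma B_zero: "(\<zero>, \<zero>) \<in> B"
  using linear_B by (auto simp: linear_op_def)

lemma diff_conv_smult: "x \<in> carrier H \<Longrightarrow> y \<in> carrier H \<Longrightarrow> x \<ominus> y = x \<oplus> (-1) \<odot> y"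
  by (rule vector_eqI) (simp_all add: ip_simps)

lemma B_diff: "(f, h) \<in> B \<Longrightarrow> (f', h') \<in> B \<Longrightarrow> (f \<ominus> f', h \<ominus> h') \<in> B"
  using B_add[OF _ B_smult[of f' h' "-1"]] B_carrier by (simp add: diff_conv_smult)

lemma G0_diff: "(f, h) \<in> B \<Longrightarrow> (g, k) \<in> B \<Longrightarrow> G0 (f \<ominus> g) = G0 f - G0 g"
  using G0_add[OF _ B_smult[of g k "-1"]] G0_smult[of g k] B_carrier by (simp add: diff_conv_smult)

lemma G1_diff: "(f, h) \<in> B \<Longrightarrow> (g, k) \<in> B \<Longrightarrow> G1 (f \<ominus> g) = G1 f - G1 g"
  using G1_add[OF _ B_smult[of g k "-1"]] G1_smult[of g k] B_carrier by (simp add: diff_conv_smult)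

lemma op_app_B: "(f, h) \<in> B \<Longrightarrow> op_app B f = h"
  unfolding op_app_def by (rule the_equality) (auto intro: B_unique)

lemma S_subset_B: "S \<subseteq> B"
  by (auto simp: S_eq)

lemma gam_carrier: "Im z \<noteq> 0 \<Longrightarrow> gam z \<in> carrier H"
  using gam_eigen B_carrier by blast

text \<open>\<open>gam \<i>\<close> and \<open>gam (- \<i>)\<close> have the boundary values (1, Q +
  i) and (1, Q - i), which are linearly independent; the coefficients solve the resulting two-by-two
  system.\<close>

lemma boundary_surj:
  obtains f h where "(f, h) \<in> B" "G0 f = a" "G1 f = b"
proof
  define c where "c = (a + (b - of_real Q * a) / \<i>) / 2"
  define d where "d = (a - (b - of_real Q * a) / \<i>) / 2"
  have cd: "c + d = a" "c * (of_real Q + \<i>) + d * (of_real Q - \<i>) = b"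
    by (simp_all add: c_def d_def field_simps)
  let ?c = c and ?d = d
  have B: "(?c \<odot> gam \<i>, ?c \<odot> (\<i> \<odot> gam \<i>)) \<in> B" "(?d \<odot> gam (-\<i>), ?d \<odot> ((-\<i>) \<odot> gam (-\<i>))) \<in> B"
    by (intro B_smult gam_eigen; simp)+
  show "(?c \<odot> gam \<i> \<oplus> ?d \<odot> gam (-\<i>), ?c \<odot> (\<i> \<odot> gam \<i>) \<oplus> ?d \<odot> ((-\<i>) \<odot> gam (-\<i>))) \<in> B"
    by (intro B_add B)
  show "G0 (?c \<odot> gam \<i> \<oplus> ?d \<odot> gam (-\<i>)) = a"
    by (simp add: G0_add[OF B] G0_smult[OF gam_eigen] G0_gam cd)
  have "G1 (?c \<odot> gam \<i> \<oplus> ?d \<odot> gam (-\<i>)) = ?c * (of_real Q + \<i>) + ?d * (of_real Q - \<i>)"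
    by (simp add: G1_add[OF B] G1_smult[OF gam_eigen] G1_gam W_i W_minus_i)
  also have "\<dots> = b" by (rule cd)
  finally show "G1 (?c \<odot> gam \<i> \<oplus> ?d \<odot> gam (-\<i>)) = b" .
qed

text \<open>The extensions of \<open>S\<close> given by one linear boundary condition:
  \<open>restr 1 0\<close> becomes the quasi-kernel, \<open>restr 1 \<i>\<close> the main operator
  and \<open>restr 1 (- \<i>)\<close> its adjoint.\<close>

definition restr :: "complex \<Rightarrow> complex \<Rightarrow> ('a \<times> 'a) set" where
  "restr a b = {(f, h) \<in> B. a * G0 f + b * G1 f = 0}"

lemma restr_subset: "restr a b \<subseteq> B"
  by (auto simp: restr_def)

lemma S_subset_restr: "S \<subseteq> restr a b"
  by (auto simp: S_eq restr_def)

lemma G_zero: "G0 \<zero> = 0" "G1 \<zero> = 0"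
proof -
  have "0 \<odot> \<zero> = \<zero>" by (rule vector_eqI) (simp_all add: ip_simps)
  then show "G0 \<zero> = 0" "G1 \<zero> = 0"
    using G0_smult[OF B_zero, of 0] G1_smult[OF B_zero, of 0] by auto
qed

lemma linear_op_sub:
  assumes "A \<subseteq> B" "(\<zero>, \<zero>) \<in> A"
    and "\<And>f h f' h'. (f, h) \<in> A \<Longrightarrow> (f', h') \<in> A \<Longrightarrow> (f \<oplus> f', h \<oplus> h') \<in> A"
    and "\<And>c f h. (f, h) \<in> A \<Longrightarrow> (c \<odot> f, c \<odot> h) \<in> A"
  shows "linear_op H A"
proof -
  have "B \<subseteq> carrier H \<times> carrier H" using linear_B by (simp add: linear_op_def)
  then have "A \<subseteq> carrier H \<times> carrier H" using assms(1) by blast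
  moreover have "single_valued A" using assms(1) B_unique unfolding single_valued_def by blast
  ultimately show ?thesis using assms(2-) unfolding linear_op_def by blast
qed

lemma linear_restr: "linear_op H (restr a b)"
proof (rule linear_op_sub)
  fix f h f' h' assume "(f, h) \<in> restr a b" "(f', h') \<in> restr a b"
  then have *: "(f, h) \<in> B" "(f', h') \<in> B" and eq: "a * G0 f + b * G1 f = 0" "a * G0 f' + b * G1 f' = 0"
    by (auto simp: restr_def)
  have "a * G0 (f \<oplus> f') + b * G1 (f \<oplus> f') = (a * G0 f + b * G1 f) + (a * G0 f' + b * G1 f')"
    by (simp add: G0_add[OF *] G1_add[OF *] algebra_simps)
  then show "(f \<oplus> f', h \<oplus> h') \<in> restr a b"
    using B_add[OF *] eq by (simp add: restr_def)
next
  fix c f h assume "(f, h) \<in> restr a b"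
  then have *: "(f, h) \<in> B" and eq: "a * G0 f + b * G1 f = 0"
    by (auto simp: restr_def)
  have "a * G0 (c \<odot> f) + b * G1 (c \<odot> f) = c * (a * G0 f + b * G1 f)"
    by (simp add: G0_smult[OF *] G1_smult[OF *] algebra_simps)
  then show "(c \<odot> f, c \<odot> h) \<in> restr a b"
    using B_smult[OF *] eq by (simp add: restr_def)
qed (auto simp: restr_def B_zero G_zero)

lemma linear_S: "linear_op H S"
  by (rule linear_op_sub) (auto simp: S_eq B_zero G_zero intro: B_add B_smult
      simp: G0_add G1_add G0_smult G1_smult)

text \<open>An annihilator computation in the boundary space: the condition cuts out the line
  spanned by (-b, a), and Green's form against this vector is, up to conjugation, the conjugate
  condition.\<close>

lemma adj_restr:
  assumes "a \<noteq> 0 \<or> b \<noteq> 0"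
  shows "adj H (restr a b) = restr (cnj a) (cnj b)"
proof (intro equalityI subrelI)
  fix g k assume gk: "(g, k) \<in> adj H (restr a b)"
  then have B: "(g, k) \<in> B"
    using adj_antimono[OF S_subset_restr] adj_S by blast
  obtain f h where fh: "(f, h) \<in> B" "G0 f = - b" "G1 f = a"
    by (rule boundary_surj)
  then have "(f, h) \<in> restr a b" by (simp add: restr_def)
  then have "ip H h g - ip H f k = 0" using gk by (simp add: adj_alt)
  then have "a * cnj (G0 g) + b * cnj (G1 g) = 0"
    using green[OF fh(1) B] fh by simp
  then have "cnj (a * cnj (G0 g) + b * cnj (G1 g)) = 0" by (simp only: complex_cnj_zero)
  then show "(g, k) \<in> restr (cnj a) (cnj b)"
    using B by (simp add: restr_def)
next
  fix g k assume "(g, k) \<in> restr (cnj a) (cnj b)"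
  then have B: "(g, k) \<in> B" and "cnj (cnj a * G0 g + cnj b * G1 g) = 0"
    by (auto simp: restr_def)
  then have eq: "a * cnj (G0 g) + b * cnj (G1 g) = 0" by simp
  have "ip H h g = ip H f k" if "(f, h) \<in> restr a b" for f h
  proof -
    have fh: "(f, h) \<in> B" and fe: "a * G0 f + b * G1 f = 0" using that by (auto simp: restr_def)
    \<comment> \<open>Multiplied by \<open>a\<close> or by \<open>b\<close>, Green's form is a
      combination of the two boundary conditions; at least one of the factors can be
      cancelled.\<close>
    have "a * (G1 f * cnj (G0 g) - G0 f * cnj (G1 g))
        = G1 f * (a * cnj (G0 g) + b * cnj (G1 g)) - cnj (G1 g) * (a * G0 f + b * G1 f)"
      "b * (G1 f * cnj (G0 g) - G0 f * cnj (G1 g))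
        = cnj (G0 g) * (a * G0 f + b * G1 f) - G0 f * (a * cnj (G0 g) + b * cnj (G1 g))"
      by (simp_all add: algebra_simps)
    then have "G1 f * cnj (G0 g) - G0 f * cnj (G1 g) = 0"
      using assms unfolding eq fe by auto
    then show ?thesis using green[OF fh B] by simp
  qed
  then show "(g, k) \<in> adj H (restr a b)"
    using B_carrier[OF B] by (simp add: adj_alt)
qed

text \<open>Boundary values in \<open>B\<close> are arbitrary, so Green's form vanishes against all
  of them only if both boundary values of g are zero. Together with \<open>closed_op_adj\<close>
  this shows that \<open>S\<close> is closed.\<close>

lemma adj_B: "adj H B = S"
proof (intro equalityI subrelI)
  fix g k assume gk: "(g, k) \<in> adj H B"
  then have B: "(g, k) \<in> B"
    using adj_antimono[OF S_subset_B] adj_S by blast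
  have eq: "G1 f * cnj (G0 g) - G0 f * cnj (G1 g) = 0" if "(f, h) \<in> B" for f h
    using gk green[OF that B] that by (simp add: adj_alt)
  obtain f h where "(f, h) \<in> B" "G0 f = 0" "G1 f = 1" by (rule boundary_surj)
  moreover obtain f' h' where "(f', h') \<in> B" "G0 f' = 1" "G1 f' = 0" by (rule boundary_surj)
  ultimately show "(g, k) \<in> S" using eq[of f h] eq[of f' h'] B by (simp add: S_eq)
next
  fix g k assume "(g, k) \<in> S"
  then have B: "(g, k) \<in> B" "G0 g = 0" "G1 g = 0" by (auto simp: S_eq)
  have "ip H h g = ip H f k" if "(f, h) \<in> B" for f h
    using green[OF that B(1)] B by simp
  then show "(g, k) \<in> adj H B"
    using B_carrier[OF B(1)] by (simp add: adj_alt)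
qed

lemma dense_if_S_subset: "S \<subseteq> A \<Longrightarrow> densely_defined H A"
  using S_dense unfolding densely_defined_def dense_in_iff by fast

text \<open>On \<open>restr 1 0\<close> Green's form vanishes, so ip h f is real and the imaginary
  part of ip (h - z f) f is - Im z |f|^2; Cauchy-Schwarz does the rest.\<close>

lemma eigen_bound:
  assumes "(f, h) \<in> restr 1 0"
  shows "\<bar>Im z\<bar> * nrm H f \<le> nrm H (h \<ominus> z \<odot> f)"
proof (cases "nrm H f = 0")
  case True
  then show ?thesis using assms B_carrier by (auto simp: restr_def)
next
  case False
  have fh: "(f, h) \<in> B" "G0 f = 0" using assms by (auto simp: restr_def)
  note c = B_carrier[OF fh(1)]
  have "ip H h f = cnj (ip H h f)"
    using green[OF fh(1) fh(1)] fh c ip_cnj_commute[of f h] by simp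
  then have "Im (ip H h f) = 0" by (simp add: complex_eq_iff)
  then have "Im (ip H (h \<ominus> z \<odot> f) f) = - Im z * (nrm H f)\<^sup>2"
    using c by (simp add: ip_simps ip_self)
  then have "\<bar>Im z\<bar> * (nrm H f)\<^sup>2 \<le> nrm H (h \<ominus> z \<odot> f) * nrm H f"
    using abs_Im_le_cmod[of "ip H (h \<ominus> z \<odot> f) f"] Cauchy_Schwarz[of "h \<ominus> z \<odot> f" f] c
    by (simp add: abs_mult)
  then show ?thesis
    using False nrm_nonneg[OF c(1)] by (simp add: power2_eq_square mult.assoc[symmetric])
qed

section \<open>Eigenvectors at non-real points\<close>

lemma eigen_zero:
  assumes "(f, z \<odot> f) \<in> B" "G0 f = 0" "Im z \<noteq> 0"
  shows "f = \<zero>"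
proof -
  have c: "f \<in> carrier H" using assms B_carrier by blast
  have "\<bar>Im z\<bar> * nrm H f \<le> nrm H (z \<odot> f \<ominus> z \<odot> f)"
    using assms by (intro eigen_bound) (simp add: restr_def)
  also have "\<dots> = 0" using c by (simp add: nrm_eq_0_iff diff_eq_zero_iff)
  finally show ?thesis
    using assms(3) nrm_nonneg[OF c] nrm_eq_0_iff[OF c] by (simp add: mult_le_0_iff)
qed

text \<open>The difference of both sides is again an eigenvector of \<open>B\<close>, but with
  \<open>G0\<close> zero, hence it vanishes by \<open>eigen_zero\<close>. This is why the deficiency
  spaces are one-dimensional.\<close>

lemma eigenvector_eq:
  assumes "(f, z \<odot> f) \<in> B" "Im z \<noteq> 0"
  shows "f = G0 f \<odot> gam z"
proof -
  let ?g = "G0 f \<odot> gam z"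
  have c: "f \<in> carrier H" "?g \<in> carrier H" using assms B_carrier gam_carrier by auto
  have g: "(?g, G0 f \<odot> (z \<odot> gam z)) \<in> B" by (intro B_smult gam_eigen assms)
  have "z \<odot> f \<ominus> G0 f \<odot> (z \<odot> gam z) = z \<odot> (f \<ominus> ?g)"
    using c gam_carrier[OF assms(2)] by (intro vector_eqI) (simp_all add: ip_simps algebra_simps)
  then have "(f \<ominus> ?g, z \<odot> (f \<ominus> ?g)) \<in> B" using B_diff[OF assms(1) g] by simp
  moreover have "G0 (f \<ominus> ?g) = 0"
    using G0_diff[OF assms(1) g] G0_smult[OF gam_eigen] G0_gam assms(2) by simp
  ultimately have "f \<ominus> ?g = \<zero>" using assms(2) by (rule eigen_zero)
  then show ?thesis using c diff_eq_zero_iff by simp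
qed

lemma eigenspace_B:
  assumes "Im z \<noteq> 0"
  shows "one_dimensional H (eigenspace H B z)"
  unfolding one_dimensional_def
proof (intro bexI conjI)
  show "gam z \<noteq> \<zero>" using G0_gam[OF assms] G_zero by auto
  have "(c \<odot> gam z, z \<odot> (c \<odot> gam z)) \<in> B" for c
  proof -
    have "z \<odot> (c \<odot> gam z) = c \<odot> (z \<odot> gam z)"
      using gam_carrier[OF assms] by (intro vector_eqI) (simp_all add: ip_simps)
    then show ?thesis using B_smult[OF gam_eigen[OF assms]] by simp
  qed
  then show "eigenspace H B z = {c \<odot> gam z |c. True}"
    using eigenvector_eq[OF _ assms] by (auto simp: eigenspace_def)
qed (rule gam_carrier[OF assms])

lemma symmetric_op_11_S: "symmetric_op_11 H S"
  unfolding symmetric_op_11_def adj_S symmetric_op_def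
  using linear_S S_dense S_subset_B closed_op_adj[of B] linear_B
  by (auto simp: adj_B linear_op_def intro!: eigenspace_B)

text \<open>Green's identity for \<open>gam z\<close> with itself gives Im z |gam z|^2 = Im (W z),
  and the values of \<open>W\<close> at i and -i are prescribed.\<close>

lemma nrm_gam: "nrm H (gam \<i>) = 1" "nrm H (gam (- \<i>)) = 1"
proof -
  have *: "2 * Im z * (nrm H (gam z))\<^sup>2 = 2 * Im (W z)" if z: "Im z \<noteq> 0" for z
  proof -
    have "(z - cnj z) * ip H (gam z) (gam z) = W z - cnj (W z)"
      using green[OF gam_eigen gam_eigen, OF z z] gam_carrier[OF z]
      by (simp add: ip_simps G0_gam[OF z] G1_gam[OF z] algebra_simps)
    then show ?thesis
      using gam_carrier[OF z] by (simp add: ip_self complex_eq_iff)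
  qed
  show "nrm H (gam \<i>) = 1" "nrm H (gam (- \<i>)) = 1"
    using *[of \<i>] *[of "- \<i>"] nrm_nonneg[OF gam_carrier[of \<i>]]
      nrm_nonneg[OF gam_carrier[of "- \<i>"]]
    by (auto simp: W_i W_minus_i power2_eq_1_iff simp del: nrm_nonneg)
qed

end

section \<open>Orthogonal projection onto a closed subspace\<close>

context hilbert_metric_space
begin

lemma closed_subspace_closed:
  assumes "closed_subspace H M"
  shows "M \<subseteq> carrier H" "x \<in> M \<Longrightarrow> c \<odot> x \<in> M" "x \<in> M \<Longrightarrow> y \<in> M \<Longrightarrow> x \<oplus> y \<in> M"
proof -
  have s: "submodule M complex_ring H" using assms by (simp add: closed_subspace_def)
  then show "M \<subseteq> carrier H" "x \<in> M \<Longrightarrow> y \<in> M \<Longrightarrow> x \<oplus> y \<in> M"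
    using subgroup.subset[of M "add_monoid H"] subgroup.m_closed[of M "add_monoid H" x y]
    by (auto simp: submodule_def)
  show "x \<in> M \<Longrightarrow> c \<odot> x \<in> M"
    using submodule.smult_closed[OF s, of c x] by (simp add: complex_ring_def)
qed

lemma orthogonal_part_le:
  assumes "u \<in> carrier H" "v \<in> carrier H" "ip H v u = 0"
  shows "nrm H u \<le> nrm H (u \<oplus> v)"
proof (cases "nrm H u = 0")
  case False
  have "ip H (u \<oplus> v) u = ip H u u" using assms by (simp add: ip_simps)
  then have "(nrm H u)\<^sup>2 \<le> nrm H (u \<oplus> v) * nrm H u"
    using Cauchy_Schwarz[of "u \<oplus> v" u] assms by (simp add: ip_self norm_power)
  then show ?thesis
    using False nrm_nonneg[OF assms(1)] by (simp add: power2_eq_square)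
qed (use assms in simp)

text \<open>A reducing subspace comes with projections only for the vectors of a dense set.
  Projecting is a contraction, so the projections of an approximating sequence form a Cauchy
  sequence; its limit lies in the closed \<open>M\<close> and keeps the orthogonality.\<close>

lemma projection_exists:
  assumes M: "closed_subspace H M" and D: "dense_in H D"
    and proj: "\<And>f. f \<in> D \<Longrightarrow> \<exists>f'\<in>M. f \<ominus> f' \<in> orthogonal_compl H M"
    and x: "x \<in> carrier H"
  obtains p where "p \<in> M" "x \<ominus> p \<in> orthogonal_compl H M"
proof -
  note Mc = closed_subspace_closed[OF M]
  have "\<exists>f f'. f \<in> carrier H \<and> f' \<in> M \<and> nrm H (x \<ominus> f) < 1 / real (Suc n) \<and>
      f \<ominus> f' \<in> orthogonal_compl H M" for n
  proof -
    obtain f where "f \<in> D \<inter> carrier H" "nrm H (x \<ominus> f) < 1 / real (Suc n)"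
      using D x unfolding dense_in_iff by (metis divide_pos_pos of_nat_0_less_iff zero_less_Suc zero_less_one)
    with proj show ?thesis by blast
  qed
  then obtain f f' where f: "\<And>n. f n \<in> carrier H" and f': "\<And>n. f' n \<in> M"
    and lim: "\<And>n. nrm H (x \<ominus> f n) < 1 / real (Suc n)"
    and orth: "\<And>n. f n \<ominus> f' n \<in> orthogonal_compl H M" by metis
  have f'c: "f' n \<in> carrier H" for n using f' Mc(1) by blast
  have ortho: "ip H (f n \<ominus> f' n) m = 0" if "m \<in> M" for n m
    using orth[of n] that by (simp add: orthogonal_compl_def)
  have small: "nrm H (f' n \<ominus> f' k) \<le> nrm H (x \<ominus> f k) + nrm H (x \<ominus> f n)" for n k
  proof -
    \<comment> \<open>\<open>?u\<close> is the part in \<open>M\<close> and \<open>?v\<close> the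
      orthogonal part of f n - f k.\<close>
    let ?u = "f' n \<ominus> f' k" and ?v = "(f n \<ominus> f' n) \<ominus> (f k \<ominus> f' k)"
    have c: "?u \<in> carrier H" "?v \<in> carrier H" using f f'c by auto
    have "?u = f' n \<oplus> (-1) \<odot> f' k"
      using f'c by (intro vector_eqI) (simp_all add: ip_simps)
    then have "?u \<in> M" using Mc f' by simp
    then have "ip H ?v ?u = 0"
      using f f'c Mc(1) ortho[of ?u n] ortho[of ?u k] by (simp add: ip_simps subset_iff)
    then have "nrm H ?u \<le> nrm H (?u \<oplus> ?v)" using c by (intro orthogonal_part_le)
    also have "?u \<oplus> ?v = (x \<ominus> f k) \<oplus> (-1) \<odot> (x \<ominus> f n)"
      using f f'c x by (intro vector_eqI) (simp_all add: ip_simps)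
    also have "nrm H \<dots> \<le> nrm H (x \<ominus> f k) + nrm H (x \<ominus> f n)"
      using nrm_triangle[of "x \<ominus> f k" "(-1) \<odot> (x \<ominus> f n)"] f x by (simp add: nrm_smult)
    finally show ?thesis .
  qed
  have inv: "\<exists>N. 2 / real (Suc N) < e" if "e > 0" for e :: real
    using reals_Archimedean[of "e / 2"] that by (auto simp: field_simps)
  have mono: "1 / real (Suc n) \<le> 1 / real (Suc N)" if "N \<le> n" for n N
    using that by (simp add: frac_le)
  have "MS.MCauchy f'"
    unfolding MS.MCauchy_def
  proof (intro conjI allI impI)
    fix e :: real assume "0 < e"
    then obtain N where N: "2 / real (Suc N) < e" using inv by blast
    show "\<exists>N. \<forall>n n'. N \<le> n \<longrightarrow> N \<le> n' \<longrightarrow> dst H (f' n) (f' n') < e"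
    proof (intro exI allI impI)
      fix n k assume "N \<le> n" "N \<le> k"
      then show "dst H (f' n) (f' k) < e"
        using small[of n k] lim[of n] lim[of k] mono[of N n] mono[of N k] N by (simp add: dst_def)
    qed
  qed (use f'c in auto)
  then obtain p where p: "limitin (norm_topology H) f' p sequentially"
    using complete MS.mcomplete_def by auto
  have pM: "p \<in> M"
    using p M f' limitin_closedin[of "norm_topology H" f' p sequentially M]
    by (simp add: closed_subspace_def)
  then have pc: "p \<in> carrier H" using Mc(1) by blast
  have "ip H (x \<ominus> p) m = 0" if m: "m \<in> M" for m
  proof -
    have mc: "m \<in> carrier H" using m Mc(1) by blast
    have bound: "cmod (ip H (x \<ominus> p) m) \<le> e * nrm H m" if "e > 0" for e
    proof -
      have "\<forall>\<^sub>F n in sequentially. f' n \<in> carrier H \<and> dst H (f' n) p < e / 2"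
        using p half_gt_zero[OF \<open>e > 0\<close>] unfolding MS.limitin_metric by blast
      then obtain N where N: "\<And>n. n \<ge> N \<Longrightarrow> dst H (f' n) p < e / 2"
        unfolding eventually_sequentially by blast
      obtain N' where N': "2 / real (Suc N') < e" using inv \<open>e > 0\<close> by blast
      define n where "n = max N N'"
      have n: "dst H (f' n) p < e / 2" "nrm H (x \<ominus> f n) < e / 2"
        using N[of n] lim[of n] mono[of N' n] N' by (auto simp: n_def)
      \<comment> \<open>The residual f n - f' n is orthogonal to m and drops out of x - p.\<close>
      have "ip H (x \<ominus> p) m = ip H ((x \<ominus> f n) \<oplus> (f' n \<ominus> p)) m"
        using x pc mc f f'c ortho[OF m, of n] by (simp add: ip_simps)
      also have "cmod \<dots> \<le> nrm H ((x \<ominus> f n) \<oplus> (f' n \<ominus> p)) * nrm H m"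
        using x pc mc f f'c by (intro Cauchy_Schwarz) auto
      also have "\<dots> \<le> e * nrm H m"
        using nrm_triangle[of "x \<ominus> f n" "f' n \<ominus> p"] n x pc mc f f'c
        by (intro mult_right_mono) (auto simp: dst_def)
      finally show ?thesis .
    qed
    have "cmod (ip H (x \<ominus> p) m) \<le> 0 + e" if "e > 0" for e
      using bound[of "e / (nrm H m + 1)"] that nrm_nonneg[OF mc]
      by (smt (verit, ccfv_SIG) divide_pos_pos mult_left_mono nonzero_eq_divide_eq)
    then have "cmod (ip H (x \<ominus> p) m) \<le> 0" by (rule field_le_epsilon)
    then show ?thesis by simp
  qed
  then have "x \<ominus> p \<in> orthogonal_compl H M"
    using x pc by (simp add: orthogonal_compl_def)
  with pM show thesis by (rule that)
qed

end

section \<open>Primeness of the symmetric operator\<close>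

context boundary_triple
begin

text \<open>Let p be the projection of \<open>gam z\<close> onto a reducing \<open>M\<close>.
  Against the part of \<open>S\<close> in \<open>M\<close>, p cannot be distinguished from
  \<open>gam z\<close>, so (p, z p) lies in the adjoint of that part. If the part is self-adjoint, p
  satisfies S p = z p with z non-real and vanishes; thus \<open>M\<close> is orthogonal to
  \<open>gam z\<close>.\<close>

lemma prime_S: "prime_op H S"
  unfolding prime_op_def
proof (rule notI, elim exE conjE)
  fix M assume nz: "M \<noteq> {\<zero>}" and red: "reduces H S M"
    and sa: "selfadjoint_op (H\<lparr>carrier := M\<rparr>) (S \<inter> M \<times> M)"
  have M: "closed_subspace H M" using red by (simp add: reduces_def)
  note Mc = closed_subspace_closed[OF M]
  have D: "dense_in H (Domain S)" using S_dense by (simp add: densely_defined_def)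
  have proj: "\<exists>f'\<in>M. f \<ominus> f' \<in> orthogonal_compl H M" if "f \<in> Domain S" for f
    using red that unfolding reduces_def by blast
  have "ip H m (gam z) = 0" if m: "m \<in> M" and z: "Im z \<noteq> 0" for m z
  proof -
    have g: "gam z \<in> carrier H" by (rule gam_carrier[OF z])
    obtain p where p: "p \<in> M" "gam z \<ominus> p \<in> orthogonal_compl H M"
      using projection_exists[OF M D proj g] by blast
    then have pc: "p \<in> carrier H" using Mc(1) by blast
    have ip_p: "ip H k (gam z) = ip H k p" if k: "k \<in> M" for k
    proof -
      have kc: "k \<in> carrier H" using k Mc(1) by blast
      have "ip H (gam z \<ominus> p) k = 0" using p(2) k by (simp add: orthogonal_compl_def)
      then have "ip H k (gam z \<ominus> p) = 0" using ip_cnj_commute[of k "gam z \<ominus> p"] kc g pc by simp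
      then show ?thesis using kc g pc by (simp add: ip_simps)
    qed
    have "ip H k p = ip H f (z \<odot> p)" if fk: "(f, k) \<in> S" "f \<in> M" "k \<in> M" for f k
    proof -
      have c: "f \<in> carrier H" using fk Mc(1) by blast
      have "(gam z, z \<odot> gam z) \<in> adj H S" using gam_eigen[OF z] adj_S by simp
      then have "ip H k (gam z) = ip H f (z \<odot> gam z)" using fk(1) by (simp add: adj_alt)
      then show ?thesis using ip_p[OF fk(2)] ip_p[OF fk(3)] c g pc by (simp add: ip_simps)
    qed
    then have "(p, z \<odot> p) \<in> adj (H\<lparr>carrier := M\<rparr>) (S \<inter> M \<times> M)"
      using p(1) Mc by (auto simp: adj_def)
    then have "(p, z \<odot> p) \<in> S" using sa by (auto simp: selfadjoint_op_def)
    then have "p = \<zero>" using z by (intro eigen_zero) (auto simp: S_eq)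
    then show ?thesis using ip_p[OF m] m Mc(1) by (auto simp: ip_simps)
  qed
  then have "M \<subseteq> {\<zero>}" using total Mc(1) by blast
  moreover have "M \<noteq> {}"
    using M subgroup.one_closed[of M "add_monoid H"] by (auto simp: closed_subspace_def submodule_def)
  ultimately show False using nz by blast
qed

section \<open>Resolvent sets and the class of the main operator\<close>

lemma resolvent_restr_1_0:
  assumes z: "Im z \<noteq> 0"
  shows "z \<in> resolvent_set H (restr 1 0)"
  unfolding resolvent_set_def
proof (intro CollectI conjI ballI)
  fix h assume h: "h \<in> carrier H"
  obtain f where f: "(f, h \<oplus> z \<odot> f) \<in> B" "G0 f = 0" using solve[OF z h] by blast
  show "\<exists>!f. (f, h \<oplus> z \<odot> f) \<in> restr 1 0"
  proof (rule ex1I)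
    show "(f, h \<oplus> z \<odot> f) \<in> restr 1 0" using f by (simp add: restr_def)
    fix g assume "(g, h \<oplus> z \<odot> g) \<in> restr 1 0"
    then have g: "(g, h \<oplus> z \<odot> g) \<in> B" "G0 g = 0" by (auto simp: restr_def)
    note c = B_carrier(1)[OF f(1)] B_carrier(1)[OF g(1)]
    have "(h \<oplus> z \<odot> g) \<ominus> (h \<oplus> z \<odot> f) = z \<odot> (g \<ominus> f)"
      using h c by (intro vector_eqI) (simp_all add: ip_simps algebra_simps)
    then have "g \<ominus> f = \<zero>"
      using B_diff[OF g(1) f(1)] G0_diff[OF g(1) f(1)] g(2) f(2) z
      by (intro eigen_zero[of _ z]) simp_all
    then show "g = f" using c diff_eq_zero_iff by simp
  qed
next
  have "nrm H f \<le> inverse \<bar>Im z\<bar> * nrm H (k \<ominus> z \<odot> f)" if "(f, k) \<in> restr 1 0" for f k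
    using eigen_bound[OF that, of z] z by (simp add: field_simps)
  then show "\<exists>C. \<forall>(f, k)\<in>restr 1 0. nrm H f \<le> C * nrm H (k \<ominus> z \<odot> f)" by blast
qed

text \<open>\<open>restr 1 \<i>\<close> is dissipative: Im (ip k f) = |G1 f|^2 is nonnegative, which
  gives the lower bound at points of the lower half-plane. The point -i is taken because
  \<open>W\<close> is known there explicitly.\<close>

lemma resolvent_restr_1_i: "- \<i> \<in> resolvent_set H (restr 1 \<i>)"
  unfolding resolvent_set_def
proof (intro CollectI conjI ballI)
  let ?T = "restr 1 \<i>" and ?z = "- \<i>"
  have ne: "2 + \<i> * of_real Q \<noteq> (0 :: complex)" by (simp add: complex_eq_iff)
  have bound: "nrm H f \<le> 1 * nrm H (k \<ominus> ?z \<odot> f)" if fk: "(f, k) \<in> ?T" for f k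
  proof (cases "nrm H f = 0")
    case True
    then show ?thesis using fk B_carrier by (auto simp: restr_def)
  next
    case False
    have B: "(f, k) \<in> B" and "G0 f + \<i> * G1 f = 0" using fk by (auto simp: restr_def)
    then have G0: "G0 f = - \<i> * G1 f" by (simp add: eq_neg_iff_add_eq_0)
    note c = B_carrier[OF B]
    have "ip H k f - cnj (ip H k f) = 2 * \<i> * (G1 f * cnj (G1 f))"
      using green[OF B B] c ip_cnj_commute[of f k] by (simp add: G0)
    also have "\<dots> = 2 * \<i> * of_real ((cmod (G1 f))\<^sup>2)" by (simp only: complex_norm_square)
    finally have "Im (ip H k f) = (cmod (G1 f))\<^sup>2" by (simp add: complex_eq_iff)
    then have "(nrm H f)\<^sup>2 \<le> Im (ip H (k \<ominus> ?z \<odot> f) f)"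
      using c by (simp add: ip_simps ip_self)
    also have "\<dots> \<le> nrm H (k \<ominus> ?z \<odot> f) * nrm H f"
      using abs_Im_le_cmod[of "ip H (k \<ominus> ?z \<odot> f) f"] Cauchy_Schwarz[of "k \<ominus> ?z \<odot> f" f] c
      by simp
    finally show ?thesis
      using False nrm_nonneg[OF c(1)] by (simp add: power2_eq_square)
  qed
  then show "\<exists>C. \<forall>(f, k)\<in>?T. nrm H f \<le> C * nrm H (k \<ominus> ?z \<odot> f)" by blast
  fix h assume h: "h \<in> carrier H"
  obtain f where f: "(f, h \<oplus> ?z \<odot> f) \<in> B" "G0 f = 0" using solve[of ?z h] h by auto
  \<comment> \<open>The solution with \<open>G0\<close> zero is corrected by a multiple of
    \<open>gam (- \<i>)\<close>. Since 1 + i W (-i) = 2 + i Q, this \<open>c\<close> cancels i G1 f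
    in the boundary condition.\<close>
  define c where "c = - \<i> * G1 f / (2 + \<i> * of_real Q)"
  have g: "(c \<odot> gam ?z, c \<odot> (?z \<odot> gam ?z)) \<in> B" by (intro B_smult gam_eigen) simp
  let ?f = "f \<oplus> c \<odot> gam ?z"
  note cc = B_carrier(1)[OF f(1)] gam_carrier[of ?z]
  have "(h \<oplus> ?z \<odot> f) \<oplus> c \<odot> (?z \<odot> gam ?z) = h \<oplus> ?z \<odot> ?f"
    using h cc by (intro vector_eqI) (simp_all add: ip_simps algebra_simps)
  moreover have "G0 ?f + \<i> * G1 ?f = \<i> * G1 f + c * (2 + \<i> * of_real Q)"
    by (simp add: G0_add[OF f(1) g] G1_add[OF f(1) g] G0_smult[OF gam_eigen] G1_smult[OF gam_eigen]
        G0_gam G1_gam W_minus_i f(2) algebra_simps)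
  moreover have "\<i> * G1 f + c * (2 + \<i> * of_real Q) = 0"
    using ne by (simp add: c_def)
  ultimately have fT: "(?f, h \<oplus> ?z \<odot> ?f) \<in> ?T"
    using B_add[OF f(1) g] by (simp add: restr_def)
  show "\<exists>!f. (f, h \<oplus> ?z \<odot> f) \<in> ?T"
  proof (rule ex1I[of _ ?f])
    show "(?f, h \<oplus> ?z \<odot> ?f) \<in> ?T" by (rule fT)
  next
    fix g assume gT: "(g, h \<oplus> ?z \<odot> g) \<in> ?T"
    have T: "(g, h \<oplus> ?z \<odot> g) \<in> B" "(?f, h \<oplus> ?z \<odot> ?f) \<in> B"
      "G0 g + \<i> * G1 g = 0" "G0 ?f + \<i> * G1 ?f = 0"
      using gT fT by (simp_all add: restr_def)
    have gc: "g \<in> carrier H" "?f \<in> carrier H" using T B_carrier by blast+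
    have "(h \<oplus> ?z \<odot> x) \<ominus> (h \<oplus> ?z \<odot> y) = ?z \<odot> (x \<ominus> y)"
      if "x \<in> carrier H" "y \<in> carrier H" for x y
      using h that by (intro vector_eqI) (simp_all add: ip_simps algebra_simps)
    note eq = this[OF gc]
    have "G0 (g \<ominus> ?f) + \<i> * G1 (g \<ominus> ?f) = (G0 g + \<i> * G1 g) - (G0 ?f + \<i> * G1 ?f)"
      by (simp only: G0_diff[OF T(1,2)] G1_diff[OF T(1,2)]) (simp add: algebra_simps)
    then have "(g \<ominus> ?f, ?z \<odot> (g \<ominus> ?f)) \<in> ?T"
      using B_diff[OF T(1,2)] T(3,4) unfolding eq restr_def by simp
    from bound[OF this] have "nrm H (g \<ominus> ?f) \<le> 0"
      using gc nrm_eq_0_iff[of "?z \<odot> (g \<ominus> ?f) \<ominus> ?z \<odot> (g \<ominus> ?f)"]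
      by (simp add: diff_eq_zero_iff)
    then have "g \<ominus> ?f = \<zero>"
      using gc nrm_eq_0_iff[of "g \<ominus> ?f"] nrm_nonneg[of "g \<ominus> ?f"] diff_closed by (metis antisym)
    then show "g = ?f" using gc diff_eq_zero_iff by metis
  qed
qed

lemma main_op_class_restr: "main_op_class H S (restr 1 \<i>)"
  unfolding main_op_class_def
proof (intro conjI)
  have adjT: "adj H (restr 1 \<i>) = restr 1 (- \<i>)" using adj_restr[of 1 \<i>] by simp
  show "\<not> symmetric_op H (restr 1 \<i>)"
  proof
    assume "symmetric_op H (restr 1 \<i>)"
    then have sub: "restr 1 \<i> \<subseteq> restr 1 (- \<i>)" by (simp add: symmetric_op_def adjT)
    \<comment> \<open>The boundary values (-i, 1) satisfy G0 + i G1 = 0, while G0 - i G1 =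
      -2i.\<close>
    obtain f h where "(f, h) \<in> B" "G0 f = - \<i>" "G1 f = 1" by (rule boundary_surj)
    then have "(f, h) \<in> restr 1 \<i>" "(f, h) \<notin> restr 1 (- \<i>)" by (simp_all add: restr_def)
    then show False using sub by blast
  qed
  show "resolvent_set H (restr 1 \<i>) \<noteq> {}" using resolvent_restr_1_i by blast
  \<comment> \<open>The conditions G0 + i G1 = 0 and G0 - i G1 = 0 together force G0 = G1 =
    0.\<close>
  show "Domain S = Domain (restr 1 \<i>) \<inter> Domain (adj H (restr 1 \<i>))"
    unfolding adjT by (auto simp: S_eq restr_def Domain_iff complex_eq_iff)
qed (simp_all add: linear_restr S_subset_restr adj_S restr_subset)

end

section \<open>The L-system of a boundary triple\<close>

context boundary_triple
begin

text \<open>The functional \<open>g \<mapsto> cnj (G1 g)\<close> in \<open>H\<^sub>-\<close> plays the role of the channel vector: the state-space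
  operator is \<open>f \<mapsto> B f + (G0 f + \<i> G1 f) \<chi>\<close>.\<close>

definition state :: "'a \<Rightarrow> 'a \<Rightarrow> complex" where
  "state f g = (if g \<in> Domain B then ip H (op_app B f) g + (G0 f + \<i> * G1 f) * cnj (G1 g) else 0)"

definition chan :: "complex \<Rightarrow> 'a \<Rightarrow> complex" where
  "chan c g = (if g \<in> Domain B then c * cnj (G1 g) else 0)"

definition sys :: "'a L_system" where
  "sys = \<lparr>sys_space = H, sym_op = S, main_op = restr 1 \<i>, state_op = state, channel_op = chan\<rparr>"

abbreviation "E \<equiv> hplus H S"

section \<open>Boundedness with respect to the graph norm\<close>

lemma hplus_simps [simp]:
  "carrier E = Domain B" "add E = add H" "smult E = smult H"
  by (simp_all add: hplus_def adj_S)

lemma nrm_hplus: "nrm E f = sqrt (Re (ip H f f + ip H (op_app B f) (op_app B f)))"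
  by (simp add: nrm_def hplus_def adj_S)

lemma nrm_le_hplus:
  assumes "(f, h) \<in> B"
  shows "nrm H f \<le> nrm E f" "nrm H h \<le> nrm E f"
  using ip_nonneg[OF B_carrier(1)[OF assms]] ip_nonneg[OF B_carrier(2)[OF assms]]
  unfolding nrm_hplus op_app_B[OF assms] by (simp_all add: nrm_def)

lemma nrm_hplus_nonneg: "f \<in> Domain B \<Longrightarrow> 0 \<le> nrm E f"
  using nrm_le_hplus(1) nrm_nonneg B_carrier(1) by (meson DomainE order_trans)

text \<open>Green's identity against fixed elements with boundary values (0, 1) and (1, 0) expresses
  - G0 f and G1 f as differences of inner products, which the graph norm controls.\<close>

lemma G_bounded:
  obtains C where "0 \<le> C" "\<And>f. f \<in> Domain B \<Longrightarrow> cmod (G0 f) \<le> C * nrm E f"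
    "\<And>f. f \<in> Domain B \<Longrightarrow> cmod (G1 f) \<le> C * nrm E f"
proof -
  have bd: "cmod (G1 f * cnj (G0 g) - G0 f * cnj (G1 g)) \<le> (nrm H g + nrm H k) * nrm E f"
    if "f \<in> Domain B" and gk: "(g, k) \<in> B" for f g k
  proof -
    obtain h where fh: "(f, h) \<in> B" using \<open>f \<in> Domain B\<close> by (rule DomainE)
    note c = B_carrier[OF fh] B_carrier[OF gk]
    have "cmod (ip H h g - ip H f k) \<le> nrm H h * nrm H g + nrm H f * nrm H k"
      using norm_triangle_ineq4[of "ip H h g" "ip H f k"]
        Cauchy_Schwarz[OF c(2) c(3)] Cauchy_Schwarz[OF c(1) c(4)] by linarith
    also have "\<dots> \<le> nrm E f * nrm H g + nrm E f * nrm H k"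
      using nrm_le_hplus[OF fh] c by (intro add_mono mult_right_mono) auto
    finally show ?thesis using green[OF fh gk] by (simp add: algebra_simps)
  qed
  obtain g k where g: "(g, k) \<in> B" "G0 g = 0" "G1 g = 1" by (rule boundary_surj)
  obtain g' k' where g': "(g', k') \<in> B" "G0 g' = 1" "G1 g' = 0" by (rule boundary_surj)
  note c = B_carrier[OF g(1)] B_carrier[OF g'(1)]
  define C where "C = nrm H g + nrm H k + (nrm H g' + nrm H k')"
  show thesis
  proof (rule that)
    show "0 \<le> C" using c by (simp add: C_def)
    fix f assume f: "f \<in> Domain B"
    have "(nrm H g + nrm H k) * nrm E f \<le> C * nrm E f" "(nrm H g' + nrm H k') * nrm E f \<le> C * nrm E f"
      unfolding C_def using c nrm_hplus_nonneg[OF f] by (intro mult_right_mono; simp)+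
    then show "cmod (G0 f) \<le> C * nrm E f" "cmod (G1 f) \<le> C * nrm E f"
      using bd[OF f g(1)] bd[OF f g'(1)] g g' by auto
  qed
qed

lemma B_domain_add: "f \<in> Domain B \<Longrightarrow> g \<in> Domain B \<Longrightarrow> f \<oplus> g \<in> Domain B"
  using B_add by blast

lemma B_domain_smult: "f \<in> Domain B \<Longrightarrow> c \<odot> f \<in> Domain B"
  using B_smult by blast

lemma antidualI:
  assumes "\<And>g. g \<notin> Domain B \<Longrightarrow> \<phi> g = 0"
    and "\<And>f g. f \<in> Domain B \<Longrightarrow> g \<in> Domain B \<Longrightarrow> \<phi> (f \<oplus> g) = \<phi> f + \<phi> g"
    and "\<And>c g. g \<in> Domain B \<Longrightarrow> \<phi> (c \<odot> g) = cnj c * \<phi> g"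
    and "\<And>g. g \<in> Domain B \<Longrightarrow> cmod (\<phi> g) \<le> C * nrm E g"
  shows "\<phi> \<in> antidual E"
  unfolding antidual_def using assms by (intro CollectI conjI exI[of _ C]) simp_all

lemma antidual_norm_le:
  assumes "0 \<le> C" "\<And>g. g \<in> Domain B \<Longrightarrow> cmod (\<phi> g) \<le> C * nrm E g"
  shows "antidual_norm E \<phi> \<le> C"
  unfolding antidual_norm_def
proof (rule cSUP_least)
  have "nrm E \<zero> = 0" by (simp add: nrm_hplus op_app_B[OF B_zero] ip_zero_left)
  then show "{g \<in> carrier E. nrm E g \<le> 1} \<noteq> {}" using B_zero by auto
next
  fix g assume g: "g \<in> {g \<in> carrier E. nrm E g \<le> 1}"
  then have "cmod (\<phi> g) \<le> C * nrm E g" using assms(2) by simp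
  also have "\<dots> \<le> C * 1" using g assms(1) by (intro mult_left_mono) auto
  finally show "cmod (\<phi> g) \<le> C" by simp
qed

lemma G_domain:
  assumes "f \<in> Domain B" "g \<in> Domain B"
  shows "G0 (f \<oplus> g) = G0 f + G0 g" "G1 (f \<oplus> g) = G1 f + G1 g"
    "G0 (c \<odot> f) = c * G0 f" "G1 (c \<odot> f) = c * G1 f"
    "op_app B (f \<oplus> g) = op_app B f \<oplus> op_app B g" "op_app B (c \<odot> f) = c \<odot> op_app B f"
    "op_app B f \<in> carrier H" "f \<in> carrier H"
proof -
  obtain h k where *: "(f, h) \<in> B" "(g, k) \<in> B" using assms by blast
  note op = op_app_B[OF *(1)] op_app_B[OF *(2)] op_app_B[OF B_add[OF *]] op_app_B[OF B_smult[OF *(1)]]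
  show "G0 (f \<oplus> g) = G0 f + G0 g" "G1 (f \<oplus> g) = G1 f + G1 g"
    "G0 (c \<odot> f) = c * G0 f" "G1 (c \<odot> f) = c * G1 f"
    "op_app B (f \<oplus> g) = op_app B f \<oplus> op_app B g" "op_app B (c \<odot> f) = c \<odot> op_app B f"
    "op_app B f \<in> carrier H" "f \<in> carrier H"
    using G0_add[OF *] G1_add[OF *] G0_smult[OF *(1)] G1_smult[OF *(1)] B_carrier[OF *(1)]
    by (simp_all add: op)
qed

lemma chan_bounded: "chan \<in> bounded_ops complex_space E"
proof -
  obtain C where C: "0 \<le> C" "\<And>f. f \<in> Domain B \<Longrightarrow> cmod (G1 f) \<le> C * nrm E f"
    by (rule G_bounded) blast
  have bd: "cmod (chan c g) \<le> (C * cmod c) * nrm E g" if "g \<in> Domain B" for c g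
    using mult_left_mono[OF C(2)[OF that], of "cmod c"] that
    by (simp add: chan_def norm_mult mult_ac)
  have "antidual_norm E (chan c) \<le> C * nrm complex_space c" for c
  proof -
    have "nrm complex_space c = cmod c"
      by (simp add: nrm_def complex_space_def cmod_def power2_eq_square)
    then show ?thesis using antidual_norm_le[of "C * cmod c" "chan c"] bd C(1) by simp
  qed
  moreover have "chan c \<in> antidual E" for c
    using bd B_domain_add B_domain_smult
    by (intro antidualI[where C = "C * cmod c"]) (auto simp: chan_def G_domain algebra_simps)
  ultimately show ?thesis
    by (auto simp: bounded_ops_def complex_space_def chan_def fun_eq_iff algebra_simps)
qed

lemma state_bounded: "state \<in> bounded_ops E E"
proof -
  obtain C where C: "0 \<le> C" "\<And>f. f \<in> Domain B \<Longrightarrow> cmod (G0 f) \<le> C * nrm E f"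
    "\<And>f. f \<in> Domain B \<Longrightarrow> cmod (G1 f) \<le> C * nrm E f"
    by (rule G_bounded) blast
  \<comment> \<open>The 1 is for the inner product, C + C bounds G0 f + i G1 f, and the last C
    bounds G1 g.\<close>
  let ?D = "1 + (C + C) * C"
  have bd: "cmod (state f g) \<le> (?D * nrm E f) * nrm E g" if f: "f \<in> Domain B" and g: "g \<in> Domain B" for f g
  proof -
    have n: "0 \<le> nrm E f" "0 \<le> nrm E g" using f g nrm_hplus_nonneg by auto
    obtain h where fh: "(f, h) \<in> B" using f by blast
    have gc: "g \<in> carrier H" using g B_carrier by blast
    have "cmod (ip H h g) \<le> nrm H h * nrm H g"
      using Cauchy_Schwarz[OF B_carrier(2)[OF fh] gc] .
    also have "\<dots> \<le> nrm E f * nrm E g"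
      using nrm_le_hplus[OF fh] g n gc by (intro mult_mono) (auto dest: nrm_le_hplus)
    finally have 1: "cmod (ip H h g) \<le> nrm E f * nrm E g" .
    have "cmod (G0 f + \<i> * G1 f) \<le> cmod (G0 f) + cmod (G1 f)"
      using norm_triangle_ineq[of "G0 f" "\<i> * G1 f"] by (simp add: norm_mult)
    also have "\<dots> \<le> (C + C) * nrm E f" using C(2,3)[OF f] by (simp add: algebra_simps)
    finally have "cmod ((G0 f + \<i> * G1 f) * cnj (G1 g)) \<le> ((C + C) * nrm E f) * (C * nrm E g)"
      unfolding norm_mult complex_mod_cnj using C(1) C(3)[OF g] n by (intro mult_mono) auto
    then have "cmod (ip H h g + (G0 f + \<i> * G1 f) * cnj (G1 g))
        \<le> nrm E f * nrm E g + ((C + C) * nrm E f) * (C * nrm E g)"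
      using 1 norm_triangle_ineq[of "ip H h g" "(G0 f + \<i> * G1 f) * cnj (G1 g)"] by linarith
    then show ?thesis using g by (simp add: state_def op_app_B[OF fh] algebra_simps)
  qed
  have "antidual_norm E (state f) \<le> ?D * nrm E f" if "f \<in> Domain B" for f
    using C(1) nrm_hplus_nonneg[OF that] bd[OF that] by (intro antidual_norm_le) auto
  moreover have "state f \<in> antidual E" if "f \<in> Domain B" for f
    using bd[OF that] that B_domain_add B_domain_smult
    by (intro antidualI[where C = "?D * nrm E f"])
      (auto simp: state_def G_domain ip_simps algebra_simps simp del: plus_closed)
  moreover have "state (f \<oplus> g) = (\<lambda>x. state f x + state g x)" if "f \<in> Domain B" "g \<in> Domain B" for f g
    using that by (auto simp: state_def fun_eq_iff G_domain ip_simps algebra_simps)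
  moreover have "state (c \<odot> f) = (\<lambda>x. c * state f x)" if "f \<in> Domain B" for c f
    using that by (auto simp: state_def fun_eq_iff G_domain ip_simps algebra_simps)
  ultimately show ?thesis unfolding bounded_ops_def by auto
qed

text \<open>Conjugation produces the term G1 f cnj (G0 g), which is not a multiple of \<chi> g.
  Green's identity, needed to move \<open>B\<close> back to f, cancels it and contributes G0 f cnj
  (G1 g) in its place.\<close>

lemma rig_adj_state:
  assumes fh: "(f, h) \<in> B"
  shows "rig_adj E state f
    = (\<lambda>g. if g \<in> Domain B then ip H h g + (G0 f - \<i> * G1 f) * cnj (G1 g) else 0)"
proof
  fix g
  have "cnj (state g f) = ip H h g + (G0 f - \<i> * G1 f) * cnj (G1 g)" if gk: "(g, k) \<in> B" for k
  proof -
    have "cnj (state g f) = ip H f k + (cnj (G0 g) - \<i> * cnj (G1 g)) * G1 f"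
      using fh ip_cnj_commute[of f k] B_carrier[OF gk] B_carrier[OF fh]
      by (auto simp: state_def op_app_B[OF gk])
    also have "\<dots> = ip H h g + (G0 f - \<i> * G1 f) * cnj (G1 g)"
      using green[OF fh gk] by (simp add: algebra_simps)
    finally show ?thesis .
  qed
  then show "rig_adj E state f g
    = (if g \<in> Domain B then ip H h g + (G0 f - \<i> * G1 f) * cnj (G1 g) else 0)"
    by (auto simp: rig_adj_def)
qed

lemma rig_re_state:
  assumes fh: "(f, h) \<in> B"
  shows "rig_re E state f = (\<lambda>g. if g \<in> Domain B then ip H h g + G0 f * cnj (G1 g) else 0)"
  unfolding rig_re_def rig_adj_state[OF fh]
  by (auto simp: fun_eq_iff state_def op_app_B[OF fh] field_simps)

lemma rig_im_state:
  assumes fh: "(f, h) \<in> B"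
  shows "rig_im E state f = chan (G1 f)"
  unfolding rig_im_def rig_adj_state[OF fh]
  by (auto simp: fun_eq_iff state_def chan_def op_app_B[OF fh] field_simps)

section \<open>Real part and quasi-kernel\<close>

lemma rig_embed_eq: "rig_embed H S h = (\<lambda>g. if g \<in> Domain B then ip H h g else 0)"
  by (simp add: rig_embed_def)

text \<open>\<chi> does not belong to \<open>H\<close>: it vanishes on the dense
  \<open>Domain S\<close>, yet not on all of \<open>Domain B\<close>. So the part from
  \<open>H\<close> and the multiple of \<chi> in an element of \<open>H\<^sub>-\<close> can be
  compared separately.\<close>

lemma weak_boundary_zero:
  assumes x: "x \<in> carrier H" and eq: "\<And>g. g \<in> Domain B \<Longrightarrow> ip H x g + a * cnj (G1 g) = 0"
  shows "x = \<zero>" "a = 0"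
proof -
  have D: "dense_in H (Domain S)" using S_dense by (simp add: densely_defined_def)
  show x0: "x = \<zero>"
  proof (rule dense_orthogonal_zero[OF D x])
    fix y assume "y \<in> Domain S \<inter> carrier H"
    then have "y \<in> Domain B" "G1 y = 0" by (auto simp: S_eq)
    then show "ip H x y = 0" using eq[of y] by simp
  qed
  obtain g k where g: "(g, k) \<in> B" "G0 g = 0" "G1 g = 1" by (rule boundary_surj)
  then show "a = 0" using eq[of g] x0 B_carrier[OF g(1)] by (auto simp: ip_simps)
qed

text \<open>The real part maps f to B f + G0 f \<chi>, and this lies in \<open>H\<close> exactly
  when the multiple of \<chi> vanishes.\<close>

lemma quasi_kernel_state: "quasi_kernel H S (rig_re E state) = restr 1 0"
proof (intro equalityI subrelI)
  fix f h assume "(f, h) \<in> quasi_kernel H S (rig_re E state)"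
  then have f: "f \<in> Domain B" and h: "h \<in> carrier H"
    and eq: "rig_re E state f = rig_embed H S h" by (auto simp: quasi_kernel_def)
  obtain k where fk: "(f, k) \<in> B" using f by blast
  have c: "k \<in> carrier H" using fk B_carrier by blast
  have "ip H (k \<ominus> h) g + G0 f * cnj (G1 g) = 0" if g: "g \<in> Domain B" for g
  proof -
    have "ip H k g + G0 f * cnj (G1 g) = ip H h g"
      using fun_cong[OF eq[unfolded rig_re_state[OF fk] rig_embed_eq], of g] g by simp
    moreover have "g \<in> carrier H" using g B_carrier by blast
    ultimately show ?thesis using c h by (simp add: ip_simps algebra_simps)
  qed
  then have "k \<ominus> h = \<zero>" "G0 f = 0"
    using weak_boundary_zero[of "k \<ominus> h" "G0 f"] c h by auto
  then show "(f, h) \<in> restr 1 0" using fk c h diff_eq_zero_iff by (auto simp: restr_def)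
next
  fix f h assume "(f, h) \<in> restr 1 0"
  then have "(f, h) \<in> B" "G0 f = 0" by (auto simp: restr_def)
  then show "(f, h) \<in> quasi_kernel H S (rig_re E state)"
    using B_carrier(2)[of f h] by (auto simp: quasi_kernel_def rig_re_state rig_embed_eq fun_eq_iff)
qed

lemma star_extension_state: "star_extension H S (restr 1 \<i>) state"
  unfolding star_extension_def
proof (intro conjI)
  have adjT: "adj H (restr 1 \<i>) = restr 1 (- \<i>)" using adj_restr[of 1 \<i>] by simp
  show "S \<subseteq> adj H (restr 1 \<i>)" unfolding adjT by (rule S_subset_restr)
  show "rig_extends H S (restr 1 \<i>) state"
    by (auto simp: rig_extends_def restr_def rig_embed_eq state_def op_app_B)
  show "rig_extends H S (adj H (restr 1 \<i>)) (rig_adj E state)"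
    unfolding adjT by (auto simp: rig_extends_def restr_def rig_embed_eq rig_adj_state fun_eq_iff)
  show "selfadjoint_op H (quasi_kernel H S (rig_re E state))"
    unfolding quasi_kernel_state selfadjoint_op_def
    using adj_restr[of 1 0] by (simp add: linear_restr dense_if_S_subset S_subset_restr)
qed (simp_all add: state_bounded S_subset_restr)

section \<open>Minimality and the impedance function\<close>

lemma chan_adj_chan: "f \<in> Domain B \<Longrightarrow> chan_adj chan f = G1 f"
  by (simp add: chan_adj_def chan_def)

lemma minimal_L_system_sys: "minimal_L_system sys"
proof -
  have im: "rig_im E state f = chan (chan_adj chan f)" if "f \<in> Domain B" for f
    using that rig_im_state chan_adj_chan by auto
  have "range chan = rig_im E state ` Domain B"
  proof (intro equalityI subsetI)
    fix \<phi> assume "\<phi> \<in> range chan"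
    then obtain c where c: "\<phi> = chan c" by blast
    obtain f h where "(f, h) \<in> B" "G0 f = 0" "G1 f = c" by (rule boundary_surj)
    then show "\<phi> \<in> rig_im E state ` Domain B" using rig_im_state c by force
  next
    fix \<phi> assume "\<phi> \<in> rig_im E state ` Domain B"
    then show "\<phi> \<in> range chan" using im by auto
  qed
  then show ?thesis
    using im hilbert symmetric_op_11_S main_op_class_restr star_extension_state chan_bounded prime_S
    by (simp add: minimal_L_system_def L_system_def sys_def sys_hplus_def)
qed

lemma realizes_sys:
  assumes V: "\<And>z. Im z > 0 \<Longrightarrow> V z = W z" and W: "\<And>z. Im z \<noteq> 0 \<Longrightarrow> W (cnj z) = cnj (W z)"
  shows "realizes sys V"
  unfolding realizes_def
proof (intro allI impI conjI)
  fix z assume z: "Im z \<noteq> 0"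
  show "z \<in> resolvent_set (sys_space sys) (sys_quasi_kernel sys)"
    using resolvent_restr_1_0[OF z]
    by (simp add: sys_quasi_kernel_def sys_def sys_hplus_def quasi_kernel_state)
  have re: "re_minus sys z f = (\<lambda>g. if g \<in> Domain B then ip H (h \<ominus> z \<odot> f) g + G0 f * cnj (G1 g) else 0)"
    if fh: "(f, h) \<in> B" for f h
    using B_carrier[OF fh] B_carrier(1)
    by (fastforce simp: re_minus_def sys_def sys_hplus_def rig_re_state[OF fh] rig_embed_eq fun_eq_iff
        ip_simps algebra_simps)
  note c = gam_carrier[OF z]
  have gD: "gam z \<in> Domain B" using gam_eigen[OF z] by blast
  have g: "re_minus sys z (gam z) = chan 1"
    unfolding re[OF gam_eigen[OF z]] using c B_carrier(1)
    by (fastforce simp: fun_eq_iff chan_def G0_gam[OF z] ip_simps)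
  show "channel_op sys 1 \<in> re_minus sys z ` carrier (sys_hplus sys)"
    using g gD by (auto simp: sys_def sys_hplus_def intro!: image_eqI[where x = "gam z"])
  \<comment> \<open>Injectivity identifies \<open>inv_into\<close> at \<open>chan 1\<close> with the
    solution \<open>gam z\<close>. A difference of two solutions satisfies the eigenvalue equation
    at z with \<open>G0\<close> zero.\<close>
  have "inj_on (re_minus sys z) (Domain B)"
  proof (rule inj_onI)
    fix f f' assume "f \<in> Domain B" "f' \<in> Domain B" and eq: "re_minus sys z f = re_minus sys z f'"
    then obtain h h' where fh: "(f, h) \<in> B" "(f', h') \<in> B" by blast
    note cc = B_carrier[OF fh(1)] B_carrier[OF fh(2)]
    let ?d = "f \<ominus> f'" and ?k = "h \<ominus> h'"
    have d: "(?d, ?k) \<in> B" by (rule B_diff[OF fh])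
    have "ip H (?k \<ominus> z \<odot> ?d) g + G0 ?d * cnj (G1 g) = 0" if g: "g \<in> Domain B" for g
    proof -
      have gc: "g \<in> carrier H" using g B_carrier by blast
      have "ip H (h \<ominus> z \<odot> f) g + G0 f * cnj (G1 g) = ip H (h' \<ominus> z \<odot> f') g + G0 f' * cnj (G1 g)"
        using fun_cong[OF eq[unfolded re[OF fh(1)] re[OF fh(2)]], of g] g by simp
      then show ?thesis using cc gc by (simp add: ip_simps G0_diff[OF fh] algebra_simps)
    qed
    then have k: "?k \<ominus> z \<odot> ?d = \<zero>" and G: "G0 ?d = 0"
      using weak_boundary_zero[of "?k \<ominus> z \<odot> ?d" "G0 ?d"] cc by auto
    have "?k = z \<odot> ?d" using k cc diff_eq_zero_iff[of ?k "z \<odot> ?d"] by simp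
    then have "?d = \<zero>" using d G z by (intro eigen_zero[of _ z]) simp_all
    then show "f = f'" using cc diff_eq_zero_iff by simp
  qed
  then have "inv_into (Domain B) (re_minus sys z) (chan 1) = gam z"
    using g gD by (metis inv_into_f_f)
  then have "impedance sys z = W z"
    using gD by (simp add: impedance_def sys_def sys_hplus_def chan_adj_chan G1_gam[OF z])
  then show "impedance sys z = (if Im z > 0 then V z else cnj (V (cnj z)))"
    using V[of z] V[of "cnj z"] W[OF z] z by auto
qed

text \<open>With gm = gam (-i) and gp = a gam i, membership of gp - \<kappa> gm in \<open>T\<close>
  means a i Q = \<kappa> (2 + i Q), because 1 + i W i = i Q and 1 + i W (-i) = 2 + i Q. Vanishing of
  \<open>G0\<close> on gp + U gm means U = - a. As |a| = 1, the first equation gives |\<kappa>| and,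
  for \<kappa> > 0, also the phase of a; the second then gives U.\<close>

lemma von_Neumann_parameters:
  assumes Q: "Q \<noteq> 0"
  obtains gp gm where "deficiency_vectors sys gp gm"
    "main_op_parameter sys gp gm (complex_of_real (\<bar>Q\<bar> / sqrt (Q\<^sup>2 + 4)))"
    "quasi_kernel_parameter sys gp gm (complex_of_real (Q / \<bar>Q\<bar>) *
        ((- complex_of_real Q + 2 * \<i>) / complex_of_real (sqrt (Q\<^sup>2 + 4))))"
proof -
  define s where "s = sqrt (Q\<^sup>2 + 4)"
  define \<kappa> where "\<kappa> = complex_of_real (\<bar>Q\<bar> / s)"
  define U where "U = complex_of_real (Q / \<bar>Q\<bar>) * ((- complex_of_real Q + 2 * \<i>) / complex_of_real s)"
  have s: "s > 0" "s\<^sup>2 = Q\<^sup>2 + 4" by (simp_all add: s_def add_nonneg_pos)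
  have "cmod (- complex_of_real Q + 2 * \<i>) = s" by (simp add: s_def cmod_def)
  then have U1: "cmod U = 1" using Q s(1) by (simp add: U_def norm_mult norm_divide)
  have "\<bar>Q\<bar> < s" using s by (intro power2_less_imp_less[of _ s]) auto
  then have k1: "cmod \<kappa> < 1" using s(1) by (simp add: \<kappa>_def norm_divide)
  \<comment> \<open>The boundary condition of \<open>T\<close> for gp - \<kappa> gm, with a = -
    U.\<close>
  have Uk: "- U * (\<i> * of_real Q) = \<kappa> * (2 + \<i> * of_real Q)"
  proof -
    have "complex_of_real (Q / \<bar>Q\<bar>) * of_real Q = of_real \<bar>Q\<bar>"
      using Q by (cases "Q > 0") (simp_all add: abs_if)
    moreover have "- (r * ((- q + 2 * \<i>) / t)) * (\<i> * q) = (r * q) * ((q - 2 * \<i>) / t * \<i>)"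
      for r q t :: complex by (simp add: divide_inverse algebra_simps)
    ultimately have "- U * (\<i> * of_real Q) = of_real \<bar>Q\<bar> * ((of_real Q - 2 * \<i>) / of_real s * \<i>)"
      unfolding U_def by metis
    also have "\<dots> = \<kappa> * (2 + \<i> * of_real Q)" by (simp add: \<kappa>_def algebra_simps add_divide_distrib)
    finally show ?thesis .
  qed
  define gp where "gp = (- U) \<odot> gam \<i>"
  define gm where "gm = gam (- \<i>)"
  have c: "gam \<i> \<in> carrier H" "gp \<in> carrier H" "gm \<in> carrier H" by (simp_all add: gp_def gm_def gam_carrier)
  have gpB: "(gp, (- U) \<odot> (\<i> \<odot> gam \<i>)) \<in> B" and gmB: "(gm, (- \<i>) \<odot> gm) \<in> B"
    unfolding gp_def gm_def by (intro B_smult gam_eigen; simp)+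
  have Gp: "G0 gp = - U" "G1 gp = - U * (of_real Q + \<i>)"
    using G0_smult[OF gam_eigen] G1_smult[OF gam_eigen] by (simp_all add: gp_def G0_gam G1_gam W_i)
  have Gm: "G0 gm = 1" "G1 gm = of_real Q - \<i>"
    by (simp_all add: gm_def G0_gam G1_gam W_minus_i)
  have "(- U) \<odot> (\<i> \<odot> gam \<i>) = \<i> \<odot> gp"
    unfolding gp_def using c by (intro vector_eqI) (simp_all add: ip_simps)
  then have def: "deficiency_vectors sys gp gm"
    using gpB gmB nrm_gam U1 c
    by (simp add: deficiency_vectors_def sys_def adj_S eigenspace_def gp_def gm_def nrm_smult)
  have kB: "(\<kappa> \<odot> gm, \<kappa> \<odot> ((- \<i>) \<odot> gm)) \<in> B" by (rule B_smult[OF gmB])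
  have "G0 (gp \<ominus> \<kappa> \<odot> gm) + \<i> * G1 (gp \<ominus> \<kappa> \<odot> gm)
      = - U * (\<i> * of_real Q) - \<kappa> * (2 + \<i> * of_real Q)"
    by (simp add: G0_diff[OF gpB kB] G1_diff[OF gpB kB] G0_smult[OF gmB] G1_smult[OF gmB] Gp Gm
        algebra_simps)
  then have "(gp \<ominus> \<kappa> \<odot> gm, (- U) \<odot> (\<i> \<odot> gam \<i>) \<ominus> \<kappa> \<odot> ((- \<i>) \<odot> gm)) \<in> restr 1 \<i>"
    using B_diff[OF gpB kB] Uk by (simp add: restr_def)
  then have main: "main_op_parameter sys gp gm \<kappa>"
    using k1 by (auto simp: main_op_parameter_def sys_def)
  have UB: "(U \<odot> gm, U \<odot> ((- \<i>) \<odot> gm)) \<in> B" by (rule B_smult[OF gmB])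
  define g where "g = gp \<oplus> U \<odot> gm"
  obtain k where gB: "(g, k) \<in> B" unfolding g_def using B_add[OF gpB UB] by blast
  have gc: "g \<in> carrier H" using gB B_carrier by blast
  have G: "G0 g = 0" "G1 g = - 2 * \<i> * U"
    unfolding g_def G0_add[OF gpB UB] G1_add[OF gpB UB] G0_smult[OF gmB] G1_smult[OF gmB] Gp Gm
    by (simp_all add: algebra_simps)
  have "U \<noteq> 0" using U1 by auto
  then have G1g: "G1 g \<noteq> 0" by (simp add: G)
  have "Domain (restr 1 0) = {f \<oplus> c \<odot> g |f c. f \<in> Domain S}"
  proof (intro equalityI subsetI)
    fix f assume "f \<in> Domain (restr 1 0)"
    then obtain h where fh: "(f, h) \<in> B" and f0: "G0 f = 0" by (auto simp: restr_def)
    \<comment> \<open>Both f and g have \<open>G0\<close> zero and \<open>G1 g\<close> is not zero,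
      so subtracting this multiple of g leaves an element of \<open>Domain S\<close>.\<close>
    let ?c = "G1 f / G1 g"
    have cg: "(?c \<odot> g, ?c \<odot> k) \<in> B" by (rule B_smult[OF gB])
    have "f \<ominus> ?c \<odot> g \<in> Domain S"
      using B_diff[OF fh cg] G0_diff[OF fh cg] G1_diff[OF fh cg] G0_smult[OF gB] G1_smult[OF gB] f0 G G1g
      by (auto simp: S_eq)
    moreover have "f = (f \<ominus> ?c \<odot> g) \<oplus> ?c \<odot> g"
      using B_carrier[OF fh] gc by (intro vector_eqI) (simp_all add: ip_simps)
    ultimately show "f \<in> {f \<oplus> c \<odot> g |f c. f \<in> Domain S}" by blast
  next
    fix f assume "f \<in> {f \<oplus> c \<odot> g |f c. f \<in> Domain S}"
    then obtain f0 c h where f: "f = f0 \<oplus> c \<odot> g" "(f0, h) \<in> B" "G0 f0 = 0" by (auto simp: S_eq)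
    show "f \<in> Domain (restr 1 0)"
      using B_add[OF f(2) B_smult[OF gB, of c]] G0_add[OF f(2) B_smult[OF gB, of c]] G0_smult[OF gB, of c] f G
      by (auto simp: restr_def)
  qed
  moreover have "g \<notin> Domain S" using G1g by (auto simp: S_eq)
  ultimately have "quasi_kernel_parameter sys gp gm U"
    using U1 by (simp add: quasi_kernel_parameter_def sys_def sys_quasi_kernel_def sys_hplus_def
        quasi_kernel_state Let_def g_def)
  with def main that show thesis unfolding \<kappa>_def U_def s_def by blast
qed

end

section \<open>Square integrable functions for a Herglotz measure\<close>

locale herglotz_measure =
  fixes \<mu> :: "real measure"
  assumes sets_eq [measurable_cong]: "sets \<mu> = sets borel"
    and infinite: "emeasure \<mu> UNIV = \<infinity>"
    and weight_one: "(\<integral>\<^sup>+t. ennreal (1 / (1 + t\<^sup>2)) \<partial>\<mu>) = 1"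
begin

lemma space_eq [simp]: "space \<mu> = UNIV"
  using sets_eq_imp_space_eq[OF sets_eq] by simp

lemma measurable_eq: "borel_measurable \<mu> = borel_measurable borel"
  by (rule measurable_cong_sets[OF sets_eq refl])

definition L2 :: "(real \<Rightarrow> complex) set" where
  "L2 = {f \<in> borel_measurable borel. integrable \<mu> (\<lambda>t. (cmod (f t))\<^sup>2)}"

lemma L2_measurable: "f \<in> L2 \<Longrightarrow> f \<in> borel_measurable borel"
  by (simp add: L2_def)

lemma L2_integrable: "f \<in> L2 \<Longrightarrow> integrable \<mu> (\<lambda>t. (cmod (f t))\<^sup>2)"
  by (simp add: L2_def)

lemma L2_bound:
  assumes "f \<in> L2" "g \<in> borel_measurable borel" "\<And>t. cmod (g t) \<le> C * cmod (f t)"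
  shows "g \<in> L2"
proof -
  have [measurable]: "g \<in> borel_measurable \<mu>" using assms(2) measurable_eq by simp
  have "integrable \<mu> (\<lambda>t. (cmod (g t))\<^sup>2)"
  proof (rule Bochner_Integration.integrable_bound)
    show "integrable \<mu> (\<lambda>t. C\<^sup>2 * (cmod (f t))\<^sup>2)" using L2_integrable[OF assms(1)] by simp
    show "AE t in \<mu>. norm ((cmod (g t))\<^sup>2) \<le> norm (C\<^sup>2 * (cmod (f t))\<^sup>2)"
      using power_mono[OF assms(3) norm_ge_zero, where n = 2]
      by (intro AE_I2) (simp add: power_mult_distrib)
  qed simp
  then show ?thesis using assms(2) by (simp add: L2_def)
qed

lemma L2_zero: "(\<lambda>_. 0) \<in> L2"
  by (simp add: L2_def)

lemma L2_scale: "f \<in> L2 \<Longrightarrow> (\<lambda>t. c * f t) \<in> L2"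
  by (rule L2_bound[of f _ "cmod c"]) (auto simp: norm_mult dest: L2_measurable)

lemma L2_cnj: "f \<in> L2 \<Longrightarrow> (\<lambda>t. cnj (f t)) \<in> L2"
  by (rule L2_bound[of f _ 1]) (auto simp: L2_measurable intro!: borel_measurable_continuous_on[OF continuous_on_cnj[OF continuous_on_id]])

lemma sum_norm_square_le: "(cmod (x + y))\<^sup>2 \<le> 2 * (cmod x)\<^sup>2 + 2 * (cmod y)\<^sup>2"
proof -
  have "(cmod (x + y))\<^sup>2 \<le> (cmod x + cmod y)\<^sup>2"
    by (intro power_mono norm_triangle_ineq) simp
  also have "\<dots> \<le> 2 * (cmod x)\<^sup>2 + 2 * (cmod y)\<^sup>2"
    using sum_squares_bound[of "cmod x" "cmod y"] by (simp add: power2_sum)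
  finally show ?thesis .
qed

lemma L2_add:
  assumes "f \<in> L2" "g \<in> L2"
  shows "(\<lambda>t. f t + g t) \<in> L2"
proof -
  have m: "(\<lambda>t. f t + g t) \<in> borel_measurable borel" using assms L2_measurable by auto
  then have [measurable]: "(\<lambda>t. f t + g t) \<in> borel_measurable \<mu>" by (simp add: measurable_eq)
  have "integrable \<mu> (\<lambda>t. (cmod (f t + g t))\<^sup>2)"
  proof (rule Bochner_Integration.integrable_bound)
    show "integrable \<mu> (\<lambda>t. 2 * (cmod (f t))\<^sup>2 + 2 * (cmod (g t))\<^sup>2)"
      using assms L2_integrable by auto
    show "AE t in \<mu>. norm ((cmod (f t + g t))\<^sup>2) \<le> norm (2 * (cmod (f t))\<^sup>2 + 2 * (cmod (g t))\<^sup>2)"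
      using sum_norm_square_le by simp
  qed simp
  with m show ?thesis by (simp add: L2_def)
qed

lemma L2_diff: "f \<in> L2 \<Longrightarrow> g \<in> L2 \<Longrightarrow> (\<lambda>t. f t - g t) \<in> L2"
  using L2_add[of f "\<lambda>t. (-1) * g t"] L2_scale[of g "-1"] by simp

lemma L2_mult_integrable:
  assumes "f \<in> L2" "g \<in> L2"
  shows "integrable \<mu> (\<lambda>t. f t * g t)"
proof (rule Bochner_Integration.integrable_bound)
  have [measurable]: "f \<in> borel_measurable \<mu>" "g \<in> borel_measurable \<mu>"
    using assms L2_measurable by (auto simp: measurable_eq)
  show "(\<lambda>t. f t * g t) \<in> borel_measurable \<mu>" by simp
  show "integrable \<mu> (\<lambda>t. (cmod (f t))\<^sup>2 + (cmod (g t))\<^sup>2)"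
    using assms L2_integrable by auto
  have "cmod (f t) * cmod (g t) \<le> (cmod (f t))\<^sup>2 + (cmod (g t))\<^sup>2" for t
  proof -
    have "0 \<le> cmod (f t) * cmod (g t)" by simp
    then show ?thesis using sum_squares_bound[of "cmod (f t)" "cmod (g t)"] by linarith
  qed
  then show "AE t in \<mu>. norm (f t * g t) \<le> norm ((cmod (f t))\<^sup>2 + (cmod (g t))\<^sup>2)"
    by (simp add: norm_mult)
qed

lemma L2_mult_cnj_integrable: "f \<in> L2 \<Longrightarrow> g \<in> L2 \<Longrightarrow> integrable \<mu> (\<lambda>t. f t * cnj (g t))"
  by (intro L2_mult_integrable L2_cnj)

lemma L2_norm_zero:
  assumes "f \<in> L2" "(\<integral>t. (cmod (f t))\<^sup>2 \<partial>\<mu>) = 0"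
  shows "AE t in \<mu>. f t = 0"
  using assms(2) integral_nonneg_eq_0_iff_AE[OF L2_integrable[OF assms(1)]] by simp

section \<open>The weight 1 / (1 + t^2) and the resolvent functions\<close>

lemma weight_integrable: "integrable \<mu> (\<lambda>t. 1 / (1 + t\<^sup>2))"
  and weight_integral: "(\<integral>t. 1 / (1 + t\<^sup>2) \<partial>\<mu>) = 1"
proof -
  have [measurable]: "(\<lambda>t. 1 / (1 + t\<^sup>2)) \<in> borel_measurable \<mu>" by (simp add: measurable_eq)
  show "integrable \<mu> (\<lambda>t. 1 / (1 + t\<^sup>2))"
    by (rule integrableI_nonneg) (auto simp: weight_one)
  show "(\<integral>t. 1 / (1 + t\<^sup>2) \<partial>\<mu>) = 1"
    by (subst integral_eq_nn_integral) (auto simp: weight_one)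
qed

lemma weight_bound_L2:
  assumes "f \<in> borel_measurable borel" "\<And>t. (cmod (f t))\<^sup>2 \<le> C / (1 + t\<^sup>2)"
  shows "f \<in> L2"
proof -
  have [measurable]: "f \<in> borel_measurable \<mu>" using assms(1) measurable_eq by simp
  have "integrable \<mu> (\<lambda>t. (cmod (f t))\<^sup>2)"
  proof (rule Bochner_Integration.integrable_bound)
    show "integrable \<mu> (\<lambda>t. C * (1 / (1 + t\<^sup>2)))" by (intro integrable_mult_right weight_integrable)
    show "AE t in \<mu>. norm ((cmod (f t))\<^sup>2) \<le> norm (C * (1 / (1 + t\<^sup>2)))"
    proof (rule AE_I2)
      fix t :: real
      have "C / (1 + t\<^sup>2) \<le> norm (C * (1 / (1 + t\<^sup>2)))"
        using abs_ge_self[of "C / (1 + t\<^sup>2)"] by simp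
      then show "norm ((cmod (f t))\<^sup>2) \<le> norm (C * (1 / (1 + t\<^sup>2)))"
        using assms(2)[of t] by simp
    qed
  qed simp
  then show ?thesis using assms(1) by (simp add: L2_def)
qed

lemma resolvent_bound:
  assumes "Im z \<noteq> 0"
  obtains C where "0 < C" "\<And>t :: real. 1 + t\<^sup>2 \<le> C * (cmod (of_real t - z))\<^sup>2"
proof
  let ?x = "Re z" and ?y = "Im z"
  \<comment> \<open>The 2 comes from t^2 \<le> 2 (t - x)^2 + 2 x^2; the fraction absorbs the
    constant 1 + 2 x^2, because y^2 is at most |t - z|^2.\<close>
  let ?C = "2 + (1 + 2 * ?x\<^sup>2) / ?y\<^sup>2"
  show "0 < ?C" by (intro add_pos_nonneg divide_nonneg_nonneg) auto
  fix t :: real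
  have "(t - 2 * ?x)\<^sup>2 \<ge> 0" by simp
  then have "t\<^sup>2 \<le> 2 * (t - ?x)\<^sup>2 + 2 * ?x\<^sup>2" by (simp add: power2_eq_square algebra_simps)
  moreover have "1 + 2 * ?x\<^sup>2 \<le> (1 + 2 * ?x\<^sup>2) / ?y\<^sup>2 * ((t - ?x)\<^sup>2 + ?y\<^sup>2)"
    using assms by (simp add: field_simps)
  moreover have "2 * (t - ?x)\<^sup>2 \<le> 2 * ((t - ?x)\<^sup>2 + ?y\<^sup>2)" by simp
  ultimately have "1 + t\<^sup>2 \<le> ?C * ((t - ?x)\<^sup>2 + ?y\<^sup>2)"
    unfolding distrib_right by linarith
  then show "1 + t\<^sup>2 \<le> ?C * (cmod (of_real t - z))\<^sup>2" by (simp add: cmod_power2)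
qed

lemma real_minus_nonzero: "Im z \<noteq> 0 \<Longrightarrow> complex_of_real t - z \<noteq> 0"
  by (auto simp: complex_eq_iff)

lemma resolvent_L2:
  assumes z: "Im z \<noteq> 0"
  shows "(\<lambda>t. 1 / (of_real t - z)) \<in> L2"
proof -
  obtain C where C: "0 < C" "\<And>t :: real. 1 + t\<^sup>2 \<le> C * (cmod (of_real t - z))\<^sup>2"
    using resolvent_bound[OF z] by blast
  show ?thesis
  proof (rule weight_bound_L2[where C = C])
    fix t :: real
    have "(cmod (of_real t - z))\<^sup>2 > 0" using real_minus_nonzero[OF z] by simp
    moreover have "1 + t\<^sup>2 > 0" by (simp add: add_pos_nonneg)
    ultimately show "(cmod (1 / (of_real t - z)))\<^sup>2 \<le> C / (1 + t\<^sup>2)"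
      using C(2)[of t] by (simp add: norm_divide power_divide field_simps)
  qed simp
qed

lemma L2_resolvent_mult:
  assumes f: "f \<in> L2" and z: "Im z \<noteq> 0"
  shows "(\<lambda>t. f t / (of_real t - z)) \<in> L2"
proof (rule L2_bound[OF f, of _ "1 / \<bar>Im z\<bar>"])
  fix t :: real
  have "\<bar>Im z\<bar> \<le> cmod (of_real t - z)" using abs_Im_le_cmod[of "of_real t - z"] by simp
  then show "cmod (f t / (of_real t - z)) \<le> 1 / \<bar>Im z\<bar> * cmod (f t)"
    using z by (simp add: norm_divide frac_le)
qed (use L2_measurable[OF f] in measurable)

text \<open>The squared norm of a constant c is |c|^2 times the infinite mass of \<mu>.\<close>

lemma not_L2_const:
  assumes "h \<in> L2" "AE t in \<mu>. h t = c"
  shows "c = 0"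
proof (rule ccontr)
  assume c: "c \<noteq> 0"
  have "integrable \<mu> (\<lambda>t. (cmod c)\<^sup>2)"
    using L2_integrable[OF assms(1)] assms L2_measurable measurable_eq
    by (subst integrable_cong_AE[where g = "\<lambda>t. (cmod (h t))\<^sup>2"]) auto
  then have "(\<integral>\<^sup>+t. ennreal (norm ((cmod c)\<^sup>2)) \<partial>\<mu>) < \<infinity>" by (simp add: integrable_iff_bounded)
  then show False using infinite c by (simp add: ennreal_mult_top)
qed

text \<open>Riesz-Fischer, reduced to the integrable case: multiplication by the zero-free square
  integrable function 1 / (t - i) turns a Cauchy sequence in L2 into one in L1, which has an almost
  everywhere convergent subsequence. Fatou's lemma then carries the L2 bound to the limit.\<close>

lemma L2_complete:
  fixes F :: "nat \<Rightarrow> real \<Rightarrow> complex"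
  assumes F: "\<And>n. F n \<in> L2"
    and Cauchy: "\<And>e. 0 < e \<Longrightarrow> \<exists>N. \<forall>m\<ge>N. \<forall>n\<ge>N. (\<integral>t. (cmod (F m t - F n t))\<^sup>2 \<partial>\<mu>) < e"
  obtains f where "f \<in> L2"
    "\<And>e. 0 < e \<Longrightarrow> \<exists>N. \<forall>n\<ge>N. (\<integral>t. (cmod (F n t - f t))\<^sup>2 \<partial>\<mu>) \<le> e"
proof -
  let ?w = "\<lambda>t. 1 / (complex_of_real t - \<i>)"
  have w: "?w \<in> L2" by (rule resolvent_L2) simp
  have wsq: "(cmod (?w t))\<^sup>2 = 1 / (1 + t\<^sup>2)" for t
    by (simp add: norm_divide cmod_power2 power_divide)
  have Fm [measurable]: "F n \<in> borel_measurable borel" for n by (rule L2_measurable[OF F])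
  have Fm' [measurable]: "F n \<in> borel_measurable \<mu>" for n by (simp add: measurable_eq)
  obtain r where r: "strict_mono r" and AE: "AE t in \<mu>. Cauchy (\<lambda>i. F (r i) t * ?w t)"
  proof (rule cauchy_L1_AE_cauchy_subseq)
    show "integrable \<mu> (\<lambda>t. F n t * ?w t)" for n by (rule L2_mult_integrable[OF F w])
    fix e :: real assume e: "0 < e"
    then obtain N where N: "\<And>m n. m \<ge> N \<Longrightarrow> n \<ge> N \<Longrightarrow> (\<integral>t. (cmod (F m t - F n t))\<^sup>2 \<partial>\<mu>) < e\<^sup>2"
      using Cauchy[of "e\<^sup>2"] by auto
    show "\<exists>N. \<forall>i\<ge>N. \<forall>j\<ge>N. (LINT t|\<mu>. norm (F i t * ?w t - F j t * ?w t)) < e"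
    proof (intro exI allI impI)
      fix i j assume ij: "N \<le> i" "N \<le> j"
      have d: "(\<lambda>t. F i t - F j t) \<in> L2" by (rule L2_diff[OF F F])
      \<comment> \<open>The inequality of the means, weighted by e. After integration the first term
        is less than e / 2, since N was chosen for e^2, and the second equals e / 2, since the
        weight has integral one.\<close>
      have le: "norm (F i t * ?w t - F j t * ?w t)
          \<le> (1 / (2 * e)) * (cmod (F i t - F j t))\<^sup>2 + (e / 2) * (1 / (1 + t\<^sup>2))" for t
      proof -
        let ?a = "cmod (F i t - F j t)" and ?b = "cmod (?w t)"
        have "0 \<le> (?a - e * ?b)\<^sup>2 / (2 * e)" using e by simp
        also have "\<dots> = (1 / (2 * e)) * ?a\<^sup>2 + (e / 2) * ?b\<^sup>2 - ?a * ?b"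
          using e by (simp add: power2_diff field_simps) (simp add: power2_eq_square)
        finally show ?thesis
          unfolding wsq by (simp add: norm_mult left_diff_distrib[symmetric] del: times_divide_eq_right)
      qed
      have "(LINT t|\<mu>. norm (F i t * ?w t - F j t * ?w t))
          \<le> (LINT t|\<mu>. (1 / (2 * e)) * (cmod (F i t - F j t))\<^sup>2 + (e / 2) * (1 / (1 + t\<^sup>2)))"
        using L2_mult_integrable[OF F w] L2_integrable[OF d] weight_integrable le
        by (intro integral_mono Bochner_Integration.integrable_add integrable_mult_right
            integrable_norm Bochner_Integration.integrable_diff) auto
      also have "\<dots> = (1 / (2 * e)) * (\<integral>t. (cmod (F i t - F j t))\<^sup>2 \<partial>\<mu>) + e / 2"
        using L2_integrable[OF d] weight_integrable
        by (subst Bochner_Integration.integral_add)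
          (auto simp: weight_integral simp del: times_divide_eq_right)
      also have "\<dots> < (1 / (2 * e)) * e\<^sup>2 + e / 2"
        using N[OF ij] e by (intro add_strict_right_mono mult_strict_left_mono) auto
      also have "\<dots> = e" using e by (simp add: power2_eq_square)
      finally show "(LINT t|\<mu>. norm (F i t * ?w t - F j t * ?w t)) < e" .
    qed
  qed
  define f where "f t = lim (\<lambda>i. F (r i) t)" for t
  have fm [measurable]: "f \<in> borel_measurable borel"
    unfolding f_def by (rule borel_measurable_lim_metric) simp
  then have fm' [measurable]: "f \<in> borel_measurable \<mu>" by (simp add: measurable_eq)
  have lim: "AE t in \<mu>. (\<lambda>i. F (r i) t) \<longlonglongrightarrow> f t"
    using AE
  proof eventually_elim
    case (elim t)
    then have "convergent (\<lambda>i. F (r i) t * ?w t)" by (rule Cauchy_convergent)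
    then obtain l where "(\<lambda>i. F (r i) t * ?w t) \<longlonglongrightarrow> l" by (auto simp: convergent_def)
    then have "(\<lambda>i. F (r i) t * ?w t * (complex_of_real t - \<i>)) \<longlonglongrightarrow> l * (complex_of_real t - \<i>)"
      by (intro tendsto_intros)
    then have "convergent (\<lambda>i. F (r i) t)"
      using real_minus_nonzero[of \<i> t] by (auto simp: convergent_def)
    then show ?case by (simp add: convergent_LIMSEQ_iff f_def)
  qed
  have key: "\<exists>N. \<forall>n\<ge>N. (\<lambda>t. F n t - f t) \<in> L2 \<and> (\<integral>t. (cmod (F n t - f t))\<^sup>2 \<partial>\<mu>) \<le> e" if e: "0 < e" for e
  proof -
    obtain N where N: "\<And>m n. m \<ge> N \<Longrightarrow> n \<ge> N \<Longrightarrow> (\<integral>t. (cmod (F m t - F n t))\<^sup>2 \<partial>\<mu>) < e"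
      using Cauchy[OF e] by auto
    show ?thesis
    proof (intro exI allI impI)
      fix n assume n: "N \<le> n"
      have "(\<integral>\<^sup>+t. ennreal ((cmod (F n t - f t))\<^sup>2) \<partial>\<mu>)
          = (\<integral>\<^sup>+t. liminf (\<lambda>i. ennreal ((cmod (F n t - F (r i) t))\<^sup>2)) \<partial>\<mu>)"
      proof (rule nn_integral_cong_AE)
        show "AE t in \<mu>. ennreal ((cmod (F n t - f t))\<^sup>2)
            = liminf (\<lambda>i. ennreal ((cmod (F n t - F (r i) t))\<^sup>2))"
          using lim
        proof eventually_elim
          case (elim t)
          then have "(\<lambda>i. ennreal ((cmod (F n t - F (r i) t))\<^sup>2)) \<longlonglongrightarrow> ennreal ((cmod (F n t - f t))\<^sup>2)"
            by (intro tendsto_ennrealI tendsto_intros)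
          then show ?case by (rule lim_imp_Liminf[OF trivial_limit_sequentially, symmetric])
        qed
      qed
      also have "\<dots> \<le> liminf (\<lambda>i. \<integral>\<^sup>+t. ennreal ((cmod (F n t - F (r i) t))\<^sup>2) \<partial>\<mu>)"
        by (rule nn_integral_liminf) simp
      also have "\<dots> \<le> liminf (\<lambda>i. ennreal e)"
      proof (rule Liminf_mono)
        have "(\<integral>\<^sup>+t. ennreal ((cmod (F n t - F (r i) t))\<^sup>2) \<partial>\<mu>) \<le> ennreal e" if i: "N \<le> i" for i
        proof -
          have "N \<le> r i" using i seq_suble[OF r, of i] by linarith
          then show ?thesis
            using N[OF n, of "r i"] L2_integrable[OF L2_diff[OF F F]]
            by (subst nn_integral_eq_integral) (auto intro!: ennreal_leI)
        qed
        then show "\<forall>\<^sub>F i in sequentially. (\<integral>\<^sup>+t. ennreal ((cmod (F n t - F (r i) t))\<^sup>2) \<partial>\<mu>) \<le> ennreal e"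
          unfolding eventually_sequentially by blast
      qed
      also have "\<dots> = ennreal e" by (simp add: Liminf_const)
      finally have le: "(\<integral>\<^sup>+t. ennreal ((cmod (F n t - f t))\<^sup>2) \<partial>\<mu>) \<le> ennreal e" .
      have int: "integrable \<mu> (\<lambda>t. (cmod (F n t - f t))\<^sup>2)"
        using le by (intro integrableI_nonneg) (auto simp: le_less_trans[OF le])
      have "(\<integral>t. (cmod (F n t - f t))\<^sup>2 \<partial>\<mu>) \<le> e"
        using le int e by (subst (asm) nn_integral_eq_integral) auto
      then show "(\<lambda>t. F n t - f t) \<in> L2 \<and> (\<integral>t. (cmod (F n t - f t))\<^sup>2 \<partial>\<mu>) \<le> e"
        using int by (simp add: L2_def)
    qed
  qed
  show thesis
  proof (rule that)
    obtain n where "(\<lambda>t. F n t - f t) \<in> L2" using key[of 1] by auto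
    then have "(\<lambda>t. F n t - (F n t - f t)) \<in> L2" by (rule L2_diff[OF F])
    then show "f \<in> L2" by simp
    show "\<exists>N. \<forall>n\<ge>N. (\<integral>t. (cmod (F n t - f t))\<^sup>2 \<partial>\<mu>) \<le> e" if "0 < e" for e
      using key[OF that] by blast
  qed
qed

section \<open>Measure of bounded intervals\<close>

lemma interval_integrable: "integrable \<mu> (indicator {a..b} :: real \<Rightarrow> real)"
proof (rule Bochner_Integration.integrable_bound)
  let ?C = "1 + a\<^sup>2 + b\<^sup>2"
  show "integrable \<mu> (\<lambda>t. ?C * (1 / (1 + t\<^sup>2)))" by (intro integrable_mult_right weight_integrable)
  have "norm (indicator {a..b} t :: real) \<le> norm (?C * (1 / (1 + t\<^sup>2)))" for t
  proof (cases "t \<in> {a..b}")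
    case True
    have "t\<^sup>2 \<le> a\<^sup>2 + b\<^sup>2"
    proof (cases "t \<ge> 0")
      case t: True
      then have "t\<^sup>2 \<le> b\<^sup>2" using True by (intro power_mono) auto
      then show ?thesis using zero_le_power2[of a] by linarith
    next
      case t: False
      then have "(- t)\<^sup>2 \<le> (- a)\<^sup>2" using True by (intro power_mono) auto
      then have "t\<^sup>2 \<le> a\<^sup>2" by simp
      then show ?thesis using zero_le_power2[of b] by linarith
    qed
    then have "1 + t\<^sup>2 \<le> ?C" by simp
    moreover have "0 < 1 + t\<^sup>2" by (simp add: add_pos_nonneg)
    ultimately have "1 \<le> ?C * (1 / (1 + t\<^sup>2))" by (simp add: field_simps)
    then show ?thesis using True abs_ge_self[of "?C * (1 / (1 + t\<^sup>2))"] by simp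
  qed simp
  then show "AE t in \<mu>. norm (indicator {a..b} t :: real) \<le> norm (?C * (1 / (1 + t\<^sup>2)))" by simp
qed (simp add: measurable_eq)

lemma interval_finite: "emeasure \<mu> {a..b} < \<infinity>"
  using interval_integrable[of a b] by (simp add: integrable_indicator_iff sets_eq)

lemma intervals_cover: "(\<Union>n. {- real n..real n}) = UNIV"
proof -
  have "x \<in> (\<Union>n. {- real n..real n})" for x
  proof -
    obtain n :: nat where "\<bar>x\<bar> \<le> real n" using real_arch_simple by blast
    then have "x \<in> {- real n..real n}" unfolding atLeastAtMost_iff by linarith
    then show ?thesis by blast
  qed
  then show ?thesis by blast
qed

text \<open>Bounded intervals have finite measure but exhaust a space of infinite measure. Division
  by such a large measure makes the corrections in \<open>mean_zero_dense\<close> small.\<close>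

lemma interval_measure_unbounded: "\<exists>n::nat. K < measure \<mu> {- real n..real n}"
proof (rule ccontr)
  assume "\<not> (\<exists>n. K < measure \<mu> {- real n..real n})"
  then have le: "measure \<mu> {- real n..real n} \<le> K" for n by (simp add: not_less)
  have "(SUP n. emeasure \<mu> {- real n..real n}) = emeasure \<mu> (\<Union>n. {- real n..real n})"
    by (rule SUP_emeasure_incseq) (auto simp: sets_eq incseq_def)
  also note intervals_cover
  finally have "(SUP n. emeasure \<mu> {- real n..real n}) = \<infinity>" using infinite by simp
  moreover have "(SUP n. emeasure \<mu> {- real n..real n}) \<le> ennreal K"
  proof (rule SUP_least)
    fix n
    have "emeasure \<mu> {- real n..real n} = ennreal (measure \<mu> {- real n..real n})"
      using interval_finite[of "- real n" "real n"] by (intro emeasure_eq_ennreal_measure) simp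
    then show "emeasure \<mu> {- real n..real n} \<le> ennreal K"
      using le[of n] by (simp add: ennreal_leI)
  qed
  ultimately have "\<infinity> \<le> ennreal K" by metis
  then show False by (simp add: top_unique)
qed

sublocale sigma_finite_measure \<mu>
proof
  show "\<exists>A. countable A \<and> A \<subseteq> sets \<mu> \<and> \<Union> A = space \<mu> \<and> (\<forall>a\<in>A. emeasure \<mu> a \<noteq> \<infinity>)"
  proof (intro exI conjI)
    show "\<Union> (range (\<lambda>n::nat. {- real n..real n})) = space \<mu>"
      by (simp add: intervals_cover)
    show "\<forall>a\<in>range (\<lambda>n::nat. {- real n..real n}). emeasure \<mu> a \<noteq> \<infinity>"
      using interval_finite by (auto simp: less_top)
  qed (auto simp: sets_eq)
qed

end

section \<open>Functions that are constant in the weak sense\<close>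

context herglotz_measure
begin

text \<open>f is the product of t f - i f and 1 / (t - i), both square integrable.\<close>

lemma decay_integrable:
  assumes "f \<in> L2" "(\<lambda>t. of_real t * f t) \<in> L2"
  shows "integrable \<mu> f"
proof -
  have "(\<lambda>t. of_real t * f t - \<i> * f t) \<in> L2" by (intro L2_diff L2_scale assms)
  then have "integrable \<mu> (\<lambda>t. (of_real t * f t - \<i> * f t) * (1 / (of_real t - \<i>)))"
    by (intro L2_mult_integrable resolvent_L2) simp_all
  moreover have "(of_real t * f t - \<i> * f t) * (1 / (of_real t - \<i>)) = f t" for t
    using real_minus_nonzero[of \<i> t] by (simp add: left_diff_distrib[symmetric])
  ultimately show ?thesis by simp
qed

text \<open>The reference function: \<open>wt\<close> has integral one and serves to correct
  integrals, while t times \<open>wt\<close> is the term subtracted in the integral representation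
  of V.\<close>

definition wt :: "real \<Rightarrow> complex" where
  "wt t = of_real (1 / (1 + t\<^sup>2))"

lemma wt_measurable [measurable]: "wt \<in> borel_measurable borel"
  unfolding wt_def by measurable

lemma wt_bounds: "cmod (wt t) \<le> 1" "cmod (of_real t * wt t) \<le> 1" "cmod (of_real t * (of_real t * wt t)) \<le> 1"
proof -
  have p: "0 < 1 + t\<^sup>2" by (simp add: add_pos_nonneg)
  have n: "cmod (wt t) = 1 / (1 + t\<^sup>2)" using p by (simp add: wt_def norm_divide flip: of_real_power of_real_add)
  have "0 \<le> (\<bar>t\<bar> - 1)\<^sup>2 + \<bar>t\<bar>" by simp
  then have t: "\<bar>t\<bar> \<le> 1 + t\<^sup>2" by (simp add: power2_eq_square algebra_simps)
  show "cmod (wt t) \<le> 1" using p by (simp add: n)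
  show "cmod (of_real t * wt t) \<le> 1" using p t by (simp add: norm_mult n)
  show "cmod (of_real t * (of_real t * wt t)) \<le> 1"
    using p by (simp add: norm_mult n) (simp add: power2_eq_square)
qed

lemma wt_L2: "wt \<in> L2" "(\<lambda>t. of_real t * wt t) \<in> L2"
proof -
  have p: "0 < 1 + t\<^sup>2" for t :: real by (simp add: add_pos_nonneg)
  have n: "cmod (wt t) = 1 / (1 + t\<^sup>2)" for t
    using p[of t] by (simp add: wt_def norm_divide flip: of_real_power of_real_add)
  show "wt \<in> L2"
  proof (rule weight_bound_L2[where C = 1])
    show "(cmod (wt t))\<^sup>2 \<le> 1 / (1 + t\<^sup>2)" for t
      using mult_left_mono[OF wt_bounds(1)[of t], of "cmod (wt t)"] by (simp add: power2_eq_square n)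
  qed simp
  show "(\<lambda>t. of_real t * wt t) \<in> L2"
  proof (rule weight_bound_L2[where C = 1])
    show "(cmod (of_real t * wt t))\<^sup>2 \<le> 1 / (1 + t\<^sup>2)" for t
      using mult_right_mono[OF wt_bounds(3)[of t], of "cmod (wt t)"]
      by (simp add: power2_eq_square norm_mult n mult_ac)
  qed measurable
qed

lemma wt_integral: "integrable \<mu> wt" "(\<integral>t. wt t \<partial>\<mu>) = 1"
  unfolding wt_def using weight_integrable weight_integral
  by (auto simp del: of_real_divide simp: integral_complex_of_real intro!: integrable_of_real)

lemma mult_bounded_L2:
  assumes "f \<in> L2" "b \<in> borel_measurable borel" "\<And>t. cmod (b t) \<le> C"
  shows "(\<lambda>t. b t * f t) \<in> L2"
proof (rule L2_bound[OF assms(1), of _ C])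
  show "(\<lambda>t. b t * f t) \<in> borel_measurable borel" using assms L2_measurable by auto
  show "cmod (b t * f t) \<le> C * cmod (f t)" for t
    using assms(3) by (simp add: norm_mult mult_right_mono)
qed

text \<open>The du Bois-Reymond argument. Subtracting a multiple of \<open>wt\<close> gives any
  decaying f integral zero, so integration against \<psi> is c times the integral of f, with one
  constant c. Then \<psi> - c annihilates all decaying functions, among them a weighted conjugate of
  itself.\<close>

lemma weakly_constant:
  assumes g: "g \<in> L2" and k: "k \<in> L2"
    and eq: "\<And>f. f \<in> L2 \<Longrightarrow> (\<lambda>t. of_real t * f t) \<in> L2 \<Longrightarrow> (\<integral>t. f t \<partial>\<mu>) = 0 \<Longrightarrow>
      (\<integral>t. of_real t * f t * cnj (g t) \<partial>\<mu>) = (\<integral>t. f t * cnj (k t) \<partial>\<mu>)"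
  obtains c where "AE t in \<mu>. of_real t * g t - k t = c"
proof -
  define \<psi> where "\<psi> t = cnj (of_real t * g t - k t)" for t
  have split: "f t * \<psi> t = of_real t * f t * cnj (g t) - f t * cnj (k t)" for f and t :: real
    by (simp add: \<psi>_def algebra_simps)
  have int: "integrable \<mu> (\<lambda>t. f t * \<psi> t)" if "f \<in> L2" "(\<lambda>t. of_real t * f t) \<in> L2" for f
    unfolding split using that g k by (intro Bochner_Integration.integrable_diff L2_mult_cnj_integrable)
  have zero: "(\<integral>t. f t * \<psi> t \<partial>\<mu>) = 0"
    if f: "f \<in> L2" "(\<lambda>t. of_real t * f t) \<in> L2" "(\<integral>t. f t \<partial>\<mu>) = 0" for f
    unfolding split using eq[OF f] f g k
    by (subst Bochner_Integration.integral_diff) (auto intro!: L2_mult_cnj_integrable)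
  define c where "c = (\<integral>t. wt t * \<psi> t \<partial>\<mu>)"
  have repr: "(\<integral>t. f t * (\<psi> t - c) \<partial>\<mu>) = 0" and repr_int: "integrable \<mu> (\<lambda>t. f t * (\<psi> t - c))"
    if f: "f \<in> L2" "(\<lambda>t. of_real t * f t) \<in> L2" for f
  proof -
    define a where "a = (\<integral>t. f t \<partial>\<mu>)"
    have fi: "integrable \<mu> f" by (rule decay_integrable[OF f])
    have "(\<lambda>t. f t - a * wt t) \<in> L2" by (intro L2_diff L2_scale f wt_L2)
    moreover have "(\<lambda>t. of_real t * f t - a * (of_real t * wt t)) \<in> L2"
      by (intro L2_diff L2_scale f wt_L2)
    then have "(\<lambda>t. of_real t * (f t - a * wt t)) \<in> L2" by (simp add: algebra_simps)
    moreover have "(\<integral>t. f t - a * wt t \<partial>\<mu>) = 0"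
      using fi wt_integral by (simp add: a_def)
    ultimately have "(\<integral>t. (f t - a * wt t) * \<psi> t \<partial>\<mu>) = 0" by (rule zero)
    moreover have "(\<integral>t. (f t - a * wt t) * \<psi> t \<partial>\<mu>) = (\<integral>t. f t * \<psi> t - a * (wt t * \<psi> t) \<partial>\<mu>)"
      by (simp add: algebra_simps)
    ultimately have "(\<integral>t. f t * \<psi> t \<partial>\<mu>) = a * c"
      using int[OF f] int[OF wt_L2] by (simp add: c_def)
    then show "(\<integral>t. f t * (\<psi> t - c) \<partial>\<mu>) = 0" "integrable \<mu> (\<lambda>t. f t * (\<psi> t - c))"
      using int[OF f] fi by (simp_all add: right_diff_distrib a_def)
  qed
  \<comment> \<open>\<psi> - c is made of t g, k and a constant, up to conjugation; the factor
    \<open>wt\<close> is strong enough that both \<open>?f\<close> and t times \<open>?f\<close> are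
    square integrable.\<close>
  let ?f = "\<lambda>t. wt t * cnj (\<psi> t - c)"
  have f1: "(\<lambda>t. (of_real t * wt t) * g t - wt t * k t - cnj c * wt t) \<in> L2"
    using wt_bounds g k by (intro L2_diff L2_scale wt_L2 mult_bounded_L2[where C = 1]) auto
  have f2: "(\<lambda>t. (of_real t * (of_real t * wt t)) * g t - (of_real t * wt t) * k t
      - cnj c * (of_real t * wt t)) \<in> L2"
    using wt_bounds g k by (intro L2_diff L2_scale wt_L2 mult_bounded_L2[where C = 1]) auto
  have f: "?f \<in> L2" "(\<lambda>t. of_real t * ?f t) \<in> L2"
    using f1 f2 by (simp_all add: \<psi>_def algebra_simps)
  have sq: "?f t * (\<psi> t - c) = of_real (1 / (1 + t\<^sup>2) * (cmod (\<psi> t - c))\<^sup>2)" for t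
    unfolding wt_def of_real_mult complex_norm_square by (simp only: mult_ac)
  have "integrable \<mu> (\<lambda>t. Re (?f t * (\<psi> t - c)))" using repr_int[OF f] by (rule integrable_Re)
  then have i: "integrable \<mu> (\<lambda>t. 1 / (1 + t\<^sup>2) * (cmod (\<psi> t - c))\<^sup>2)" unfolding sq Re_complex_of_real .
  have "(\<integral>t. Re (?f t * (\<psi> t - c)) \<partial>\<mu>) = 0" unfolding integral_Re[OF repr_int[OF f]] repr[OF f] by simp
  then have "(\<integral>t. 1 / (1 + t\<^sup>2) * (cmod (\<psi> t - c))\<^sup>2 \<partial>\<mu>) = 0" unfolding sq Re_complex_of_real .
  then have "AE t in \<mu>. 1 / (1 + t\<^sup>2) * (cmod (\<psi> t - c))\<^sup>2 = 0"
    by (subst (asm) integral_nonneg_eq_0_iff_AE[OF i]) auto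
  then have "AE t in \<mu>. of_real t * g t - k t = cnj c"
  proof eventually_elim
    case (elim t)
    have "1 / (1 + t\<^sup>2) \<noteq> 0" by (simp add: add_nonneg_eq_0_iff)
    with elim have "\<psi> t = c" by auto
    then show ?case by (metis \<psi>_def complex_cnj_cnj)
  qed
  then show thesis by (rule that)
qed

section \<open>Density of the functions of integral zero\<close>

lemma cutoff_L2: "f \<in> L2 \<Longrightarrow> (\<lambda>t. indicator {a..b} t * f t) \<in> L2"
  by (rule mult_bounded_L2[where C = 1]) (auto simp: indicator_def)

lemma cutoff_decay:
  assumes "f \<in> L2"
  shows "(\<lambda>t. of_real t * (indicator {- r..r} t * f t)) \<in> L2"
proof -
  have "(\<lambda>t. (of_real t * indicator {- r..r} t) * f t) \<in> L2"
    by (rule mult_bounded_L2[OF assms, where C = "\<bar>r\<bar>"]) (auto simp: indicator_def norm_mult)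
  then show ?thesis by (simp add: mult.assoc)
qed

text \<open>Truncating f gives a decaying function with some integral a. Subtracting a times a
  normalized indicator of a long interval removes the integral at the cost of a squared norm |a|^2 /
  L, where the measure L of the interval can be made large.\<close>

lemma mean_zero_dense:
  assumes f: "f \<in> L2" and e: "0 < e"
  obtains g where "g \<in> L2" "(\<lambda>t. of_real t * g t) \<in> L2" "(\<integral>t. g t \<partial>\<mu>) = 0"
    "(\<integral>t. (cmod (f t - g t))\<^sup>2 \<partial>\<mu>) < e"
proof -
  have fm [measurable]: "f \<in> borel_measurable \<mu>" using L2_measurable[OF f] by (simp add: measurable_eq)
  define F where "F n t = indicator {- real n..real n} t * f t" for n and t :: real
  have "(\<lambda>n. \<integral>t. (cmod (f t - F n t))\<^sup>2 \<partial>\<mu>) \<longlonglongrightarrow> (\<integral>t. 0 \<partial>\<mu>)"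
  proof (rule integral_dominated_convergence)
    show "integrable \<mu> (\<lambda>t. (cmod (f t))\<^sup>2)" by (rule L2_integrable[OF f])
    show "AE t in \<mu>. (\<lambda>n. (cmod (f t - F n t))\<^sup>2) \<longlonglongrightarrow> 0"
    proof (rule AE_I2, rule tendsto_eventually)
      fix t
      obtain N :: nat where N: "\<bar>t\<bar> \<le> real N" using real_arch_simple by blast
      show "\<forall>\<^sub>F n in sequentially. (cmod (f t - F n t))\<^sup>2 = 0"
        unfolding eventually_sequentially F_def using N by (intro exI[of _ N]) (auto simp: indicator_def)
    qed
    show "AE t in \<mu>. norm ((cmod (f t - F n t))\<^sup>2) \<le> (cmod (f t))\<^sup>2" for n
      by (auto simp: F_def indicator_def)
    show "(\<lambda>t. (cmod (f t - F n t))\<^sup>2) \<in> borel_measurable \<mu>" for n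
      unfolding F_def by measurable
  qed simp
  then have "\<forall>\<^sub>F n in sequentially. (\<integral>t. (cmod (f t - F n t))\<^sup>2 \<partial>\<mu>) < e / 4"
    using e by (intro order_tendstoD) auto
  then obtain n where n: "(\<integral>t. (cmod (f t - F n t))\<^sup>2 \<partial>\<mu>) < e / 4"
    by (meson eventually_sequentially order_refl)
  have Fn: "F n \<in> L2" "(\<lambda>t. of_real t * F n t) \<in> L2"
    unfolding F_def by (rule cutoff_L2[OF f] cutoff_decay[OF f])+
  define a where "a = (\<integral>t. F n t \<partial>\<mu>)"
  \<comment> \<open>The bound 1 keeps L positive. The other makes |a|^2 / L < e / 4, so that the two
    errors, each doubled by squaring a sum, add up to less than e.\<close>
  obtain m :: nat where m: "max 1 (4 * (cmod a)\<^sup>2 / e) < measure \<mu> {- real m..real m}"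
    using interval_measure_unbounded by blast
  define r where "r = real m"
  define L where "L = measure \<mu> {- r..r}"
  have L: "1 < L" "4 * (cmod a)\<^sup>2 / e < L" using m by (simp_all add: L_def r_def)
  define E where "E t = indicator {- r..r} t * (1 / complex_of_real L)" for t :: real
  have I_L2: "(\<lambda>t. indicator {- r..r} t :: complex) \<in> L2"
  proof -
    have "(\<lambda>t. (cmod (indicator {- r..r} t))\<^sup>2) = (indicator {- r..r} :: real \<Rightarrow> real)"
      by (auto simp: indicator_def fun_eq_iff)
    then show ?thesis using interval_integrable[of "- r" r] by (auto simp: L2_def)
  qed
  have E: "E \<in> L2" "(\<lambda>t. of_real t * E t) \<in> L2"
  proof -
    have "(\<lambda>t. 1 / of_real L * indicator {- r..r} t) \<in> L2" by (rule L2_scale[OF I_L2])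
    moreover have "(\<lambda>t. 1 / of_real L * (of_real t * (indicator {- r..r} t * indicator {- r..r} t))) \<in> L2"
      by (rule L2_scale[OF cutoff_decay[OF I_L2]])
    moreover have "E = (\<lambda>t. 1 / of_real L * indicator {- r..r} t)"
      "(\<lambda>t. of_real t * E t) = (\<lambda>t. 1 / of_real L * (of_real t * (indicator {- r..r} t * indicator {- r..r} t)))"
      by (auto simp: E_def indicator_def fun_eq_iff)
    ultimately show "E \<in> L2" "(\<lambda>t. of_real t * E t) \<in> L2" by metis+
  qed
  have E_sq: "(cmod (a * E t))\<^sup>2 = (cmod a)\<^sup>2 / L\<^sup>2 * indicator {- r..r} t" for t
    by (simp add: E_def indicator_def norm_mult norm_divide power_divide power_mult_distrib)
  have ind: "(\<integral>t. indicator {- r..r} t \<partial>\<mu>) = L"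
    by (simp add: L_def)
  have E_int: "(\<integral>t. E t \<partial>\<mu>) = 1"
  proof -
    have "E = (\<lambda>t. complex_of_real (1 / L * indicator {- r..r} t))"
      by (auto simp: E_def indicator_def fun_eq_iff)
    then have "(\<integral>t. E t \<partial>\<mu>) = of_real (1 / L * (\<integral>t. indicator {- r..r} t \<partial>\<mu>))"
      by (simp only: integral_complex_of_real integral_mult_right_zero)
    then show ?thesis using L(1) by (simp add: L_def)
  qed
  show thesis
  proof (rule that)
    show "(\<lambda>t. F n t - a * E t) \<in> L2" by (intro L2_diff L2_scale Fn E)
    have "(\<lambda>t. of_real t * F n t - a * (of_real t * E t)) \<in> L2" by (intro L2_diff L2_scale Fn E)
    then show "(\<lambda>t. of_real t * (F n t - a * E t)) \<in> L2" by (simp add: algebra_simps)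
    show "(\<integral>t. F n t - a * E t \<partial>\<mu>) = 0"
      using decay_integrable[OF Fn] decay_integrable[OF E] by (simp add: E_int a_def)
    have "(\<integral>t. (cmod (f t - (F n t - a * E t)))\<^sup>2 \<partial>\<mu>)
        \<le> (\<integral>t. 2 * (cmod (f t - F n t))\<^sup>2 + 2 * (cmod (a * E t))\<^sup>2 \<partial>\<mu>)"
    proof (rule integral_mono)
      show "integrable \<mu> (\<lambda>t. (cmod (f t - (F n t - a * E t)))\<^sup>2)"
        by (intro L2_integrable L2_diff L2_scale f Fn E)
      show "integrable \<mu> (\<lambda>t. 2 * (cmod (f t - F n t))\<^sup>2 + 2 * (cmod (a * E t))\<^sup>2)"
        by (intro Bochner_Integration.integrable_add integrable_mult_right L2_integrable L2_diff L2_scale f Fn E)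
      show "(cmod (f t - (F n t - a * E t)))\<^sup>2 \<le> 2 * (cmod (f t - F n t))\<^sup>2 + 2 * (cmod (a * E t))\<^sup>2" for t
        using sum_norm_square_le[of "f t - F n t" "a * E t"] by (simp add: algebra_simps)
    qed
    also have "\<dots> = 2 * (\<integral>t. (cmod (f t - F n t))\<^sup>2 \<partial>\<mu>) + 2 * (\<integral>t. (cmod (a * E t))\<^sup>2 \<partial>\<mu>)"
      using L2_integrable[OF L2_diff[OF f Fn(1)]] L2_integrable[OF L2_scale[OF E(1), of a]]
      by (subst Bochner_Integration.integral_add) auto
    also have "(\<integral>t. (cmod (a * E t))\<^sup>2 \<partial>\<mu>) = (cmod a)\<^sup>2 / L\<^sup>2 * L"
      unfolding E_sq using ind by (simp del: integral_indicator)
    also have "\<dots> = (cmod a)\<^sup>2 / L" using L(1) by (simp add: power2_eq_square)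
    also have "2 * (\<integral>t. (cmod (f t - F n t))\<^sup>2 \<partial>\<mu>) + 2 * ((cmod a)\<^sup>2 / L) < 2 * (e / 4) + 2 * (e / 4)"
    proof (rule add_strict_mono)
      have "(cmod a)\<^sup>2 / L < e / 4" using L e by (simp add: field_simps)
      then show "2 * ((cmod a)\<^sup>2 / L) < 2 * (e / 4)" by (rule mult_strict_left_mono) simp
    qed (use n in simp)
    finally show "(\<integral>t. (cmod (f t - (F n t - a * E t)))\<^sup>2 \<partial>\<mu>) < e" by simp
  qed
qed

end

section \<open>Totality of the resolvent functions\<close>

context herglotz_measure
begin

text \<open>Partial fractions: from \<open>1 / (y - s)\<close> and \<open>1 / (y + s)\<close> to \<open>1 / (y\<^sup>2 - s\<^sup>2)\<close>. Iterating squares,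
  \<open>1 / (y ^ 2 ^ k - w)\<close> becomes a combination of resolvent functions; with \<open>w = -n\<close> and suitable
  \<open>k\<close> these approximate the indicator function of an interval.\<close>

lemma partial_fraction_step:
  assumes s: "Im s \<noteq> 0"
    and P: "has_bochner_integral \<mu> (\<lambda>t. m t / (of_real (y t) - s)) 0"
      "has_bochner_integral \<mu> (\<lambda>t. m t / (of_real (y t) - - s)) 0"
  shows "has_bochner_integral \<mu> (\<lambda>t. m t / (of_real ((y t)\<^sup>2) - s\<^sup>2)) 0"
proof -
  have "has_bochner_integral \<mu> (\<lambda>t. 1 / (2 * s) * (m t / (of_real (y t) - s) - m t / (of_real (y t) - - s)))
      (1 / (2 * s) * (0 - 0))"
    by (intro has_bochner_integral_mult_right has_bochner_integral_diff P)
  moreover have "1 / (2 * s) * (m t / (of_real (y t) - s) - m t / (of_real (y t) - - s))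
      = m t / (of_real ((y t)\<^sup>2) - s\<^sup>2)" for t
  proof -
    have "complex_of_real (y t) - s \<noteq> 0" "complex_of_real (y t) - - s \<noteq> 0" "s \<noteq> 0"
      using real_minus_nonzero[of s "y t"] real_minus_nonzero[of "- s" "y t"] s by auto
    moreover have "complex_of_real ((y t)\<^sup>2) - s\<^sup>2 = (of_real (y t) - s) * (of_real (y t) - - s)"
      by (simp add: power2_eq_square algebra_simps)
    ultimately show ?thesis by (simp add: divide_simps) (simp add: algebra_simps)
  qed
  ultimately show ?thesis by simp
qed

text \<open>The square roots of a non-real w are non-real, so both fall under the induction
  hypothesis; the start is an affine change of variable.\<close>

lemma iterated_partial_fractions:
  assumes m: "\<And>z. Im z \<noteq> 0 \<Longrightarrow> has_bochner_integral \<mu> (\<lambda>t. m t / (of_real t - z)) 0"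
    and b: "b > 0" and w: "Im w \<noteq> 0"
  shows "has_bochner_integral \<mu> (\<lambda>t. m t / (of_real (((t - a) / b) ^ 2 ^ k) - w)) 0"
  using w
proof (induction k arbitrary: w)
  case 0
  have "has_bochner_integral \<mu> (\<lambda>t. of_real b * (m t / (of_real t - (of_real a + of_real b * w)))) (of_real b * 0)"
    using 0 b by (intro has_bochner_integral_mult_right m) simp
  moreover have "of_real b * (m t / (of_real t - (of_real a + of_real b * w)))
      = m t / (of_real (((t - a) / b) ^ 2 ^ 0) - w)" for t
  proof -
    have "complex_of_real (((t - a) / b) ^ 2 ^ 0) - w = (of_real t - (of_real a + of_real b * w)) / of_real b"
      using b by (simp add: field_simps)
    then show ?thesis using b by simp
  qed
  ultimately show ?case by simp
next
  case (Suc k)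
  define s where "s = csqrt w"
  have s2: "s\<^sup>2 = w" by (simp add: s_def)
  have "Im s \<noteq> 0" using Suc.prems unfolding s2[symmetric] by (auto simp: power2_eq_square)
  then have "has_bochner_integral \<mu> (\<lambda>t. m t / (of_real ((((t - a) / b) ^ 2 ^ k)\<^sup>2) - s\<^sup>2)) 0"
    by (intro partial_fraction_step Suc.IH) auto
  then show ?case by (simp add: s2 power_mult[symmetric] mult.commute)
qed

text \<open>The value -c is real and not covered by the iteration. One last step from its non-real
  square roots, i sqrt c and - i sqrt c, reaches it; this accounts for the exponent
  \<open>Suc k\<close>.\<close>

lemma interval_kernel:
  assumes m: "\<And>z. Im z \<noteq> 0 \<Longrightarrow> has_bochner_integral \<mu> (\<lambda>t. m t / (of_real t - z)) 0"
    and b: "b > 0" and c: "c > 0"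
  shows "has_bochner_integral \<mu> (\<lambda>t. m t * of_real (c / (c + ((t - a) / b) ^ 2 ^ Suc k))) 0"
proof -
  define s where "s = \<i> * complex_of_real (sqrt c)"
  have s: "Im s \<noteq> 0" "s\<^sup>2 = - of_real c"
    using c by (simp_all add: s_def power_mult_distrib flip: of_real_power)
  have "has_bochner_integral \<mu> (\<lambda>t. m t / (of_real ((((t - a) / b) ^ 2 ^ k)\<^sup>2) - s\<^sup>2)) 0"
    using s by (intro partial_fraction_step iterated_partial_fractions m b) auto
  then have "has_bochner_integral \<mu> (\<lambda>t. of_real c * (m t / (of_real ((((t - a) / b) ^ 2 ^ k)\<^sup>2) - s\<^sup>2))) (of_real c * 0)"
    by (rule has_bochner_integral_mult_right)
  moreover have "of_real c * (m t / (of_real ((((t - a) / b) ^ 2 ^ k)\<^sup>2) - s\<^sup>2))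
      = m t * of_real (c / (c + ((t - a) / b) ^ 2 ^ Suc k))" for t
    by (simp add: s(2) power_mult[symmetric] mult.commute add.commute)
  ultimately show ?thesis by simp
qed

text \<open>A majorant independent of n. For |y| > 1, Bernoulli's inequality bounds the power of y^2
  with exponent n + 1 below by 1 + (n + 1) (y^2 - 1), and 2^n \<ge> n + 1 compares the
  exponents.\<close>

lemma kernel_bound:
  fixes y :: real
  shows "real (Suc n) / (real (Suc n) + y ^ 2 ^ Suc n) \<le> 2 * (1 / (1 + y\<^sup>2))"
proof -
  let ?c = "real (Suc n)" and ?X = "y ^ 2 ^ Suc n"
  have X: "?X = (y\<^sup>2) ^ 2 ^ n" by (simp add: power_mult)
  have X0: "0 \<le> ?X" unfolding X by simp
  have "?c * (1 + y\<^sup>2) \<le> 2 * (?c + ?X)"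
  proof (cases "y\<^sup>2 \<le> 1")
    case True
    then have "?c * (1 + y\<^sup>2) \<le> ?c * 2" by (intro mult_left_mono) auto
    also have "\<dots> \<le> 2 * (?c + ?X)" using X0 by simp
    finally show ?thesis .
  next
    case False
    have "1 + ?c * (y\<^sup>2 - 1) \<le> (1 + (y\<^sup>2 - 1)) ^ Suc n"
      using False by (intro Bernoulli_inequality) simp
    also have "\<dots> \<le> ?X"
      unfolding X using False Suc_leI[OF less_exp[of n]] power_increasing[of "Suc n" "2 ^ n" "y\<^sup>2"]
      by (simp del: power_Suc)
    finally have b: "1 + ?c * (y\<^sup>2 - 1) \<le> ?X" .
    have "1 + u \<le> X \<Longrightarrow> 0 \<le> X \<Longrightarrow> 2 * c + u \<le> 2 * (c + X)" for u X c :: real by simp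
    from this[OF b X0] have "2 * ?c + ?c * (y\<^sup>2 - 1) \<le> 2 * (?c + ?X)" .
    then show ?thesis by (simp add: algebra_simps)
  qed
  moreover have "0 < 1 + y\<^sup>2" "0 < ?c + ?X" using X0 by (simp_all add: add_pos_nonneg)
  ultimately show ?thesis by (simp add: divide_simps mult.commute)
qed

text \<open>The constant n + 1 grows so that the limit at |y| = 1 is 1 and not 1/2, which makes the
  interval closed. For |y| > 1 the power of y, with its doubly exponential growth, still
  wins.\<close>

lemma kernel_tendsto:
  fixes y :: real
  shows "(\<lambda>n. real (Suc n) / (real (Suc n) + y ^ 2 ^ Suc n)) \<longlonglongrightarrow> (if \<bar>y\<bar> \<le> 1 then 1 else 0)"
proof (cases "\<bar>y\<bar> \<le> 1")
  case True
  have X: "0 \<le> y ^ 2 ^ Suc n" "y ^ 2 ^ Suc n \<le> 1" for n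
  proof -
    have e: "y ^ 2 ^ Suc n = (y\<^sup>2) ^ 2 ^ n" by (simp add: power_mult)
    have "y\<^sup>2 \<le> 1" using True by (simp add: abs_square_le_1)
    then show "0 \<le> y ^ 2 ^ Suc n" "y ^ 2 ^ Suc n \<le> 1" unfolding e by (simp_all add: power_le_one)
  qed
  have "(\<lambda>n. real (Suc n) / (real (Suc n) + y ^ 2 ^ Suc n)) \<longlonglongrightarrow> 1"
  proof (rule tendsto_sandwich)
    show "\<forall>\<^sub>F n in sequentially. real (Suc n) / (real (Suc n) + 1) \<le> real (Suc n) / (real (Suc n) + y ^ 2 ^ Suc n)"
      using X by (intro always_eventually allI divide_left_mono) (auto intro!: mult_pos_pos add_pos_nonneg)
    show "\<forall>\<^sub>F n in sequentially. real (Suc n) / (real (Suc n) + y ^ 2 ^ Suc n) \<le> 1"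
      using X by (intro always_eventually allI) (simp add: divide_le_eq add_pos_nonneg)
    have "(\<lambda>n. 1 - inverse (real (Suc (Suc n)))) \<longlonglongrightarrow> 1 - 0"
      by (intro tendsto_diff tendsto_const LIMSEQ_Suc[OF LIMSEQ_inverse_real_of_nat])
    moreover have "1 - inverse (real (Suc (Suc n))) = real (Suc n) / (real (Suc n) + 1)" for n
      by (simp add: field_simps)
    ultimately show "(\<lambda>n. real (Suc n) / (real (Suc n) + 1)) \<longlonglongrightarrow> 1" by simp
  qed simp
  then show ?thesis using True by simp
next
  case False
  define x where "x = y\<^sup>2"
  have x: "1 < x" using False by (metis x_def abs_square_le_1 not_le)
  have "(\<lambda>n. real (Suc n) / (real (Suc n) + y ^ 2 ^ Suc n)) \<longlonglongrightarrow> 0"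
  proof (rule tendsto_sandwich)
    show "\<forall>\<^sub>F n in sequentially. 0 \<le> real (Suc n) / (real (Suc n) + y ^ 2 ^ Suc n)"
    proof (intro always_eventually allI)
      fix n
      have "y ^ 2 ^ Suc n = x ^ 2 ^ n" by (simp add: power_mult x_def)
      then show "0 \<le> real (Suc n) / (real (Suc n) + y ^ 2 ^ Suc n)" using x by simp
    qed
    show "\<forall>\<^sub>F n in sequentially. real (Suc n) / (real (Suc n) + y ^ 2 ^ Suc n) \<le> real (Suc n) * inverse x ^ Suc n"
    proof (intro always_eventually allI)
      fix n
      have e: "y ^ 2 ^ Suc n = x ^ 2 ^ n" by (simp add: power_mult x_def)
      have "x ^ Suc n \<le> x ^ 2 ^ n" using x less_exp[of n] by (intro power_increasing Suc_leI) auto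
      then have "real (Suc n) / (real (Suc n) + y ^ 2 ^ Suc n) \<le> real (Suc n) / x ^ Suc n"
        unfolding e using x by (intro divide_left_mono mult_pos_pos add_pos_pos) auto
      then show "real (Suc n) / (real (Suc n) + y ^ 2 ^ Suc n) \<le> real (Suc n) * inverse x ^ Suc n"
        by (simp add: divide_inverse power_inverse del: power_Suc)
    qed
    have "(\<lambda>n. real n * inverse x ^ n) \<longlonglongrightarrow> 0"
      using x by (intro powser_times_n_limit_0) (simp add: inverse_less_1_iff)
    then show "(\<lambda>n. real (Suc n) * inverse x ^ Suc n) \<longlonglongrightarrow> 0" by (rule LIMSEQ_Suc)
  qed simp
  then show ?thesis using False by simp
qed

lemma interval_integral_zero:
  assumes mm: "m \<in> borel_measurable borel"
    and m: "\<And>z. Im z \<noteq> 0 \<Longrightarrow> has_bochner_integral \<mu> (\<lambda>t. m t / (of_real t - z)) 0"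
    and cd: "c < d"
  shows "has_bochner_integral \<mu> (\<lambda>t. indicator {c..d} t * m t) 0"
proof -
  define a where "a = (c + d) / 2"
  define b where "b = (d - c) / 2"
  have b: "b > 0" using cd by (simp add: b_def)
  have [measurable]: "m \<in> borel_measurable \<mu>" using mm measurable_eq by simp
  define K where "K n t = m t * of_real (real (Suc n) / (real (Suc n) + ((t - a) / b) ^ 2 ^ Suc n))" for n t
  have K: "has_bochner_integral \<mu> (K n) 0" for n
    unfolding K_def by (rule interval_kernel[OF m b]) simp_all
  \<comment> \<open>The majorant uses the kernel with c = 1 and exponent 2, so its integrability is
    an instance of \<open>interval_kernel\<close>.\<close>
  let ?w = "\<lambda>t. 2 * norm (m t * of_real (1 / (1 + ((t - a) / b) ^ 2 ^ Suc 0)))"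
  have lim: "AE t in \<mu>. (\<lambda>n. K n t) \<longlonglongrightarrow> indicator {c..d} t * m t"
  proof (rule AE_I2)
    fix t
    have "(\<lambda>n. K n t) \<longlonglongrightarrow> m t * of_real (if \<bar>(t - a) / b\<bar> \<le> 1 then 1 else 0)"
      unfolding K_def by (intro tendsto_intros kernel_tendsto)
    moreover have "\<bar>(t - a) / b\<bar> \<le> 1 \<longleftrightarrow> t \<in> {c..d}"
    proof -
      have "\<bar>(t - a) / b\<bar> \<le> 1 \<longleftrightarrow> \<bar>t - a\<bar> \<le> b" using b by (simp add: abs_divide)
      also have "\<dots> \<longleftrightarrow> t \<in> {c..d}" unfolding atLeastAtMost_iff a_def b_def by (auto simp: abs_le_iff field_simps)
      finally show ?thesis .
    qed
    ultimately show "(\<lambda>n. K n t) \<longlonglongrightarrow> indicator {c..d} t * m t"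
      by (auto simp: indicator_def split: if_splits)
  qed
  have w: "integrable \<mu> ?w"
    using interval_kernel[OF m b, of 1 a 0]
    by (intro integrable_mult_right integrable_norm) (simp add: has_bochner_integral_iff)
  have bound: "AE t in \<mu>. norm (K n t) \<le> ?w t" for n
  proof (rule AE_I2)
    fix t
    let ?y = "(t - a) / b"
    have "0 \<le> ?y ^ 2 ^ Suc n" by (simp add: power_mult)
    then have "norm (K n t) = cmod (m t) * (real (Suc n) / (real (Suc n) + ?y ^ 2 ^ Suc n))"
      unfolding K_def norm_mult norm_of_real by (simp add: abs_of_nonneg)
    also have "\<dots> \<le> cmod (m t) * (2 * (1 / (1 + ?y\<^sup>2)))"
      by (intro mult_left_mono kernel_bound) simp
    also have "\<dots> = ?w t"
      unfolding norm_mult norm_of_real by (simp add: abs_of_nonneg)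
    finally show "norm (K n t) \<le> ?w t" .
  qed
  have meas: "(\<lambda>t. indicator {c..d} t * m t) \<in> borel_measurable \<mu>" by measurable
  have Km: "K n \<in> borel_measurable \<mu>" for n
    using K[of n] by (auto simp: has_bochner_integral_iff)
  have "integrable \<mu> (\<lambda>t. indicator {c..d} t * m t)"
    by (rule integrable_dominated_convergence[OF meas Km w lim bound])
  moreover have "(\<lambda>n. integral\<^sup>L \<mu> (K n)) \<longlonglongrightarrow> (\<integral>t. indicator {c..d} t * m t \<partial>\<mu>)"
    by (rule integral_dominated_convergence[OF meas Km w lim bound])
  then have "(\<integral>t. indicator {c..d} t * m t \<partial>\<mu>) = 0"
    using K by (simp add: has_bochner_integral_iff LIMSEQ_const_iff)
  ultimately show ?thesis by (simp add: has_bochner_integral_iff)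
qed

text \<open>\<mu> may have atoms, and two intervals may meet in one point, so points are needed too;
  they are limits of shrinking intervals.\<close>

lemma closed_interval_integral_zero:
  assumes mm: "m \<in> borel_measurable borel"
    and m: "\<And>z. Im z \<noteq> 0 \<Longrightarrow> has_bochner_integral \<mu> (\<lambda>t. m t / (of_real t - z)) 0"
  shows "has_bochner_integral \<mu> (\<lambda>t. indicator {c..d} t * m t) 0"
proof (cases c d rule: linorder_cases)
  case less
  with mm m show ?thesis by (rule interval_integral_zero)
next
  case greater
  then show ?thesis by (simp add: has_bochner_integral_iff)
next
  case equal
  have [measurable]: "m \<in> borel_measurable \<mu>" using mm measurable_eq by simp
  let ?I = "\<lambda>n::nat. {c..c + inverse (real (Suc n))}"
  have I: "has_bochner_integral \<mu> (\<lambda>t. indicator (?I n) t * m t) 0" for n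
    by (rule interval_integral_zero[OF mm m])
      (simp_all only: less_add_same_cancel1 inverse_positive_iff_positive of_nat_0_less_iff zero_less_Suc
        not_False_eq_True)
  have meas: "(\<lambda>t. indicator {c..d} t * m t) \<in> borel_measurable \<mu>" by measurable
  have Im: "(\<lambda>t. indicator (?I n) t * m t) \<in> borel_measurable \<mu>" for n by measurable
  have w: "integrable \<mu> (\<lambda>t. norm (indicator (?I 0) t * m t))"
    using I[of 0] by (intro integrable_norm) (simp add: has_bochner_integral_iff)
  have bound: "AE t in \<mu>. norm (indicator (?I n) t * m t) \<le> norm (indicator (?I 0) t * m t)" for n
  proof -
    have "inverse (real (Suc n)) \<le> 1" by (simp add: field_simps)
    then show ?thesis by (intro AE_I2) (auto simp: indicator_def)
  qed
  have lim: "AE t in \<mu>. (\<lambda>n. indicator (?I n) t * m t) \<longlonglongrightarrow> indicator {c..d} t * m t"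
  proof (rule AE_I2, rule tendsto_eventually)
    fix t
    show "\<forall>\<^sub>F n in sequentially. indicator (?I n) t * m t = indicator {c..d} t * m t"
    proof (cases "t \<le> c")
      case True
      then show ?thesis using equal by (intro always_eventually) (auto simp: indicator_def)
    next
      case False
      then obtain N where N: "inverse (real (Suc N)) < t - c" using reals_Archimedean[of "t - c"] by auto
      have "indicator (?I n) t * m t = indicator {c..d} t * m t" if "N \<le> n" for n
      proof -
        have "inverse (real (Suc n)) \<le> inverse (real (Suc N))" using that by (intro le_imp_inverse_le) auto
        then have "c + inverse (real (Suc n)) < t" using N by linarith
        then show ?thesis using False equal by (auto simp: indicator_def simp del: of_nat_Suc)
      qed
      then show ?thesis unfolding eventually_sequentially by blast
    qed
  qed
  have "integrable \<mu> (\<lambda>t. indicator {c..d} t * m t)"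
    by (rule integrable_dominated_convergence[OF meas Im w lim bound])
  moreover have "(\<lambda>n. \<integral>t. indicator (?I n) t * m t \<partial>\<mu>) \<longlonglongrightarrow> (\<integral>t. indicator {c..d} t * m t \<partial>\<mu>)"
    by (rule integral_dominated_convergence[OF meas Im w lim bound])
  then have "(\<integral>t. indicator {c..d} t * m t \<partial>\<mu>) = 0"
    using I by (simp add: has_bochner_integral_iff LIMSEQ_const_iff)
  ultimately show ?thesis by (simp add: has_bochner_integral_iff)
qed

text \<open>Vanishing on intervals passes to all Borel sets by Dynkin's argument, since closed
  intervals are stable under intersection. m is truncated first, because only its truncations are
  known to be integrable.\<close>

lemma resolvents_total:
  assumes mm: "m \<in> borel_measurable borel"
    and m: "\<And>z. Im z \<noteq> 0 \<Longrightarrow> has_bochner_integral \<mu> (\<lambda>t. m t / (of_real t - z)) 0"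
  shows "AE t in \<mu>. m t = 0"
proof -
  have "AE t in \<mu>. indicator {- real N..real N} t * m t = 0" for N
  proof -
    let ?h = "\<lambda>t. indicator {- real N..real N} t * m t"
    have hi: "integrable \<mu> ?h"
      using closed_interval_integral_zero[OF mm m] by (simp add: has_bochner_integral_iff)
    have interval: "set_lebesgue_integral \<mu> {c..d} ?h = 0" for c d
    proof -
      have "indicator {c..d} t *\<^sub>R ?h t = indicator {max c (- real N)..min d (real N)} t * m t" for t
        by (auto simp: indicator_def)
      then show ?thesis
        using closed_interval_integral_zero[OF mm m, of "max c (- real N)" "min d (real N)"]
        by (simp add: set_lebesgue_integral_def has_bochner_integral_iff)
    qed
    have total: "set_lebesgue_integral \<mu> UNIV ?h = 0"
      using closed_interval_integral_zero[OF mm m] by (simp add: set_lebesgue_integral_def has_bochner_integral_iff)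
    have set_int: "set_integrable \<mu> A ?h" if "A \<in> sets borel" for A
      using hi that unfolding set_integrable_def by (intro integrable_mult_indicator) (auto simp: sets_eq)
    have "set_lebesgue_integral \<mu> A ?h = 0" if A: "A \<in> sets borel" for A
    proof -
      have gen: "sets borel = sigma_sets UNIV (range (\<lambda>(c, d). {c..d :: real}))"
        by (subst borel_eq_atLeastAtMost) (simp add: sets_measure_of)
      have stable: "Int_stable (range (\<lambda>(c, d). {c..d :: real}))"
      proof (rule Int_stableI_image)
        fix p q :: "real \<times> real"
        show "\<exists>k\<in>UNIV. (case p of (c, d) \<Rightarrow> {c..d}) \<inter> (case q of (c, d) \<Rightarrow> {c..d}) = (case k of (c, d) \<Rightarrow> {c..d})"
          by (rule bexI[of _ "(max (fst p) (fst q), min (snd p) (snd q))"]) (auto split: prod.splits)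
      qed
      have closed: "range (\<lambda>(c, d). {c..d :: real}) \<subseteq> Pow UNIV" by simp
      show ?thesis
        using stable closed A[unfolded gen]
      proof (induction rule: sigma_sets_induct_disjoint)
        case (basic A)
        then show ?case using interval by auto
      next
        case empty
        show ?case by (simp add: set_lebesgue_integral_def)
      next
        case (compl A)
        then have AB: "A \<in> sets borel" by (simp add: gen)
        have "set_lebesgue_integral \<mu> (A \<union> (UNIV - A)) ?h
            = set_lebesgue_integral \<mu> A ?h + set_lebesgue_integral \<mu> (UNIV - A) ?h"
          using AB by (intro set_integral_Un set_int) auto
        then show ?case using compl total by simp
      next
        case (union A)
        then have AB: "A i \<in> sets borel" for i by (auto simp: gen)
        have "set_lebesgue_integral \<mu> (\<Union>i. A i) ?h = (\<Sum>i. set_lebesgue_integral \<mu> (A i) ?h)"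
          using AB set_int[of "\<Union>i. A i"] disjoint_family_onD[OF union(1)]
          by (intro lebesgue_integral_countable_add) (auto simp: sets_eq)
        then show ?case using union by simp
      qed
    qed
    then show ?thesis using density_zero[OF hi] by (simp add: sets_eq)
  qed
  then have "AE t in \<mu>. \<forall>N. indicator {- real N..real N} t * m t = 0"
    unfolding AE_all_countable by (rule allI)
  then show ?thesis
  proof eventually_elim
    case (elim t)
    have "t \<in> (\<Union>N. {- real N..real N})" unfolding intervals_cover by simp
    then obtain N where "t \<in> {- real N..real N}" by blast
    then show ?case using elim[rule_format, of N] by simp
  qed
qed

end

section \<open>The space of classes of square integrable functions\<close>

lemma cring_complex_ring: "cring complex_ring"
proof -
  have "\<exists>y. x + y = 0 \<and> y + x = 0" for x :: complex by (rule exI[of _ "- x"]) simp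
  then show ?thesis
    by unfold_locales (auto simp: complex_ring_def Units_def algebra_simps add_eq_0_iff)
qed

context herglotz_measure
begin

definition cls :: "(real \<Rightarrow> complex) \<Rightarrow> (real \<Rightarrow> complex) set" where
  "cls f = {g \<in> borel_measurable borel. AE t in \<mu>. g t = f t}"

text \<open>Sets that are not classes get the representative \<open>0\<close>; this makes the distance symmetric on
  the whole type.\<close>

definition rep :: "(real \<Rightarrow> complex) set \<Rightarrow> real \<Rightarrow> complex" where
  "rep X = (if X \<in> cls ` L2 then SOME f. f \<in> L2 \<and> cls f = X else (\<lambda>_. 0))"

definition L2_space :: "(real \<Rightarrow> complex) set inner_space" where
  "L2_space = \<lparr>carrier = cls ` L2, mult = (\<lambda>X Y. X), one = cls (\<lambda>_. 0), zero = cls (\<lambda>_. 0),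
    add = (\<lambda>X Y. cls (\<lambda>t. rep X t + rep Y t)), smult = (\<lambda>c X. cls (\<lambda>t. c * rep X t)),
    ip = (\<lambda>X Y. \<integral>t. rep X t * cnj (rep Y t) \<partial>\<mu>)\<rparr>"

lemma cls_cong: "AE t in \<mu>. f t = g t \<Longrightarrow> cls f = cls g"
proof -
  assume fg: "AE t in \<mu>. f t = g t"
  have "(AE t in \<mu>. h t = f t) \<longleftrightarrow> (AE t in \<mu>. h t = g t)" for h
  proof
    show "AE t in \<mu>. h t = g t" if "AE t in \<mu>. h t = f t"
      using that fg by eventually_elim simp
    show "AE t in \<mu>. h t = f t" if "AE t in \<mu>. h t = g t"
      using that fg by eventually_elim simp
  qed
  then show ?thesis by (simp add: cls_def)
qed

lemma cls_eqD:
  assumes "cls f = cls g" "f \<in> L2"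
  shows "AE t in \<mu>. f t = g t"
proof -
  have "f \<in> cls g"
    unfolding assms(1)[symmetric] using L2_measurable[OF assms(2)] by (simp add: cls_def)
  then show ?thesis by (simp add: cls_def)
qed

lemma rep: "rep X \<in> L2" "X \<in> cls ` L2 \<Longrightarrow> cls (rep X) = X"
proof -
  have *: "(SOME f. f \<in> L2 \<and> cls f = X) \<in> L2 \<and> cls (SOME f. f \<in> L2 \<and> cls f = X) = X" if "X \<in> cls ` L2"
    by (rule someI_ex[of "\<lambda>f. f \<in> L2 \<and> cls f = X"]) (use that in blast)
  then show "rep X \<in> L2" "X \<in> cls ` L2 \<Longrightarrow> cls (rep X) = X"
    by (auto simp: rep_def L2_zero)
qed

lemma rep_cls: "f \<in> L2 \<Longrightarrow> AE t in \<mu>. rep (cls f) t = f t"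
  by (intro cls_eqD rep) auto

lemma L2_space_simps:
  "carrier L2_space = cls ` L2" "\<zero>\<^bsub>L2_space\<^esub> = cls (\<lambda>_. 0)"
  "f \<in> L2 \<Longrightarrow> g \<in> L2 \<Longrightarrow> cls f \<oplus>\<^bsub>L2_space\<^esub> cls g = cls (\<lambda>t. f t + g t)"
  "f \<in> L2 \<Longrightarrow> c \<odot>\<^bsub>L2_space\<^esub> cls f = cls (\<lambda>t. c * f t)"
  "f \<in> L2 \<Longrightarrow> g \<in> L2 \<Longrightarrow> ip L2_space (cls f) (cls g) = (\<integral>t. f t * cnj (g t) \<partial>\<mu>)"
proof -
  show "carrier L2_space = cls ` L2" "\<zero>\<^bsub>L2_space\<^esub> = cls (\<lambda>_. 0)" by (simp_all add: L2_space_def)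
  show "c \<odot>\<^bsub>L2_space\<^esub> cls f = cls (\<lambda>t. c * f t)" if "f \<in> L2"
  proof -
    have "AE t in \<mu>. c * rep (cls f) t = c * f t" using rep_cls[OF that] by eventually_elim simp
    then show ?thesis by (simp add: L2_space_def cls_cong)
  qed
  assume fg: "f \<in> L2" "g \<in> L2"
  have "AE t in \<mu>. rep (cls f) t + rep (cls g) t = f t + g t"
    using rep_cls[OF fg(1)] rep_cls[OF fg(2)] by eventually_elim simp
  then show "cls f \<oplus>\<^bsub>L2_space\<^esub> cls g = cls (\<lambda>t. f t + g t)" by (simp add: L2_space_def cls_cong)
  have ae: "AE t in \<mu>. rep (cls f) t * cnj (rep (cls g) t) = f t * cnj (g t)"
    using rep_cls[OF fg(1)] rep_cls[OF fg(2)] by eventually_elim simp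
  have "(\<integral>t. rep (cls f) t * cnj (rep (cls g) t) \<partial>\<mu>) = (\<integral>t. f t * cnj (g t) \<partial>\<mu>)"
    using L2_mult_cnj_integrable[OF rep(1) rep(1)] L2_mult_cnj_integrable[OF fg] ae
    by (intro integral_cong_AE) (auto dest: borel_measurable_integrable)
  then show "ip L2_space (cls f) (cls g) = (\<integral>t. f t * cnj (g t) \<partial>\<mu>)" by (simp add: L2_space_def)
qed

text \<open>\<open>X\<close> ranges over the whole type: outside the carrier its representative is 0
  and the inverse is still well determined, so the formulas for difference and distance hold there
  as well.\<close>

lemma a_inv_L2_space: "\<ominus>\<^bsub>L2_space\<^esub> X = cls (\<lambda>t. - rep X t)"
proof -
  have n: "(\<lambda>t. - rep X t) \<in> L2" using L2_scale[OF rep(1), of "-1" X] by simp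
  have add: "X \<oplus>\<^bsub>L2_space\<^esub> cls g = cls (\<lambda>t. rep X t + g t)" "cls g \<oplus>\<^bsub>L2_space\<^esub> X = cls (\<lambda>t. g t + rep X t)"
    if "g \<in> L2" for g
  proof -
    have "AE t in \<mu>. rep X t + rep (cls g) t = rep X t + g t" "AE t in \<mu>. rep (cls g) t + rep X t = g t + rep X t"
      using rep_cls[OF that] by (eventually_elim, simp)+
    then show "X \<oplus>\<^bsub>L2_space\<^esub> cls g = cls (\<lambda>t. rep X t + g t)" "cls g \<oplus>\<^bsub>L2_space\<^esub> X = cls (\<lambda>t. g t + rep X t)"
      by (simp_all add: L2_space_def cls_cong)
  qed
  have "(THE Y. Y \<in> cls ` L2 \<and> X \<oplus>\<^bsub>L2_space\<^esub> Y = cls (\<lambda>_. 0) \<and> Y \<oplus>\<^bsub>L2_space\<^esub> X = cls (\<lambda>_. 0)) = cls (\<lambda>t. - rep X t)"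
  proof (rule the_equality)
    show "cls (\<lambda>t. - rep X t) \<in> cls ` L2 \<and> X \<oplus>\<^bsub>L2_space\<^esub> cls (\<lambda>t. - rep X t) = cls (\<lambda>_. 0)
        \<and> cls (\<lambda>t. - rep X t) \<oplus>\<^bsub>L2_space\<^esub> X = cls (\<lambda>_. 0)"
      using n by (simp add: add[OF n])
    fix Y assume Y: "Y \<in> cls ` L2 \<and> X \<oplus>\<^bsub>L2_space\<^esub> Y = cls (\<lambda>_. 0) \<and> Y \<oplus>\<^bsub>L2_space\<^esub> X = cls (\<lambda>_. 0)"
    then obtain g where g: "g \<in> L2" "Y = cls g" by blast
    have "AE t in \<mu>. rep X t + g t = 0"
      using Y g by (intro cls_eqD L2_add rep) (simp add: add[OF g(1)])
    then have "AE t in \<mu>. g t = - rep X t" by eventually_elim (simp only: add_eq_0_iff)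
    then show "Y = cls (\<lambda>t. - rep X t)" unfolding g by (rule cls_cong)
  qed
  then show ?thesis by (simp add: a_inv_def m_inv_def L2_space_simps)
qed

lemma L2_space_diff: "X \<ominus>\<^bsub>L2_space\<^esub> Y = cls (\<lambda>t. rep X t - rep Y t)"
proof -
  have n: "(\<lambda>t. - rep Y t) \<in> L2" using L2_scale[OF rep(1), of "-1" Y] by simp
  have "AE t in \<mu>. rep X t + rep (cls (\<lambda>t. - rep Y t)) t = rep X t - rep Y t"
    using rep_cls[OF n] by eventually_elim simp
  then show ?thesis unfolding a_minus_def a_inv_L2_space by (simp add: L2_space_def cls_cong)
qed

lemma L2_space_nrm: "f \<in> L2 \<Longrightarrow> nrm L2_space (cls f) = sqrt (\<integral>t. (cmod (f t))\<^sup>2 \<partial>\<mu>)"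
proof -
  assume f: "f \<in> L2"
  have "ip L2_space (cls f) (cls f) = (\<integral>t. complex_of_real ((cmod (f t))\<^sup>2) \<partial>\<mu>)"
    using f by (simp add: L2_space_simps complex_norm_square del: of_real_power)
  then show ?thesis unfolding nrm_def integral_complex_of_real by simp
qed

lemma L2_space_dst: "dst L2_space X Y = sqrt (\<integral>t. (cmod (rep X t - rep Y t))\<^sup>2 \<partial>\<mu>)"
  unfolding dst_def L2_space_diff by (rule L2_space_nrm) (intro L2_diff rep)

section \<open>The Hilbert space axioms for classes\<close>

lemma abelian_group_L2_space: "abelian_group L2_space"
proof (rule abelian_groupI)
  fix X Y assume "X \<in> carrier L2_space" "Y \<in> carrier L2_space"
  then obtain f g where fg: "f \<in> L2" "g \<in> L2" "X = cls f" "Y = cls g" by (auto simp: L2_space_simps)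
  show "X \<oplus>\<^bsub>L2_space\<^esub> Y \<in> carrier L2_space" using fg L2_add by (auto simp: L2_space_simps)
  show "X \<oplus>\<^bsub>L2_space\<^esub> Y = Y \<oplus>\<^bsub>L2_space\<^esub> X" using fg by (simp add: L2_space_simps add.commute)
  fix Z assume "Z \<in> carrier L2_space"
  then obtain h where h: "h \<in> L2" "Z = cls h" by (auto simp: L2_space_simps)
  show "X \<oplus>\<^bsub>L2_space\<^esub> Y \<oplus>\<^bsub>L2_space\<^esub> Z = X \<oplus>\<^bsub>L2_space\<^esub> (Y \<oplus>\<^bsub>L2_space\<^esub> Z)"
    using fg h by (simp add: L2_space_simps L2_add add.assoc)
next
  show "\<zero>\<^bsub>L2_space\<^esub> \<in> carrier L2_space" using L2_zero by (auto simp: L2_space_simps)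
  fix X assume "X \<in> carrier L2_space"
  then obtain f where f: "f \<in> L2" "X = cls f" by (auto simp: L2_space_simps)
  show "\<zero>\<^bsub>L2_space\<^esub> \<oplus>\<^bsub>L2_space\<^esub> X = X" using f L2_zero by (simp add: L2_space_simps)
  have n: "(\<lambda>t. (-1) * f t) \<in> L2" by (rule L2_scale[OF f(1)])
  show "\<exists>Y\<in>carrier L2_space. Y \<oplus>\<^bsub>L2_space\<^esub> X = \<zero>\<^bsub>L2_space\<^esub>"
  proof
    show "cls (\<lambda>t. (-1) * f t) \<in> carrier L2_space" using n by (simp add: L2_space_simps)
    show "cls (\<lambda>t. (-1) * f t) \<oplus>\<^bsub>L2_space\<^esub> X = \<zero>\<^bsub>L2_space\<^esub>"
      unfolding f(2) L2_space_simps(2) L2_space_simps(3)[OF n f(1)] by simp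
  qed
qed

lemma module_L2_space: "Module.module complex_ring L2_space"
proof (rule moduleI[OF cring_complex_ring abelian_group_L2_space])
  fix a b X assume "X \<in> carrier L2_space"
  then obtain f where f: "f \<in> L2" "X = cls f" by (auto simp: L2_space_simps)
  show "a \<odot>\<^bsub>L2_space\<^esub> X \<in> carrier L2_space" using f L2_scale by (auto simp: L2_space_simps)
  show "(a \<oplus>\<^bsub>complex_ring\<^esub> b) \<odot>\<^bsub>L2_space\<^esub> X = a \<odot>\<^bsub>L2_space\<^esub> X \<oplus>\<^bsub>L2_space\<^esub> b \<odot>\<^bsub>L2_space\<^esub> X"
    using f by (simp add: L2_space_simps L2_scale complex_ring_def distrib_right)
  show "(a \<otimes>\<^bsub>complex_ring\<^esub> b) \<odot>\<^bsub>L2_space\<^esub> X = a \<odot>\<^bsub>L2_space\<^esub> (b \<odot>\<^bsub>L2_space\<^esub> X)"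
    using f by (simp add: L2_space_simps L2_scale complex_ring_def mult.assoc)
  show "\<one>\<^bsub>complex_ring\<^esub> \<odot>\<^bsub>L2_space\<^esub> X = X"
    using f by (simp add: L2_space_simps complex_ring_def)
  fix Y assume "Y \<in> carrier L2_space"
  then obtain g where g: "g \<in> L2" "Y = cls g" by (auto simp: L2_space_simps)
  show "a \<odot>\<^bsub>L2_space\<^esub> (X \<oplus>\<^bsub>L2_space\<^esub> Y) = a \<odot>\<^bsub>L2_space\<^esub> X \<oplus>\<^bsub>L2_space\<^esub> a \<odot>\<^bsub>L2_space\<^esub> Y"
    using f g by (simp add: L2_space_simps L2_scale L2_add distrib_left)
qed

lemma pre_hilbert_L2_space: "pre_hilbert_space L2_space"
proof (rule pre_hilbert_space.intro[OF module_L2_space], unfold_locales)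
  fix X Y Z c
  show "0 \<le> dst L2_space X Y" by (simp add: L2_space_dst)
  show "dst L2_space X Y = dst L2_space Y X" by (simp add: L2_space_dst norm_minus_commute)
  assume "X \<in> carrier L2_space"
  then obtain f where f: "f \<in> L2" "X = cls f" by (auto simp: L2_space_simps)
  have sq: "ip L2_space X X = complex_of_real (\<integral>t. (cmod (f t))\<^sup>2 \<partial>\<mu>)"
  proof -
    have "ip L2_space X X = (\<integral>t. complex_of_real ((cmod (f t))\<^sup>2) \<partial>\<mu>)"
      using f by (simp add: L2_space_simps complex_norm_square del: of_real_power)
    then show ?thesis by (simp only: integral_complex_of_real)
  qed
  show "0 \<le> Re (ip L2_space X X)" unfolding sq by simp
  show "X = \<zero>\<^bsub>L2_space\<^esub>" if "ip L2_space X X = 0"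
  proof -
    have "AE t in \<mu>. f t = 0" using that unfolding sq by (intro L2_norm_zero f) simp
    then show ?thesis unfolding f L2_space_simps by (rule cls_cong)
  qed
  assume "Z \<in> carrier L2_space"
  then obtain h where h: "h \<in> L2" "Z = cls h" by (auto simp: L2_space_simps)
  show "ip L2_space (c \<odot>\<^bsub>L2_space\<^esub> X) Z = c * ip L2_space X Z"
    using f h by (simp add: L2_space_simps L2_scale mult.assoc)
  assume "Y \<in> carrier L2_space"
  then obtain g where g: "g \<in> L2" "Y = cls g" by (auto simp: L2_space_simps)
  show "ip L2_space (X \<oplus>\<^bsub>L2_space\<^esub> Y) Z = ip L2_space X Z + ip L2_space Y Z"
    using f g h L2_mult_cnj_integrable[OF f(1) h(1)] L2_mult_cnj_integrable[OF g(1) h(1)]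
    by (simp add: L2_space_simps L2_add distrib_right)
next
  fix X Y assume "X \<in> carrier L2_space" "Y \<in> carrier L2_space"
  then obtain f g where fg: "f \<in> L2" "g \<in> L2" "X = cls f" "Y = cls g" by (auto simp: L2_space_simps)
  have "cnj (ip L2_space Y X) = (\<integral>t. cnj (g t * cnj (f t)) \<partial>\<mu>)"
    using fg by (simp only: L2_space_simps Bochner_Integration.integral_cnj)
  then show "ip L2_space X Y = cnj (ip L2_space Y X)"
    using fg by (simp add: L2_space_simps mult.commute)
qed

lemma hilbert_L2_space: "hilbert_metric_space L2_space"
proof -
  interpret pre_hilbert_space L2_space by (rule pre_hilbert_L2_space)
  show ?thesis
  proof
    show "Metric_space.mcomplete (carrier L2_space) (dst L2_space)"
      unfolding MS.mcomplete_def
    proof (intro allI impI)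
      fix \<sigma> assume \<sigma>: "MS.MCauchy \<sigma>"
      have "\<exists>N. \<forall>m\<ge>N. \<forall>n\<ge>N. (\<integral>t. (cmod (rep (\<sigma> m) t - rep (\<sigma> n) t))\<^sup>2 \<partial>\<mu>) < e" if "0 < e" for e
      proof -
        obtain N where "\<forall>m n. N \<le> m \<longrightarrow> N \<le> n \<longrightarrow> dst L2_space (\<sigma> m) (\<sigma> n) < sqrt e"
          using \<sigma> real_sqrt_gt_zero[OF \<open>0 < e\<close>] unfolding MS.MCauchy_def by blast
        then show ?thesis unfolding L2_space_dst real_sqrt_less_iff by blast
      qed
      then obtain f where f: "f \<in> L2"
        and lim: "\<And>e. 0 < e \<Longrightarrow> \<exists>N. \<forall>n\<ge>N. (\<integral>t. (cmod (rep (\<sigma> n) t - f t))\<^sup>2 \<partial>\<mu>) \<le> e"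
        using L2_complete[of "\<lambda>n. rep (\<sigma> n)"] rep(1) by blast
      have d: "dst L2_space (\<sigma> n) (cls f) = sqrt (\<integral>t. (cmod (rep (\<sigma> n) t - f t))\<^sup>2 \<partial>\<mu>)" for n
      proof -
        have "AE t in \<mu>. (cmod (rep (\<sigma> n) t - rep (cls f) t))\<^sup>2 = (cmod (rep (\<sigma> n) t - f t))\<^sup>2"
          using rep_cls[OF f] by eventually_elim simp
        then have "(\<integral>t. (cmod (rep (\<sigma> n) t - rep (cls f) t))\<^sup>2 \<partial>\<mu>) = (\<integral>t. (cmod (rep (\<sigma> n) t - f t))\<^sup>2 \<partial>\<mu>)"
          using L2_integrable[OF L2_diff[OF rep(1) rep(1)]] L2_integrable[OF L2_diff[OF rep(1) f]]
          by (intro integral_cong_AE) (auto dest: borel_measurable_integrable)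
        then show ?thesis by (simp add: L2_space_dst)
      qed
      have "limitin (norm_topology L2_space) \<sigma> (cls f) sequentially"
        unfolding MS.limitin_metric
      proof (intro conjI allI impI)
        show "cls f \<in> carrier L2_space" using f by (simp add: L2_space_simps)
        fix e :: real assume e: "0 < e"
        \<comment> \<open>The available bound is non-strict; e / 2 makes the distance strictly less
          than e.\<close>
        obtain N where N: "\<And>n. n \<ge> N \<Longrightarrow> (\<integral>t. (cmod (rep (\<sigma> n) t - f t))\<^sup>2 \<partial>\<mu>) \<le> (e / 2)\<^sup>2"
          using lim[of "(e / 2)\<^sup>2"] e by auto
        have "dst L2_space (\<sigma> n) (cls f) < e" if "n \<ge> N" for n
        proof -
          have "dst L2_space (\<sigma> n) (cls f) \<le> sqrt ((e / 2)\<^sup>2)"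
            unfolding d by (rule real_sqrt_le_mono[OF N[OF that]])
          also have "\<dots> < e" using e by simp
          finally show ?thesis .
        qed
        moreover have "\<sigma> n \<in> carrier L2_space" for n using \<sigma> by (auto simp: MS.MCauchy_def)
        ultimately show "\<forall>\<^sub>F n in sequentially. \<sigma> n \<in> carrier L2_space \<and> dst L2_space (\<sigma> n) (cls f) < e"
          unfolding eventually_sequentially by blast
      qed
      then show "\<exists>x. limitin (norm_topology L2_space) \<sigma> x sequentially" by blast
    qed
  qed
qed

end

section \<open>Multiplication by the independent variable\<close>

context herglotz_measure
begin

text \<open>\<open>f\<close> lies in the domain of the maximal operator with boundary value \<open>c\<close>, and is mapped to
  \<open>t f - c\<close>. The constant \<open>c\<close> is unique since \<open>\<mu>\<close> is infinite.\<close>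

definition bdry :: "(real \<Rightarrow> complex) \<Rightarrow> complex \<Rightarrow> bool" where
  "bdry f c \<longleftrightarrow> f \<in> L2 \<and> (\<lambda>t. of_real t * f t - c) \<in> L2"

definition max_op :: "((real \<Rightarrow> complex) set \<times> (real \<Rightarrow> complex) set) set" where
  "max_op = {(cls f, cls (\<lambda>t. of_real t * f t - c)) |f c. bdry f c}"

definition bd0 :: "(real \<Rightarrow> complex) set \<Rightarrow> complex" where
  "bd0 X = (THE c. \<exists>f. X = cls f \<and> bdry f c)"

text \<open>A regularized integral: with boundary value c, f behaves like c / t and need not be
  integrable, but subtracting c t / (1 + t^2) makes it so. For f = 1 / (t - z) this is the integral
  in V.\<close>

definition bd1 :: "real \<Rightarrow> (real \<Rightarrow> complex) set \<Rightarrow> complex" where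
  "bd1 Q X = of_real Q * bd0 X + (\<integral>t. rep X t - bd0 X * (of_real t * wt t) \<partial>\<mu>)"

definition min_op :: "real \<Rightarrow> ((real \<Rightarrow> complex) set \<times> (real \<Rightarrow> complex) set) set" where
  "min_op Q = {(f, h) \<in> max_op. bd0 f = 0 \<and> bd1 Q f = 0}"

definition res :: "complex \<Rightarrow> (real \<Rightarrow> complex) set" where
  "res z = cls (\<lambda>t. 1 / (of_real t - z))"

text \<open>The formula is used at every non-real z, whereas the class prescribes V on the upper
  half-plane only; \<open>weyl_cnj\<close> supplies the reflection.\<close>

definition weyl :: "real \<Rightarrow> complex \<Rightarrow> complex" where
  "weyl Q z = of_real Q + (\<integral>t. 1 / (of_real t - z) - of_real t * wt t \<partial>\<mu>)"

lemma bdry_unique: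
  assumes "bdry f c" "bdry g d" "cls f = cls g"
  shows "c = d"
proof -
  have fg: "AE t in \<mu>. f t = g t" using assms by (intro cls_eqD) (auto simp: bdry_def)
  have "(\<lambda>t. (of_real t * f t - c) - (of_real t * g t - d)) \<in> L2"
    by (rule L2_diff) (use assms in \<open>simp_all add: bdry_def\<close>)
  moreover have "AE t in \<mu>. (of_real t * f t - c) - (of_real t * g t - d) = d - c"
    using fg by eventually_elim simp
  ultimately have "d - c = 0" by (rule not_L2_const)
  then show ?thesis by simp
qed

lemma bd0_cls: "bdry f c \<Longrightarrow> bd0 (cls f) = c"
  unfolding bd0_def by (rule the_equality) (auto intro: bdry_unique)

lemma wt_identity: "complex_of_real t * (complex_of_real t * wt t) = 1 - wt t"
proof -
  have "1 + t\<^sup>2 \<noteq> 0" by (simp add: add_nonneg_eq_0_iff)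
  then have "t * (t * (1 / (1 + t\<^sup>2))) = 1 - 1 / (1 + t\<^sup>2)"
    by (simp add: field_simps) (simp add: power2_eq_square)
  then have "complex_of_real (t * (t * (1 / (1 + t\<^sup>2)))) = of_real (1 - 1 / (1 + t\<^sup>2))" by (rule arg_cong)
  then show ?thesis by (simp only: wt_def of_real_mult of_real_diff of_real_1)
qed

text \<open>Since t^2 wt = 1 - wt, t times the regularized function is (t f - c) + c wt, again
  square integrable; so \<open>decay_integrable\<close> applies.\<close>

lemma regularized_integrable:
  assumes "bdry f c"
  shows "integrable \<mu> (\<lambda>t. f t - c * (of_real t * wt t))"
proof (rule decay_integrable)
  show "(\<lambda>t. f t - c * (of_real t * wt t)) \<in> L2"
    using assms by (intro L2_diff L2_scale wt_L2) (simp add: bdry_def)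
  have "(\<lambda>t. (of_real t * f t - c) + c * wt t) \<in> L2"
    using assms by (intro L2_add L2_scale wt_L2) (simp add: bdry_def)
  moreover have "(of_real t * f t - c) + c * wt t = of_real t * (f t - c * (of_real t * wt t))" for t
  proof -
    have "of_real t * (f t - c * (of_real t * wt t)) = of_real t * f t - c * (of_real t * (of_real t * wt t))"
      by (simp add: algebra_simps)
    then show ?thesis unfolding wt_identity by (simp add: algebra_simps)
  qed
  ultimately show "(\<lambda>t. of_real t * (f t - c * (of_real t * wt t))) \<in> L2" by simp
qed

lemma bd1_cls:
  assumes "bdry f c"
  shows "bd1 Q (cls f) = of_real Q * c + (\<integral>t. f t - c * (of_real t * wt t) \<partial>\<mu>)"
proof -
  have f: "f \<in> L2" using assms by (simp add: bdry_def)
  have "AE t in \<mu>. rep (cls f) t - c * (of_real t * wt t) = f t - c * (of_real t * wt t)"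
    using rep_cls[OF f] by eventually_elim simp
  moreover have "(\<lambda>t. rep (cls f) t - c * (of_real t * wt t)) \<in> borel_measurable \<mu>"
    unfolding measurable_eq by (intro L2_measurable L2_diff L2_scale rep wt_L2)
  ultimately have "(\<integral>t. rep (cls f) t - c * (of_real t * wt t) \<partial>\<mu>) = (\<integral>t. f t - c * (of_real t * wt t) \<partial>\<mu>)"
    using regularized_integrable[OF assms] by (intro integral_cong_AE) auto
  then show ?thesis by (simp add: bd1_def bd0_cls[OF assms])
qed

lemma max_opE:
  assumes "(X, Y) \<in> max_op"
  obtains f c where "bdry f c" "X = cls f" "Y = cls (\<lambda>t. of_real t * f t - c)"
    "f \<in> L2" "(\<lambda>t. of_real t * f t - c) \<in> L2"
  using assms unfolding max_op_def bdry_def by blast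

section \<open>The maximal operator and Green's identity\<close>

lemma bdry_add: "bdry f c \<Longrightarrow> bdry g d \<Longrightarrow> bdry (\<lambda>t. f t + g t) (c + d)"
  using L2_add[of f g] L2_add[of "\<lambda>t. of_real t * f t - c" "\<lambda>t. of_real t * g t - d"]
  by (simp add: bdry_def algebra_simps)

lemma bdry_scale: "bdry f c \<Longrightarrow> bdry (\<lambda>t. a * f t) (a * c)"
  using L2_scale[of f a] L2_scale[of "\<lambda>t. of_real t * f t - c" a]
  by (simp add: bdry_def algebra_simps)

lemma bdry_res:
  assumes "Im z \<noteq> 0"
  shows "bdry (\<lambda>t. 1 / (of_real t - z)) 1"
proof -
  have "of_real t * (1 / (of_real t - z)) - 1 = z * (1 / (of_real t - z))" for t
    using real_minus_nonzero[OF assms, of t] by (simp add: field_simps)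
  then show ?thesis
    using resolvent_L2[OF assms] L2_scale[OF resolvent_L2[OF assms], of z] by (simp add: bdry_def)
qed

lemma linear_max_op: "linear_op L2_space max_op"
proof -
  have "max_op \<subseteq> carrier L2_space \<times> carrier L2_space"
    by (auto simp: max_op_def L2_space_simps bdry_def)
  moreover have "single_valued max_op"
  proof (rule single_valuedI)
    fix X Y Z assume "(X, Y) \<in> max_op" "(X, Z) \<in> max_op"
    then obtain f c g d where fc: "bdry f c" "X = cls f" "Y = cls (\<lambda>t. of_real t * f t - c)"
      and gd: "bdry g d" "X = cls g" "Z = cls (\<lambda>t. of_real t * g t - d)"
      by (elim max_opE) blast
    have fg: "cls f = cls g" using fc(2) gd(2) by simp
    then have "c = d" by (rule bdry_unique[OF fc(1) gd(1)])
    have "AE t in \<mu>. f t = g t" using fc(1) by (intro cls_eqD fg) (simp add: bdry_def)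
    then have "AE t in \<mu>. of_real t * f t - c = of_real t * g t - d"
      by eventually_elim (simp add: \<open>c = d\<close>)
    then show "Y = Z" unfolding fc(3) gd(3) by (rule cls_cong)
  qed
  moreover have "(\<zero>\<^bsub>L2_space\<^esub>, \<zero>\<^bsub>L2_space\<^esub>) \<in> max_op"
    unfolding max_op_def
    by (rule CollectI, intro exI[of _ "\<lambda>_. 0"] exI[of _ 0]) (simp add: bdry_def L2_zero L2_space_simps)
  moreover have "(X \<oplus>\<^bsub>L2_space\<^esub> X', Y \<oplus>\<^bsub>L2_space\<^esub> Y') \<in> max_op" if XY: "(X, Y) \<in> max_op" "(X', Y') \<in> max_op" for X Y X' Y'
  proof -
    obtain f c where f: "bdry f c" "X = cls f" "Y = cls (\<lambda>t. of_real t * f t - c)"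
      "f \<in> L2" "(\<lambda>t. of_real t * f t - c) \<in> L2" by (rule max_opE[OF XY(1)])
    obtain g d where g: "bdry g d" "X' = cls g" "Y' = cls (\<lambda>t. of_real t * g t - d)"
      "g \<in> L2" "(\<lambda>t. of_real t * g t - d) \<in> L2" by (rule max_opE[OF XY(2)])
    have "Y \<oplus>\<^bsub>L2_space\<^esub> Y' = cls (\<lambda>t. of_real t * (f t + g t) - (c + d))"
      unfolding f g L2_space_simps(3)[OF f(5) g(5)] by (simp add: algebra_simps)
    moreover have "X \<oplus>\<^bsub>L2_space\<^esub> X' = cls (\<lambda>t. f t + g t)"
      unfolding f g by (rule L2_space_simps(3)[OF f(4) g(4)])
    ultimately show ?thesis using bdry_add[OF f(1) g(1)] unfolding max_op_def by blast
  qed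
  moreover have "(a \<odot>\<^bsub>L2_space\<^esub> X, a \<odot>\<^bsub>L2_space\<^esub> Y) \<in> max_op" if XY: "(X, Y) \<in> max_op" for a X Y
  proof -
    obtain f c where f: "bdry f c" "X = cls f" "Y = cls (\<lambda>t. of_real t * f t - c)"
      "f \<in> L2" "(\<lambda>t. of_real t * f t - c) \<in> L2" by (rule max_opE[OF XY])
    have "a \<odot>\<^bsub>L2_space\<^esub> Y = cls (\<lambda>t. of_real t * (a * f t) - a * c)"
      unfolding f L2_space_simps(4)[OF f(5)] by (simp add: algebra_simps)
    moreover have "a \<odot>\<^bsub>L2_space\<^esub> X = cls (\<lambda>t. a * f t)"
      unfolding f by (rule L2_space_simps(4)[OF f(4)])
    ultimately show ?thesis using bdry_scale[OF f(1)] unfolding max_op_def by blast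
  qed
  ultimately show ?thesis unfolding linear_op_def by blast
qed

text \<open>In the difference of the inner products the terms t f cnj g cancel, and the constants c
  and d remain, paired with g and f. The regularizing terms cancel each other as well, and so do the
  terms with Q, because Q is real.\<close>

lemma green_max_op:
  assumes "(X, Y) \<in> max_op" "(X', Y') \<in> max_op"
  shows "ip L2_space Y X' - ip L2_space X Y' = bd1 Q X * cnj (bd0 X') - bd0 X * cnj (bd1 Q X')"
proof -
  obtain f c where f: "bdry f c" "X = cls f" "Y = cls (\<lambda>t. of_real t * f t - c)"
    "f \<in> L2" "(\<lambda>t. of_real t * f t - c) \<in> L2" by (rule max_opE[OF assms(1)])
  obtain g d where g: "bdry g d" "X' = cls g" "Y' = cls (\<lambda>t. of_real t * g t - d)"
    "g \<in> L2" "(\<lambda>t. of_real t * g t - d) \<in> L2" by (rule max_opE[OF assms(2)])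
  let ?u = "\<lambda>t. f t - c * (of_real t * wt t)" and ?v = "\<lambda>t. g t - d * (of_real t * wt t)"
  have i: "integrable \<mu> ?u" "integrable \<mu> (\<lambda>t. cnj (?v t))"
    by (rule regularized_integrable[OF f(1)]
        integrable_bounded_linear[OF bounded_linear_cnj regularized_integrable[OF g(1)]])+
  have ptw: "(of_real t * f t - c) * cnj (g t) - f t * cnj (of_real t * g t - d)
      = cnj d * ?u t - c * cnj (?v t)" for t
    by (simp add: wt_def algebra_simps)
  have "ip L2_space Y X' - ip L2_space X Y'
      = (\<integral>t. (of_real t * f t - c) * cnj (g t) - f t * cnj (of_real t * g t - d) \<partial>\<mu>)"
    unfolding f(2,3) g(2,3) L2_space_simps(5)[OF f(5) g(4)] L2_space_simps(5)[OF f(4) g(5)]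
    by (intro Bochner_Integration.integral_diff[symmetric] L2_mult_cnj_integrable f g)
  also have "\<dots> = (\<integral>t. cnj d * ?u t - c * cnj (?v t) \<partial>\<mu>)" unfolding ptw ..
  also have "\<dots> = cnj d * (\<integral>t. ?u t \<partial>\<mu>) - c * cnj (\<integral>t. ?v t \<partial>\<mu>)"
    using i by (subst Bochner_Integration.integral_diff)
      (simp_all only: integrable_mult_right integral_mult_right_zero Bochner_Integration.integral_cnj)
  also have "\<dots> = bd1 Q X * cnj (bd0 X') - bd0 X * cnj (bd1 Q X')"
    by (simp add: f(2) g(2) bd0_cls[OF f(1)] bd0_cls[OF g(1)] bd1_cls[OF f(1)] bd1_cls[OF g(1)]
        algebra_simps)
  finally show ?thesis .
qed

section \<open>Adjoint and density of the minimal operator\<close>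

lemma min_op_cls:
  assumes "f \<in> L2" "(\<lambda>t. of_real t * f t) \<in> L2" "(\<integral>t. f t \<partial>\<mu>) = 0"
  shows "(cls f, cls (\<lambda>t. of_real t * f t)) \<in> min_op Q"
proof -
  have b: "bdry f 0" using assms by (simp add: bdry_def)
  then have "(cls f, cls (\<lambda>t. of_real t * f t - 0)) \<in> max_op" unfolding max_op_def by blast
  then show ?thesis using bd0_cls[OF b] bd1_cls[OF b, of Q] assms(3) by (simp add: min_op_def)
qed

text \<open>Testing with all decaying functions of integral zero lets \<open>weakly_constant\<close>
  supply the boundary constant; the converse inclusion is Green's identity with vanishing boundary
  values.\<close>

lemma adj_min_op: "adj L2_space (min_op Q) = max_op"
proof (intro equalityI subrelI)
  interpret pre_hilbert_space L2_space by (rule pre_hilbert_L2_space)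
  fix Y Z
  {
    assume YZ: "(Y, Z) \<in> adj L2_space (min_op Q)"
    then obtain g k where g: "g \<in> L2" "Y = cls g" and k: "k \<in> L2" "Z = cls k"
      by (auto simp: adj_def L2_space_simps)
    have eq: "ip L2_space X' Y = ip L2_space X Z" if "(X, X') \<in> min_op Q" for X X'
      using YZ that by (simp add: adj_alt)
    obtain c where c: "AE t in \<mu>. of_real t * g t - k t = c"
    proof (rule weakly_constant[OF g(1) k(1)])
      fix f assume f: "f \<in> L2" "(\<lambda>t. of_real t * f t) \<in> L2" "(\<integral>t. f t \<partial>\<mu>) = 0"
      show "(\<integral>t. of_real t * f t * cnj (g t) \<partial>\<mu>) = (\<integral>t. f t * cnj (k t) \<partial>\<mu>)"
        using eq[OF min_op_cls[OF f]] f g k by (simp add: L2_space_simps)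
    qed
    let ?h = "\<lambda>t. of_real t * g t - c"
    have ae: "AE t in \<mu>. ?h t = k t" using c by eventually_elim (simp add: algebra_simps)
    have hm: "?h \<in> borel_measurable borel" using L2_measurable[OF g(1)] by measurable
    have "integrable \<mu> (\<lambda>t. (cmod (?h t))\<^sup>2)"
    proof (subst integrable_cong_AE[where g = "\<lambda>t. (cmod (k t))\<^sup>2"])
      show "AE t in \<mu>. (cmod (?h t))\<^sup>2 = (cmod (k t))\<^sup>2" using ae by eventually_elim simp
      show "(\<lambda>t. (cmod (?h t))\<^sup>2) \<in> borel_measurable \<mu>" unfolding measurable_eq using hm by measurable
    qed (use L2_integrable[OF k(1)] in auto)
    then have "bdry g c" using hm g(1) by (simp add: bdry_def L2_def)
    moreover have "Z = cls ?h" unfolding k using ae by (intro cls_cong[symmetric])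
    ultimately show "(Y, Z) \<in> max_op" unfolding max_op_def g by blast
  next
    assume YZ: "(Y, Z) \<in> max_op"
    have "ip L2_space X' Y = ip L2_space X Z" if "(X, X') \<in> min_op Q" for X X'
      using green_max_op[of X X' Y Z Q] that YZ by (simp add: min_op_def)
    moreover have "Y \<in> carrier L2_space" "Z \<in> carrier L2_space"
      using YZ linear_max_op unfolding linear_op_def by blast+
    ultimately show "(Y, Z) \<in> adj L2_space (min_op Q)" by (simp add: adj_alt)
  }
qed

lemma dense_min_op: "densely_defined L2_space (min_op Q)"
proof -
  interpret pre_hilbert_space L2_space by (rule pre_hilbert_L2_space)
  show ?thesis
    unfolding densely_defined_def dense_in_iff
  proof (intro ballI allI impI)
    fix X and e :: real assume "X \<in> carrier L2_space" and e: "0 < e"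
    then obtain f where f: "f \<in> L2" "X = cls f" by (auto simp: L2_space_simps)
    obtain g where g: "g \<in> L2" "(\<lambda>t. of_real t * g t) \<in> L2" "(\<integral>t. g t \<partial>\<mu>) = 0"
      "(\<integral>t. (cmod (f t - g t))\<^sup>2 \<partial>\<mu>) < e\<^sup>2"
      using mean_zero_dense[OF f(1), of "e\<^sup>2"] e by auto
    have "X \<ominus>\<^bsub>L2_space\<^esub> cls g = cls (\<lambda>t. f t - g t)"
    proof -
      have "AE t in \<mu>. rep X t - rep (cls g) t = f t - g t"
        unfolding f using rep_cls[OF f(1)] rep_cls[OF g(1)] by eventually_elim simp
      then show ?thesis unfolding L2_space_diff by (rule cls_cong)
    qed
    then have "nrm L2_space (X \<ominus>\<^bsub>L2_space\<^esub> cls g) < sqrt (e\<^sup>2)"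
      using g(4) by (simp only: L2_space_nrm[OF L2_diff[OF f(1) g(1)]] real_sqrt_less_iff)
    moreover have "cls g \<in> Domain (min_op Q) \<inter> carrier L2_space"
      using min_op_cls[OF g(1-3)] g(1) by (auto simp: L2_space_simps)
    ultimately show "\<exists>Y\<in>Domain (min_op Q) \<inter> carrier L2_space. nrm L2_space (X \<ominus>\<^bsub>L2_space\<^esub> Y) < e"
      using e by auto
  qed
qed

text \<open>1 / (t - i) - t / (1 + t^2) = i / (1 + t^2), and the weight has integral one: here the
  normalization of \<mu> fixes the values at i and -i.\<close>

lemma weyl_i: "weyl Q \<i> = of_real Q + \<i>" "weyl Q (- \<i>) = of_real Q - \<i>"
proof -
  have *: "1 / (complex_of_real t - \<i>) - of_real t * wt t = \<i> * wt t"
    "1 / (complex_of_real t - - \<i>) - of_real t * wt t = - \<i> * wt t" for t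
  proof -
    have nz: "complex_of_real t - \<i> \<noteq> 0" "complex_of_real t - - \<i> \<noteq> 0"
      using real_minus_nonzero[of \<i> t] real_minus_nonzero[of "- \<i>" t] by simp_all
    have w: "wt t = 1 / ((complex_of_real t - \<i>) * (complex_of_real t - - \<i>))"
      by (simp add: wt_def power2_eq_square algebra_simps)
    show "1 / (complex_of_real t - \<i>) - of_real t * wt t = \<i> * wt t"
      "1 / (complex_of_real t - - \<i>) - of_real t * wt t = - \<i> * wt t"
      unfolding w using nz by (simp_all add: divide_simps)
  qed
  show "weyl Q \<i> = of_real Q + \<i>" "weyl Q (- \<i>) = of_real Q - \<i>"
    unfolding weyl_def * by (simp_all add: wt_integral)
qed

lemma weyl_cnj: "weyl Q (cnj z) = cnj (weyl Q z)"
proof -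
  have "1 / (complex_of_real t - cnj z) - of_real t * wt t
      = cnj (1 / (complex_of_real t - z) - of_real t * wt t)" for t
    by (simp add: wt_def)
  then show ?thesis
    unfolding weyl_def by (simp only: Bochner_Integration.integral_cnj complex_cnj_add complex_cnj_complex_of_real)
qed

lemma boundary_triple_L2:
  "boundary_triple L2_space (min_op Q) max_op bd0 (bd1 Q) res (weyl Q) Q"
proof (rule boundary_triple.intro[OF hilbert_L2_space], rule boundary_triple_axioms.intro)
  show "linear_op L2_space max_op" by (rule linear_max_op)
  show "min_op Q = {(f, h). (f, h) \<in> max_op \<and> bd0 f = 0 \<and> bd1 Q f = 0}" by (auto simp: min_op_def)
  show "densely_defined L2_space (min_op Q)" by (rule dense_min_op)
  show "adj L2_space (min_op Q) = max_op" by (rule adj_min_op)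
  show "weyl Q \<i> = complex_of_real Q + \<i>" "weyl Q (- \<i>) = complex_of_real Q - \<i>" by (rule weyl_i)+
  show "ip L2_space h g - ip L2_space f k = bd1 Q f * cnj (bd0 g) - bd0 f * cnj (bd1 Q g)"
    if "(f, h) \<in> max_op" "(g, k) \<in> max_op" for f h g k
    using that by (rule green_max_op)
next
  fix X Y X' Y' assume "(X, Y) \<in> max_op" "(X', Y') \<in> max_op"
  then obtain f c g d where f: "bdry f c" "X = cls f" "f \<in> L2" and g: "bdry g d" "X' = cls g" "g \<in> L2"
    by (elim max_opE) blast
  have X: "cls f \<oplus>\<^bsub>L2_space\<^esub> cls g = cls (\<lambda>t. f t + g t)" using f g by (simp add: L2_space_simps)
  show "bd0 (X \<oplus>\<^bsub>L2_space\<^esub> X') = bd0 X + bd0 X'"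
    unfolding f(2) g(2) X bd0_cls[OF bdry_add[OF f(1) g(1)]] bd0_cls[OF f(1)] bd0_cls[OF g(1)] ..
  have "(\<integral>t. f t + g t - (c + d) * (of_real t * wt t) \<partial>\<mu>)
      = (\<integral>t. (f t - c * (of_real t * wt t)) + (g t - d * (of_real t * wt t)) \<partial>\<mu>)"
    by (simp add: algebra_simps)
  also have "\<dots> = (\<integral>t. f t - c * (of_real t * wt t) \<partial>\<mu>) + (\<integral>t. g t - d * (of_real t * wt t) \<partial>\<mu>)"
    by (intro Bochner_Integration.integral_add regularized_integrable f g)
  finally show "bd1 Q (X \<oplus>\<^bsub>L2_space\<^esub> X') = bd1 Q X + bd1 Q X'"
    unfolding f(2) g(2) X bd1_cls[OF bdry_add[OF f(1) g(1)]] bd1_cls[OF f(1)] bd1_cls[OF g(1)]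
    by (simp add: distrib_left)
next
  fix X Y a assume "(X, Y) \<in> max_op"
  then obtain f c where f: "bdry f c" "X = cls f" "f \<in> L2" by (rule max_opE)
  have X: "a \<odot>\<^bsub>L2_space\<^esub> cls f = cls (\<lambda>t. a * f t)" using f by (simp add: L2_space_simps)
  show "bd0 (a \<odot>\<^bsub>L2_space\<^esub> X) = a * bd0 X"
    unfolding f(2) X bd0_cls[OF bdry_scale[OF f(1)]] bd0_cls[OF f(1)] ..
  have "(\<integral>t. a * f t - a * c * (of_real t * wt t) \<partial>\<mu>) = (\<integral>t. a * (f t - c * (of_real t * wt t)) \<partial>\<mu>)"
    by (simp only: right_diff_distrib mult.assoc)
  also have "\<dots> = a * (\<integral>t. f t - c * (of_real t * wt t) \<partial>\<mu>)" by (rule integral_mult_right_zero)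
  finally show "bd1 Q (a \<odot>\<^bsub>L2_space\<^esub> X) = a * bd1 Q X"
    unfolding f(2) X bd1_cls[OF bdry_scale[OF f(1)]] bd1_cls[OF f(1)] by (simp only: distrib_left mult_ac)
next
  fix z assume z: "Im z \<noteq> 0"
  note b = bdry_res[OF z]
  have "of_real t * (1 / (of_real t - z)) - 1 = z * (1 / (of_real t - z))" for t
    using real_minus_nonzero[OF z, of t] by (simp add: field_simps)
  then have "z \<odot>\<^bsub>L2_space\<^esub> res z = cls (\<lambda>t. of_real t * (1 / (of_real t - z)) - 1)"
    unfolding res_def L2_space_simps(4)[OF resolvent_L2[OF z]] by simp
  then show "(res z, z \<odot>\<^bsub>L2_space\<^esub> res z) \<in> max_op"
    using b unfolding max_op_def res_def by blast
  show "bd0 (res z) = 1" unfolding res_def by (rule bd0_cls[OF b])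
  show "bd1 Q (res z) = weyl Q z" unfolding res_def weyl_def bd1_cls[OF b] by simp
  fix X assume "X \<in> carrier L2_space"
  then obtain h where h: "h \<in> L2" "X = cls h" by (auto simp: L2_space_simps)
  \<comment> \<open>The resolvent of multiplication by t: it solves (t - z) f = h with boundary
    constant 0.\<close>
  let ?f = "\<lambda>t. h t / (of_real t - z)"
  have f: "?f \<in> L2" by (rule L2_resolvent_mult[OF h(1) z])
  have tf: "of_real t * ?f t - 0 = h t + z * ?f t" for t
    using real_minus_nonzero[OF z, of t] by (simp add: field_simps)
  have b: "bdry ?f 0" unfolding bdry_def tf by (intro conjI f L2_add h L2_scale)
  have "X \<oplus>\<^bsub>L2_space\<^esub> z \<odot>\<^bsub>L2_space\<^esub> cls ?f = cls (\<lambda>t. of_real t * ?f t - 0)"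
    unfolding tf h(2) using h(1) f by (simp only: L2_space_simps L2_scale)
  then have "(cls ?f, X \<oplus>\<^bsub>L2_space\<^esub> z \<odot>\<^bsub>L2_space\<^esub> cls ?f) \<in> max_op" unfolding max_op_def using b by blast
  then show "\<exists>f. (f, X \<oplus>\<^bsub>L2_space\<^esub> z \<odot>\<^bsub>L2_space\<^esub> f) \<in> max_op \<and> bd0 f = 0" using bd0_cls[OF b] by blast
next
  fix X assume "X \<in> carrier L2_space" and orth: "\<And>z. Im z \<noteq> 0 \<Longrightarrow> ip L2_space X (res z) = 0"
  then obtain m where m: "m \<in> L2" "X = cls m" by (auto simp: L2_space_simps)
  have "has_bochner_integral \<mu> (\<lambda>t. m t / (of_real t - z)) 0" if z: "Im z \<noteq> 0" for z
  proof -
    \<comment> \<open>The second argument of the inner product is conjugated, so orthogonality to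
      \<open>res (cnj z)\<close> yields the integral with 1 / (t - z).\<close>
    have z': "Im (cnj z) \<noteq> 0" using z by simp
    have *: "m t * cnj (1 / (of_real t - cnj z)) = m t / (of_real t - z)" for t by simp
    show ?thesis
      using orth[OF z'] L2_mult_cnj_integrable[OF m(1) resolvent_L2[OF z']]
      unfolding res_def m(2) L2_space_simps(5)[OF m(1) resolvent_L2[OF z']] *
      by (simp add: has_bochner_integral_iff)
  qed
  then have "AE t in \<mu>. m t = 0" by (rule resolvents_total[OF L2_measurable[OF m(1)]])
  then show "X = \<zero>\<^bsub>L2_space\<^esub>" unfolding m L2_space_simps by (rule cls_cong)
qed

end

theorem theorem15:
  fixes Q :: real and V :: "complex \<Rightarrow> complex"
  assumes "Q \<noteq> 0" and "V \<in> class_M Q"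
  shows "\<exists>(\<Theta> :: (real \<Rightarrow> complex) set L_system) gp gm.
    minimal_L_system \<Theta> \<and> realizes \<Theta> V \<and>
    deficiency_vectors \<Theta> gp gm \<and>
    main_op_parameter \<Theta> gp gm (complex_of_real (\<bar>Q\<bar> / sqrt (Q\<^sup>2 + 4))) \<and>
    quasi_kernel_parameter \<Theta> gp gm
      (complex_of_real (Q / \<bar>Q\<bar>) *
        ((- complex_of_real Q + 2 * \<i>) / complex_of_real (sqrt (Q\<^sup>2 + 4))))"
proof -
  obtain \<mu> :: "real measure" where \<mu>: "sets \<mu> = sets borel" "emeasure \<mu> UNIV = \<infinity>"
      "(\<integral>\<^sup>+t. ennreal (1 / (1 + t\<^sup>2)) \<partial>\<mu>) = 1"
    and V: "\<And>z. Im z > 0 \<Longrightarrow> V z = complex_of_real Q +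
        (\<integral>t. (1 / (complex_of_real t - z) - complex_of_real (t / (1 + t\<^sup>2))) \<partial>\<mu>)"
    using assms(2) unfolding class_M_def by blast
  interpret herglotz_measure \<mu> using \<mu> by unfold_locales
  interpret boundary_triple L2_space "min_op Q" max_op bd0 "bd1 Q" res "weyl Q" Q
    by (rule boundary_triple_L2)
  have "complex_of_real (t / (1 + t\<^sup>2)) = of_real t * wt t" for t by (simp add: wt_def)
  then have "realizes sys V"
    using V weyl_cnj by (intro realizes_sys) (simp_all only: weyl_def)
  then show ?thesis
    using minimal_L_system_sys von_Neumann_parameters[OF assms(1)] by metis
qed


end
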